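(* Let $H$ be a closed cocompact subgroup of a locally compact second countable abelian group $G$. Assume that $H$ has no non-trivial compact subgroups. Assume, moreover, that an $H$-action $\mathcal S$ on a probability standard Borel space $(Y,\mathcal C,\nu)$ has the AOP property. Let $\widetilde{\mathcal S}$ be the $G$-action induced from $\mathcal S$ on $Y\times G/H$. Then, for each $E,F\in L^2(Y\times G/H)\ominus L^2(G/H)$, $$\lim_{p\ne q,\ p,q\in\mathscr P,\ p,q\to\infty}\ \sup_{\kappa\in J^e(\widetilde{\mathcal S}^{(p)},\widetilde{\mathcal S}^{(q)})}\left|\int_{Y\times G/H\times Y\times G/H}E\otimes F\,d\kappa\right|=0 .$$
   Context: Let $\mathscr P$ be the set of primes. For a measure-preserving action $\mathcal R=(R_g)$ of an abelian group $K$ and $p\in\mathbb Z$, $\mathcal R^{(p)}$ is the $K$-action $R^{(p)}_g=R_{g^p}$. For two measure-preserving $K$-actions $\mathcal R,\mathcal R'$ on probability spaces, $J^e(\mathcal R,\mathcal R')$ is the set of ergodic joinings, i.e. probability measures on the product space, invariant and ergodic under the diagonal action $(R_g\times R'_g)_{g\in K}$, whose marginals are the given measures (a supremum over an empty set is $0$). An ergodic $H$-action $\mathcal S$ on $(Y,\mathcal C,\nu)$, with $\mathcal S^{(p)}$ ergodic for every prime $p$, has the AOP property if for all $f,g\in L^2_0(Y,\nu)$ (zero mean functions) $$\lim_{p\ne q,\ p,q\in\mathscr P,\ p,q\to\infty}\ \sup_{\kappa\in J^e(\mathcal S^{(p)},\mathcal S^{(q)})}\left|\int_{Y\times Y}f\otimes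 g\,d\kappa\right|=0 .$$ Induced action: let $m_{G/H}$ be the $G$-invariant probability measure on $G/H$, and let $s:G/H\to G$ be a Borel selector of the quotient map $\pi:G\to G/H$ (i.e. $\pi\circ s=\mathrm{Id}$). Put $\theta(g,xH)=s(gxH)^{-1}g\,s(xH)\in H$. The $G$-action induced from $\mathcal S=(S_h)_{h\in H}$ is the action $\widetilde{\mathcal S}=(\widetilde S_g)_{g\in G}$ on $(Y\times G/H,\nu\otimes m_{G/H})$ given by $\widetilde S_g(y,xH)=(S_{\theta(g,xH)}y,\,gxH)$. (Up to isomorphism over $G/H$ it does not depend on $s$.) $L^2(G/H)$ is regarded as the subspace of $L^2(Y\times G/H)$ of functions depending only on the second coordinate, and $\ominus$ denotes orthogonal complement. *)

theory Defs
  imports "HOL-Probability.Probability" "HOL-Computational_Algebra.Primes"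
begin

(* Abelian groups are written additively: the ambient group is a type 'g of class
   topological_ab_group_add, and an acting group K is a subgroup of it, given as a set. *)

definition add_subgroup :: "'g::ab_group_add set \<Rightarrow> bool" where
  "add_subgroup K \<longleftrightarrow> 0 \<in> K \<and> (\<forall>x\<in>K. \<forall>y\<in>K. x + y \<in> K) \<and> (\<forall>x\<in>K. - x \<in> K)"

definition no_nontrivial_compact_subgroups ::
    "'g::{topological_space, ab_group_add} set \<Rightarrow> bool" where
  "no_nontrivial_compact_subgroups H \<longleftrightarrow>
     (\<forall>C. C \<subseteq> H \<and> add_subgroup C \<and> compact C \<longrightarrow> C = {0})"


definition borel_of :: "'a topology \<Rightarrow> 'a measure" where
  "borel_of T = sigma (topspace T) {U. openin T U}"

definition standard_borel :: "'a measure \<Rightarrow> bool" where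
  "standard_borel M \<longleftrightarrow>
     (\<exists>T. completely_metrizable_space T \<and> second_countable T \<and> topspace T = space M \<and>
          sets M = sets (borel_of T))"


(* The maps R g matter only for g \<in> K and only on space M.  The action is a genuine
   (everywhere defined) one, jointly measurable in the group variable and the point. *)

definition mp_action ::
    "'g::{topological_space, ab_group_add} set \<Rightarrow> 'x measure \<Rightarrow> ('g \<Rightarrow> 'x \<Rightarrow> 'x) \<Rightarrow> bool" where
  "mp_action K M R \<longleftrightarrow>
     (\<lambda>(g, x). R g x) \<in> measurable (restrict_space borel K \<Otimes>\<^sub>M M) M \<and>
     (\<forall>x\<in>space M. R 0 x = x) \<and>
     (\<forall>g\<in>K. \<forall>h\<in>K. \<forall>x\<in>space M. R (g + h) x = R g (R h x)) \<and>
     (\<forall>g\<in>K. distr M M (R g) = M)"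

definition ergodic :: "'g set \<Rightarrow> 'x measure \<Rightarrow> ('g \<Rightarrow> 'x \<Rightarrow> 'x) \<Rightarrow> bool" where
  "ergodic K M R \<longleftrightarrow>
     (\<forall>A\<in>sets M. (\<forall>g\<in>K. AE x in M. R g x \<in> A \<longleftrightarrow> x \<in> A) \<longrightarrow>
        measure M A = 0 \<or> measure M A = 1)"

(* The group element written g^p multiplicatively is the p-fold sum of g. *)

definition pow_action :: "('g::ab_group_add \<Rightarrow> 'x \<Rightarrow> 'x) \<Rightarrow> nat \<Rightarrow> 'g \<Rightarrow> 'x \<Rightarrow> 'x" where
  "pow_action R p g = R (\<Sum>i<p. g)"

definition ergodic_joinings ::
    "'g set \<Rightarrow> 'x measure \<Rightarrow> ('g \<Rightarrow> 'x \<Rightarrow> 'x) \<Rightarrow> 'y measure \<Rightarrow> ('g \<Rightarrow> 'y \<Rightarrow> 'y) \<Rightarrow>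
     ('x \<times> 'y) measure set" where
  "ergodic_joinings K M R M' R' =
     {\<kappa>. prob_space \<kappa> \<and> sets \<kappa> = sets (M \<Otimes>\<^sub>M M') \<and>
         distr \<kappa> M fst = M \<and> distr \<kappa> M' snd = M' \<and>
         (\<forall>g\<in>K. distr \<kappa> \<kappa> (map_prod (R g) (R' g)) = \<kappa>) \<and>
         ergodic K \<kappa> (\<lambda>g. map_prod (R g) (R' g))}"


definition L2 :: "'x measure \<Rightarrow> ('x \<Rightarrow> complex) set" where
  "L2 M = {f \<in> borel_measurable M. integrable M (\<lambda>x. (cmod (f x))\<^sup>2)}"

definition L2_0 :: "'x measure \<Rightarrow> ('x \<Rightarrow> complex) set" where
  "L2_0 M = {f \<in> L2 M. (\<integral>x. f x \<partial>M) = 0}"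

definition L2_ominus_snd :: "'y measure \<Rightarrow> 'c measure \<Rightarrow> ('y \<times> 'c \<Rightarrow> complex) set" where
  "L2_ominus_snd M N =
     {E \<in> L2 (M \<Otimes>\<^sub>M N). \<forall>\<phi>\<in>L2 N. (\<integral>z. E z * cnj (\<phi> (snd z)) \<partial>(M \<Otimes>\<^sub>M N)) = 0}"


definition distinct_primes_at_top :: "(nat \<times> nat) filter" where
  "distinct_primes_at_top =
     inf (at_top \<times>\<^sub>F at_top) (principal {(p, q). prime p \<and> prime q \<and> p \<noteq> q})"

(* The supremum is taken in ennreal, where the supremum of the empty set is 0. *)

definition joining_sup ::
    "'g::ab_group_add set \<Rightarrow> 'x measure \<Rightarrow> ('g \<Rightarrow> 'x \<Rightarrow> 'x) \<Rightarrow> nat \<Rightarrow> nat \<Rightarrow>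
     ('x \<Rightarrow> complex) \<Rightarrow> ('x \<Rightarrow> complex) \<Rightarrow> ennreal" where
  "joining_sup K M R p q f g =
     (SUP \<kappa> \<in> ergodic_joinings K M (pow_action R p) M (pow_action R q).
        ennreal (cmod (\<integral>z. f (fst z) * g (snd z) \<partial>\<kappa>)))"

definition AOP ::
    "'g::{topological_space, ab_group_add} set \<Rightarrow> 'y measure \<Rightarrow> ('g \<Rightarrow> 'y \<Rightarrow> 'y) \<Rightarrow> bool" where
  "AOP K M R \<longleftrightarrow>
     mp_action K M R \<and> ergodic K M R \<and> (\<forall>p. prime p \<longrightarrow> ergodic K M (pow_action R p)) \<and>
     (\<forall>f\<in>L2_0 M. \<forall>g\<in>L2_0 M.
        ((\<lambda>(p, q). joining_sup K M R p q f g) \<longlongrightarrow> 0) distinct_primes_at_top)"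


definition coset :: "'g::ab_group_add set \<Rightarrow> 'g \<Rightarrow> 'g set" where
  "coset H x = (+) x ` H"

definition quot_topology :: "'g::{topological_space, ab_group_add} set \<Rightarrow> 'g set topology" where
  "quot_topology H = topology (\<lambda>U. U \<subseteq> range (coset H) \<and> open (coset H -` U))"

lemma openin_quot_topology:
  "openin (quot_topology H) U \<longleftrightarrow> U \<subseteq> range (coset H) \<and> open (coset H -` U)"
proof -
  have "istopology (\<lambda>U. U \<subseteq> range (coset H) \<and> open (coset H -` U))"
    unfolding istopology_def by (auto simp: vimage_Union)
  then show ?thesis
    unfolding quot_topology_def by (simp add: topology_inverse')
qed

lemma topspace_quot_topology: "topspace (quot_topology H) = range (coset H)"
proof
  show "topspace (quot_topology H) \<subseteq> range (coset H)"
    using openin_topspace[of "quot_topology H"] by (simp only: openin_quot_topology)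
  have "openin (quot_topology H) (range (coset H))"
    by (auto simp: openin_quot_topology vimage_def)
  then show "range (coset H) \<subseteq> topspace (quot_topology H)"
    by (rule openin_subset)
qed

lemma quotient_map_coset: "quotient_map euclidean (quot_topology H) (coset H)"
  by (auto simp: quotient_map_def topspace_quot_topology openin_quot_topology vimage_def)

definition quot_invariant_prob ::
    "'g::{topological_space, ab_group_add} set \<Rightarrow> 'g set measure \<Rightarrow> bool" where
  "quot_invariant_prob H m \<longleftrightarrow>
     prob_space m \<and> space m = range (coset H) \<and> sets m = sets (borel_of (quot_topology H)) \<and>
     (\<forall>g. distr m m (\<lambda>c. (+) g ` c) = m)"

definition borel_selector ::
    "'g::{topological_space, ab_group_add} set \<Rightarrow> ('g set \<Rightarrow> 'g) \<Rightarrow> bool" where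
  "borel_selector H s \<longleftrightarrow>
     s \<in> measurable (borel_of (quot_topology H)) borel \<and>
     (\<forall>c\<in>range (coset H). coset H (s c) = c)"

definition cocycle :: "('g::ab_group_add set \<Rightarrow> 'g) \<Rightarrow> 'g \<Rightarrow> 'g set \<Rightarrow> 'g" where
  "cocycle s g c = - s ((+) g ` c) + g + s c"

definition induced_action ::
    "('g::ab_group_add set \<Rightarrow> 'g) \<Rightarrow> ('g \<Rightarrow> 'y \<Rightarrow> 'y) \<Rightarrow> 'g \<Rightarrow> 'y \<times> 'g set \<Rightarrow> 'y \<times> 'g set" where
  "induced_action s S g = (\<lambda>(y, c). (S (cocycle s g c) y, (+) g ` c))"

end

theory Submission
  imports Defs
begin

text \<open>A joining of the powers \<open>p\<close> and \<open>q\<close> of the induced action can be tested against the base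
action. An element \<open>h\<close> of \<open>H\<close> fixes every coset, and the cocycle takes the
value \<open>h\<close> on it, so \<open>H\<close> acts on \<open>Y \<times> G/H\<close> by \<open>S\<close> in the first coordinate only. Let \<open>\<kappa>\<close> be a
joining and \<open>C\<close>, \<open>D\<close> measurable sets of cosets. The set of points whose two coset coordinates
lie in \<open>C\<close> and \<open>D\<close> is then invariant under \<open>H\<close>; conditioning \<open>\<kappa>\<close> on it and projecting to
\<open>Y \<times> Y\<close> gives a measure invariant under the powers \<open>p\<close> and \<open>q\<close> of \<open>S\<close>. Its marginals are
invariant and absolutely continuous with respect to \<open>\<nu>\<close>, hence equal to \<open>\<nu>\<close>, because the prime
powers of \<open>S\<close> are ergodic. So it is a joining of the two powers of \<open>S\<close>
(\<open>conditioned_joining\<close>).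

This joining need not be ergodic, while the AOP property controls only ergodic ones. The value
of a joining on a fixed rectangle is, however, dominated by its value for some ergodic joining
(\<open>ergodic_joining_dominates_on_rectangle\<close>). Joinings are identified with finitely additive
contents on the ring of finite unions of rectangles: these form a compact convex set in a
product of intervals, and each of them is countably additive because standard Borel measures
are inner regular with respect to compact sets (\<open>joint_content_extends\<close>). A coordinate is
maximized at an extreme point of this set (\<open>compact_extreme_point_maximizing_coordinate\<close>), and
an extreme joining is ergodic, since otherwise conditioning on an invariant set and on its
complement would split it. Passing to the complement of one side of the rectangle turns the
one-sided bound into a bound of \<open>\<bar>\<kappa> (A \<times> B) - \<nu> A * \<nu> B\<bar>\<close>.

Consequently, the integral of a product of functions \<open>(1\<^sub>A - \<nu> A) \<otimes> 1\<^sub>C\<close> and \<open>(1\<^sub>B - \<nu> B) \<otimes> 1\<^sub>D\<close>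
against any joining of the induced powers is at most the supremum in the definition of AOP for
\<open>1\<^sub>A - \<nu> A\<close> and \<open>1\<^sub>B - \<nu> B\<close> (\<open>induced_joining_correlation\<close>). Linear combinations of such
functions are dense in the orthogonal complement of \<open>L\<^sup>2(G/H)\<close>, and by the Cauchy-Schwarz
inequality an approximation in \<open>L\<^sup>2\<close> perturbs all joining integrals by a small amount,
uniformly over the joinings.\<close>

section \<open>Standard Borel spaces and compact sets\<close>

text \<open>Inner regularity with respect to compact sets, with compactness pulled back from \<open>\<nat> \<Rightarrow> \<real>\<close>: a
standard Borel space has a Polish topology on its carrier, while \<open>\<nat> \<Rightarrow> \<real>\<close> is Polish as a type.
As \<open>\<phi>\<close> is injective, the inclusion \<open>C \<subseteq> \<phi> ` A\<close> makes the preimage of \<open>C\<close> a subset of \<open>A\<close> and puts every point of \<open>C\<close> in the range of \<open>\<phi>\<close>; families of such preimages therefore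
inherit the finite intersection property of compact sets.\<close>

definition compactly_coded :: "'a measure \<Rightarrow> ('a \<Rightarrow> nat \<Rightarrow> real) \<Rightarrow> bool" where
  "compactly_coded M \<phi> \<longleftrightarrow> inj_on \<phi> (space M) \<and> \<phi> \<in> borel_measurable M \<and>
     (\<forall>A\<in>sets M. \<forall>e>0. \<exists>C. compact C \<and> C \<subseteq> \<phi> ` A \<and> measure M (A - \<phi> -` C) \<le> e)"

text \<open>The coordinates of \<open>\<phi>\<close> are the distances to the points of a countable dense set. They separate
points and generate the topology, so \<open>\<phi>\<close> is an embedding; its range is completely metrizable,
hence a \<open>G\<^sub>\<delta>\<close> set, and in particular Borel.\<close>

lemma polish_coding:
  assumes T: "completely_metrizable_space T" "second_countable T" and ne: "topspace T \<noteq> {}"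
  obtains \<phi> :: "'a \<Rightarrow> nat \<Rightarrow> real"
  where "inj_on \<phi> (topspace T)" "continuous_map T euclidean \<phi>"
    "\<phi> ` topspace T \<in> sets borel"
    "\<And>U. openin T U \<Longrightarrow> \<exists>V. open V \<and> U = topspace T \<inter> \<phi> -` V"
proof -
  obtain M d where Md: "Metric_space M d" and TM: "T = Metric_space.mtopology M d"
    using T(1) unfolding completely_metrizable_space_def by blast
  interpret Metric_space M d by (rule Md)
  obtain D where D: "countable D" "D \<subseteq> topspace T" "T closure_of D = topspace T"
    using second_countable_imp_separable_space[OF T(2)] unfolding separable_space_def by blast
  have Dne: "D \<noteq> {}" using D(3) ne by (metis closure_of_empty)
  define e where "e = from_nat_into D"
  have eD: "range e = D" using D(1) Dne by (simp add: e_def range_from_nat_into)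
  have eM: "e i \<in> M" for i using eD D(2) TM by auto
  have tM: "topspace T = M" by (simp add: TM)
  have dense: "\<exists>i. d x (e i) < r" if xr: "x \<in> M" "r > 0" for x r
  proof -
    have "x \<in> mtopology closure_of D" using D(3) xr tM TM by simp
    then obtain y where "y \<in> D" "y \<in> mball x r" using xr unfolding metric_closure_of by blast
    moreover obtain i where "y = e i" using eD \<open>y \<in> D\<close> by blast
    ultimately show ?thesis by auto
  qed
  define \<phi> where "\<phi> x i = d x (e i)" for x i
  have op: "\<exists>V. open V \<and> U = topspace T \<inter> \<phi> -` V" if U: "openin T U" for U
  proof -
    have "\<exists>V. open V \<and> \<phi> x \<in> V \<and> topspace T \<inter> \<phi> -` V \<subseteq> U" if x: "x \<in> U" for x
    proof -
      have xM: "x \<in> M" using U x openin_subset tM by blast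
      obtain r where r: "r > 0" "mball x r \<subseteq> U"
        using U x TM openin_mtopology by metis
      obtain i where i: "d x (e i) < r / 3" using dense[OF xM, of "r/3"] r by auto
      let ?V = "{f. f i < r/3} :: (nat \<Rightarrow> real) set"
      have "open ?V" by (intro open_Collect_less continuous_on_const continuous_on_product_coordinates)
      moreover have "topspace T \<inter> \<phi> -` ?V \<subseteq> U"
      proof
        fix y assume "y \<in> topspace T \<inter> \<phi> -` ?V"
        then have y: "y \<in> M" "d y (e i) < r/3" by (auto simp: tM \<phi>_def)
        have "d x y \<le> d x (e i) + d (e i) y" using triangle xM y eM by blast
        also have "\<dots> < r" using i y r by (simp add: commute)
        finally show "y \<in> U" using r xM y by auto
      qed
      ultimately show ?thesis using i by (intro exI[of _ ?V]) (auto simp: \<phi>_def)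
    qed
    then obtain V where V: "\<And>x. x \<in> U \<Longrightarrow> open (V x) \<and> \<phi> x \<in> V x \<and> topspace T \<inter> \<phi> -` V x \<subseteq> U"
      by metis
    have "open (\<Union>x\<in>U. V x)" using V by auto
    moreover have "U = topspace T \<inter> \<phi> -` (\<Union>x\<in>U. V x)"
      using V openin_subset[OF U] by auto
    ultimately show ?thesis by blast
  qed
  have inj: "inj_on \<phi> (topspace T)"
  proof (rule inj_onI)
    fix x y assume xy: "x \<in> topspace T" "y \<in> topspace T" "\<phi> x = \<phi> y"
    show "x = y"
    proof (rule ccontr)
      assume "x \<noteq> y"
      then have "openin T (mball x (d x y))" "x \<in> mball x (d x y)" "y \<notin> mball x (d x y)"
        using xy tM TM by auto
      with op obtain V where "mball x (d x y) = topspace T \<inter> \<phi> -` V" by blast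
      then show False using xy \<open>x \<in> mball x (d x y)\<close> \<open>y \<notin> mball x (d x y)\<close> by auto
    qed
  qed
  have cont: "continuous_map T euclidean \<phi>"
  proof -
    have "continuous_map T euclideanreal (\<lambda>x. \<phi> x i)" for i
      unfolding TM continuous_map_from_metric
    proof (intro conjI ballI allI impI)
      fix a U assume a: "a \<in> M" and U: "openin euclideanreal U \<and> \<phi> a i \<in> U"
      then obtain r where r: "r > 0" "ball (\<phi> a i) r \<subseteq> U"
        by (meson open_contains_ball open_openin)
      have "\<bar>d a (e i) - d x (e i)\<bar> \<le> d a x" if "x \<in> M" for x
        using triangle[OF a that eM[of i]] triangle[OF that a eM[of i]] by (simp add: commute)
      then have "\<phi> x i \<in> U" if "x \<in> M" "d a x < r" for x
        using that r(2) by (force simp: \<phi>_def dist_real_def)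
      then show "\<exists>r>0. \<forall>x. x \<in> M \<and> d a x < r \<longrightarrow> \<phi> x i \<in> U" using r(1) by blast
    qed auto
    then show ?thesis
      unfolding euclidean_product_topology[symmetric] by (simp add: continuous_map_componentwise_UNIV)
  qed
  have hom: "homeomorphic_map T (subtopology euclidean (\<phi> ` topspace T)) \<phi>"
  proof (rule bijective_open_imp_homeomorphic_map)
    show "continuous_map T (subtopology euclidean (\<phi> ` topspace T)) \<phi>"
      using cont by (auto simp: continuous_map_in_subtopology)
    show "open_map T (subtopology euclidean (\<phi> ` topspace T)) \<phi>"
      unfolding open_map_def
    proof (intro allI impI)
      fix U assume "openin T U"
      then obtain V where V: "open V" "U = topspace T \<inter> \<phi> -` V" using op by blast
      then have "\<phi> ` U = \<phi> ` topspace T \<inter> V" by auto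
      then show "openin (subtopology euclidean (\<phi> ` topspace T)) (\<phi> ` U)"
        using V by (auto simp: openin_open)
    qed
  qed (use inj in auto)
  then have "completely_metrizable_space (subtopology euclidean (\<phi> ` topspace T))"
    using T(1) homeomorphic_completely_metrizable_space homeomorphic_map_imp_homeomorphic_space by blast
  then have "gdelta_in euclidean (\<phi> ` topspace T)"
    using completely_metrizable_space_eq_gdelta_in[OF completely_metrizable_space_euclidean] by (metis subset_UNIV topspace_euclidean)
  then have "(countable intersection_of open) (\<phi> ` topspace T)"
    by (simp add: gdelta_in_alt)
  then obtain \<U> where \<U>: "countable \<U>" "\<U> \<subseteq> Collect open" "\<Inter>\<U> = \<phi> ` topspace T"
    unfolding intersection_of_def by auto
  have "\<Inter>\<U> \<in> sets borel"
  proof (cases "\<U> = {}")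
    case False
    then have "(\<Inter>U\<in>\<U>. U) \<in> sets borel" using \<U> by (intro sets.countable_INT'') auto
    then show ?thesis by simp
  qed simp
  then have "\<phi> ` topspace T \<in> sets borel" using \<U>(3) by simp
  then show thesis using that inj cont op by blast
qed

lemma standard_borel_compactly_coded:
  assumes sb: "standard_borel M" and M: "finite_measure M" and ne: "space M \<noteq> {}"
  shows "\<exists>\<phi>. compactly_coded M \<phi>"
proof -
  interpret finite_measure M by fact
  obtain T where T: "completely_metrizable_space T" "second_countable T"
    and sp: "topspace T = space M" and se: "sets M = sets (borel_of T)"
    using sb unfolding standard_borel_def by blast
  obtain \<phi> :: "'a \<Rightarrow> nat \<Rightarrow> real" where \<phi>: "inj_on \<phi> (topspace T)" "continuous_map T euclidean \<phi>"
    "\<phi> ` topspace T \<in> sets borel"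
    "\<And>U. openin T U \<Longrightarrow> \<exists>V. open V \<and> U = topspace T \<inter> \<phi> -` V"
    using polish_coding[OF T] ne sp by metis
  have sM: "sets M = sigma_sets (space M) {U. openin T U}"
    unfolding se borel_of_def using openin_subset sp by (subst sets_measure_of) auto
  have m: "\<phi> \<in> borel_measurable M"
  proof (rule borel_measurableI)
    fix S :: "(nat \<Rightarrow> real) set" assume "open S"
    then have "openin T {x \<in> topspace T. \<phi> x \<in> S}" using \<phi>(2) by (auto simp: continuous_map_def)
    then have "{x \<in> topspace T. \<phi> x \<in> S} \<in> sets M" by (simp add: sM sigma_sets.Basic)
    moreover have "{x \<in> topspace T. \<phi> x \<in> S} = \<phi> -` S \<inter> space M" using sp by auto
    ultimately show "\<phi> -` S \<inter> space M \<in> sets M" by simp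
  qed
  have pre: "\<exists>B\<in>sets borel. A = \<phi> -` B \<inter> space M" if "A \<in> sets M" for A
    using that unfolding sM
  proof induction
    case (Basic a)
    then obtain V where "open V" "a = topspace T \<inter> \<phi> -` V" using \<phi>(4) by auto
    then show ?case using sp by (intro bexI[of _ V]) auto
  next
    case Empty
    then show ?case by (intro bexI[of _ "{}"]) auto
  next
    case (Compl a)
    then obtain B where "B \<in> sets borel" "a = \<phi> -` B \<inter> space M" by auto
    then show ?case by (intro bexI[of _ "- B"]) auto
  next
    case (Union a)
    then obtain B where "\<And>i::nat. B i \<in> sets borel \<and> a i = \<phi> -` B i \<inter> space M" by metis
    then show ?case by (intro bexI[of _ "\<Union>i. B i"]) auto
  qed
  have "\<exists>C. compact C \<and> C \<subseteq> \<phi> ` A \<and> measure M (A - \<phi> -` C) \<le> e" if A: "A \<in> sets M" and e: "e > 0" for A e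
  proof -
    obtain B where B: "B \<in> sets borel" "A = \<phi> -` B \<inter> space M" using pre[OF A] by auto
    define B' where "B' = B \<inter> \<phi> ` space M"
    have B': "B' \<in> sets borel" using B \<phi>(3) sp by (auto simp: B'_def)
    have AB: "A = \<phi> -` B' \<inter> space M" and im: "\<phi> ` A = B'" using B by (auto simp: B'_def)
    \<comment> \<open>inner regularity of the image measure gives the compact set\<close>
    let ?N = "distr M borel \<phi>"
    interpret N: finite_measure ?N by (rule finite_measure_distr[OF m])
    have "emeasure ?N B' = (SUP K \<in> {K. K \<subseteq> B' \<and> compact K}. emeasure ?N K)"
      by (rule inner_regular) (use B' N.emeasure_finite in auto)
    moreover have "{K. K \<subseteq> B' \<and> compact K} \<noteq> {}" by (auto intro: exI[of _ "{}"])
    ultimately have "\<exists>K\<in>{K. K \<subseteq> B' \<and> compact K}. emeasure ?N B' < emeasure ?N K + ennreal e"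
      using N.emeasure_finite[of B'] by (intro SUP_approx_ennreal[OF e]) (auto simp: infinity_ennreal_def)
    then obtain K where "K \<in> {K. K \<subseteq> B' \<and> compact K}" "emeasure ?N B' < emeasure ?N K + ennreal e" by blast
    then have K: "K \<subseteq> B'" "compact K" "emeasure ?N B' \<le> emeasure ?N K + ennreal e"
      by (auto simp: less_imp_le)
    have "closed K" using K(2) by (rule compact_imp_closed)
    then have Kb: "K \<in> sets borel" by simp
    have "measure M A = measure ?N B'" using B' AB by (simp add: measure_distr[OF m])
    moreover have "measure M (A \<inter> \<phi> -` K) = measure ?N K"
      using Kb AB K by (simp add: measure_distr[OF m]) (rule arg_cong[where f="measure M"], auto)
    moreover have "measure ?N B' \<le> measure ?N K + e"
      using K(3) e by (simp add: N.emeasure_eq_measure ennreal_plus[symmetric] del: ennreal_plus)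
    moreover have "A \<inter> \<phi> -` K \<in> sets M"
    proof -
      have "A \<inter> \<phi> -` K = A \<inter> (\<phi> -` K \<inter> space M)" using AB by auto
      then show ?thesis using A measurable_sets[OF m Kb] by simp
    qed
    moreover have "A - \<phi> -` K = A - (A \<inter> \<phi> -` K)" by auto
    ultimately have "measure M (A - \<phi> -` K) \<le> e"
      using A by (simp add: finite_measure_Diff)
    then show ?thesis using K im by auto
  qed
  then show ?thesis unfolding compactly_coded_def using \<phi>(1) sp m by (intro exI[of _ \<phi>]) auto
qed

section \<open>Countable additivity of contents with given marginals\<close>

definition rectangles :: "'a measure \<Rightarrow> 'b measure \<Rightarrow> ('a \<times> 'b) set set" where
  "rectangles M N = {A \<times> B | A B. A \<in> sets M \<and> B \<in> sets N}"

lemma semiring_rectangles: "semiring_of_sets (space M \<times> space N) (rectangles M N)"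
proof
  show "rectangles M N \<subseteq> Pow (space M \<times> space N)"
    unfolding rectangles_def by (auto dest: sets.sets_into_space)
  show "{} \<in> rectangles M N" unfolding rectangles_def by blast
  show "a \<inter> b \<in> rectangles M N" if "a \<in> rectangles M N" "b \<in> rectangles M N" for a b
  proof -
    obtain A B A' B' where ab: "a = A \<times> B" "b = A' \<times> B'"
      and s: "A \<in> sets M" "B \<in> sets N" "A' \<in> sets M" "B' \<in> sets N"
      using \<open>a \<in> rectangles M N\<close> \<open>b \<in> rectangles M N\<close> unfolding rectangles_def by blast
    have "a \<inter> b = (A \<inter> A') \<times> (B \<inter> B')" using ab by auto
    then show ?thesis using s unfolding rectangles_def by blast
  qed
  show "\<exists>C\<subseteq>rectangles M N. finite C \<and> disjoint C \<and> a - b = \<Union> C"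
    if "a \<in> rectangles M N" "b \<in> rectangles M N" for a b
  proof -
    obtain A B A' B' where ab: "a = A \<times> B" "b = A' \<times> B'"
      and s: "A \<in> sets M" "B \<in> sets N" "A' \<in> sets M" "B' \<in> sets N"
      using \<open>a \<in> rectangles M N\<close> \<open>b \<in> rectangles M N\<close> unfolding rectangles_def by blast
    let ?C = "{(A - A') \<times> B, (A \<inter> A') \<times> (B - B')}"
    have "?C \<subseteq> rectangles M N" unfolding rectangles_def using s by blast
    moreover have "disjoint ?C" by (auto simp: disjoint_def)
    moreover have "a - b = \<Union>?C" unfolding ab by auto
    ultimately show ?thesis by (meson finite.emptyI finite.insertI)
  qed
qed

text \<open>The members are the finite unions of rectangles. A content is recorded on this ring rather than
on rectangles alone, so that additivity can be imposed by equations between coordinates.\<close>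

definition rectangle_ring :: "'a measure \<Rightarrow> 'b measure \<Rightarrow> ('a \<times> 'b) set set" where
  "rectangle_ring M N = semiring_of_sets.generated_ring (rectangles M N)"

lemma ring_rectangle_ring: "ring_of_sets (space M \<times> space N) (rectangle_ring M N)"
  unfolding rectangle_ring_def by (rule semiring_of_sets.generating_ring[OF semiring_rectangles])

lemma Times_in_rectangle_ring [intro]:
  "A \<in> sets M \<Longrightarrow> B \<in> sets N \<Longrightarrow> A \<times> B \<in> rectangle_ring M N"
  unfolding rectangle_ring_def
  by (rule semiring_of_sets.generated_ringI_Basic[OF semiring_rectangles]) (auto simp: rectangles_def)

lemma rectangle_ringE:
  assumes "X \<in> rectangle_ring M N"
  obtains C where "finite C" "C \<subseteq> rectangles M N" "X = \<Union>C"
  using assms unfolding rectangle_ring_def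
  by (metis semiring_of_sets.generated_ringE[OF semiring_rectangles])

lemma sets_pair_rectangle_ring:
  "sets (M \<Otimes>\<^sub>M N) = sigma_sets (space M \<times> space N) (rectangle_ring M N)"
  unfolding rectangle_ring_def semiring_of_sets.sigma_sets_generated_ring_eq[OF semiring_rectangles]
  by (simp add: sets_pair_measure rectangles_def)

lemma rectangle_ring_subset_sets: "rectangle_ring M N \<subseteq> sets (M \<Otimes>\<^sub>M N)"
  unfolding sets_pair_rectangle_ring by auto

text \<open>Nonnegativity is required of all sets, including those outside the ring, where a content will be
set to \<open>0\<close>; this keeps the space of contents inside a product of intervals.\<close>

definition joint_content :: "'a measure \<Rightarrow> 'b measure \<Rightarrow> (('a \<times> 'b) set \<Rightarrow> real) \<Rightarrow> bool" where
  "joint_content M N b \<longleftrightarrow> (\<forall>X. 0 \<le> b X) \<and>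
     (\<forall>X\<in>rectangle_ring M N. \<forall>Y\<in>rectangle_ring M N. X \<inter> Y = {} \<longrightarrow> b (X \<union> Y) = b X + b Y) \<and>
     (\<forall>A\<in>sets M. b (A \<times> space N) = measure M A) \<and>
     (\<forall>B\<in>sets N. b (space M \<times> B) = measure N B)"

lemma joint_content_positive_additive:
  assumes "joint_content M N b"
  shows "positive (rectangle_ring M N) (\<lambda>X. ennreal (b X))" "additive (rectangle_ring M N) (\<lambda>X. ennreal (b X))"
proof -
  interpret ring_of_sets "space M \<times> space N" "rectangle_ring M N" by (rule ring_rectangle_ring)
  have "b ({} \<union> {}) = b {} + b {}" using assms unfolding joint_content_def by blast
  then have "b {} = 0" by simp
  then show "positive (rectangle_ring M N) (\<lambda>X. ennreal (b X))" by (simp add: positive_def)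
  show "additive (rectangle_ring M N) (\<lambda>X. ennreal (b X))"
    using assms unfolding joint_content_def additive_def by (auto simp: ennreal_plus)
qed

text \<open>For a rectangle \<open>A \<times> B\<close> the error is bounded by the marginals: \<open>A \<times> B\<close> minus \<open>K \<times> L\<close> lies in the
union of \<open>(A - K) \<times> space N\<close> and \<open>space M \<times> (B - L)\<close>. Finite unions follow by induction.\<close>

lemma joint_content_inner_compact:
  assumes b: "joint_content M N b"
    and \<phi>: "compactly_coded M \<phi>" and \<psi>: "compactly_coded N \<psi>"
    and X: "X \<in> rectangle_ring M N" and e: "0 < e"
  obtains C where "compact C" "C \<subseteq> map_prod \<phi> \<psi> ` X"
    "map_prod \<phi> \<psi> -` C \<inter> (space M \<times> space N) \<in> rectangle_ring M N"
    "b (X - map_prod \<phi> \<psi> -` C) \<le> e"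
proof -
  interpret R: ring_of_sets "space M \<times> space N" "rectangle_ring M N" by (rule ring_rectangle_ring)
  let ?\<Phi> = "map_prod \<phi> \<psi>" and ?f = "\<lambda>X. ennreal (b X)"
  note pa = joint_content_positive_additive[OF b]
  have mono: "b X \<le> b Y" if "X \<in> rectangle_ring M N" "Y \<in> rectangle_ring M N" "X \<subseteq> Y" for X Y
    using R.additive_increasing[OF pa] that b unfolding increasing_def joint_content_def
    by (metis ennreal_le_iff)
  have sub: "b (X \<union> Y) \<le> b X + b Y" if XY: "X \<in> rectangle_ring M N" "Y \<in> rectangle_ring M N" for X Y
  proof -
    have "b (X \<union> Y) = b (X \<union> (Y - X))" by (simp add: Un_Diff_cancel)
    also have "\<dots> = b X + b (Y - X)" using XY b unfolding joint_content_def by blast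
    also have "\<dots> \<le> b X + b Y" using mono[of "Y - X" Y] XY by auto
    finally show ?thesis .
  qed
  obtain \<R> where \<R>: "finite \<R>" "\<R> \<subseteq> rectangles M N" "X = \<Union>\<R>" using X by (rule rectangle_ringE)
  have "\<forall>e>0. \<exists>C. compact C \<and> C \<subseteq> ?\<Phi> ` \<Union>\<R> \<and> ?\<Phi> -` C \<inter> (space M \<times> space N) \<in> rectangle_ring M N \<and>
        b (\<Union>\<R> - ?\<Phi> -` C) \<le> e"
    using \<R>(1,2)
  proof (induction)
    case empty
    have "b {} = 0" using pa(1) b unfolding positive_def joint_content_def by (metis ennreal_eq_0_iff order_antisym)
    then show ?case by (intro allI impI exI[of _ "{}"]) auto
  next
    case (insert r \<R>)
    show ?case
    proof (intro allI impI)
      fix e :: real assume "e > 0"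
      then have e: "e/2 > 0" "e/4 > 0" by auto
      obtain A B where AB: "r = A \<times> B" "A \<in> sets M" "B \<in> sets N"
        using insert.prems unfolding rectangles_def by blast
      obtain C where C: "compact C" "C \<subseteq> ?\<Phi> ` \<Union>\<R>"
        "?\<Phi> -` C \<inter> (space M \<times> space N) \<in> rectangle_ring M N" "b (\<Union>\<R> - ?\<Phi> -` C) \<le> e/2"
        using insert e by blast
      obtain K where K: "compact K" "K \<subseteq> \<phi> ` A" "measure M (A - \<phi> -` K) \<le> e/4"
        using \<phi> AB e unfolding compactly_coded_def by blast
      obtain L where L: "compact L" "L \<subseteq> \<psi> ` B" "measure N (B - \<psi> -` L) \<le> e/4"
        using \<psi> AB e unfolding compactly_coded_def by blast
      have Km: "\<phi> -` K \<inter> space M \<in> sets M" and Lm: "\<psi> -` L \<inter> space N \<in> sets N"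
        using \<phi> \<psi> K(1) L(1) compact_imp_closed unfolding compactly_coded_def
        by (metis borel_closed measurable_sets)+
      have pre: "?\<Phi> -` (K \<times> L) \<inter> (space M \<times> space N) = (\<phi> -` K \<inter> space M) \<times> (\<psi> -` L \<inter> space N)"
        by auto
      let ?D = "C \<union> K \<times> L"
      have D3: "?\<Phi> -` ?D \<inter> (space M \<times> space N) \<in> rectangle_ring M N"
        using C(3) pre Km Lm by (auto simp: vimage_Un Int_Un_distrib2)
      have AA: "A - \<phi> -` K = A - (\<phi> -` K \<inter> space M)" "B - \<psi> -` L = B - (\<psi> -` L \<inter> space N)"
        using AB sets.sets_into_space by blast+
      have AA': "A - \<phi> -` K \<in> sets M" "B - \<psi> -` L \<in> sets N"
        unfolding AA using AB Km Lm by auto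
      have UR: "\<Union>\<R> \<in> rectangle_ring M N"
        using insert by (intro R.finite_Union) (auto simp: rectangles_def)
      have diff: "Z - ?\<Phi> -` C' \<in> rectangle_ring M N"
        if "Z \<in> rectangle_ring M N" "?\<Phi> -` C' \<inter> (space M \<times> space N) \<in> rectangle_ring M N" for Z C'
      proof -
        have "Z - ?\<Phi> -` C' = Z - (?\<Phi> -` C' \<inter> (space M \<times> space N))"
          using R.sets_into_space[OF that(1)] by blast
        then show ?thesis using that by auto
      qed
      have "\<Union>(insert r \<R>) - ?\<Phi> -` ?D \<subseteq>
          (\<Union>\<R> - ?\<Phi> -` C) \<union> ((A - \<phi> -` K) \<times> space N \<union> space M \<times> (B - \<psi> -` L))"
        using AB sets.sets_into_space[OF AB(2)] sets.sets_into_space[OF AB(3)] by auto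
      moreover have "\<Union>(insert r \<R>) \<in> rectangle_ring M N" using UR AB by auto
      ultimately have "b (\<Union>(insert r \<R>) - ?\<Phi> -` ?D) \<le>
          b ((\<Union>\<R> - ?\<Phi> -` C) \<union> ((A - \<phi> -` K) \<times> space N \<union> space M \<times> (B - \<psi> -` L)))"
        using UR AA' C(3) D3 by (intro mono diff R.Un Times_in_rectangle_ring) auto
      also have "\<dots> \<le> b (\<Union>\<R> - ?\<Phi> -` C) + b ((A - \<phi> -` K) \<times> space N \<union> space M \<times> (B - \<psi> -` L))"
        using UR AA' C(3) by (intro sub diff R.Un Times_in_rectangle_ring) auto
      also have "\<dots> \<le> b (\<Union>\<R> - ?\<Phi> -` C) + (b ((A - \<phi> -` K) \<times> space N) + b (space M \<times> (B - \<psi> -` L)))"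
        using AA' by (intro add_left_mono sub Times_in_rectangle_ring) auto
      also have "\<dots> = b (\<Union>\<R> - ?\<Phi> -` C) + (measure M (A - \<phi> -` K) + measure N (B - \<psi> -` L))"
        using b AA' unfolding joint_content_def by auto
      also have "\<dots> \<le> e" using C(4) K(3) L(3) by simp
      finally have "b (\<Union>(insert r \<R>) - ?\<Phi> -` ?D) \<le> e" .
      moreover have "?D \<subseteq> ?\<Phi> ` \<Union>(insert r \<R>)"
        using C(2) K(2) L(2) unfolding AB(1) by (fastforce simp: image_iff)
      ultimately show "\<exists>C. compact C \<and> C \<subseteq> ?\<Phi> ` \<Union>(insert r \<R>) \<and>
          ?\<Phi> -` C \<inter> (space M \<times> space N) \<in> rectangle_ring M N \<and> b (\<Union>(insert r \<R>) - ?\<Phi> -` C) \<le> e"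
        using D3 C(1) K(1) L(1) by (intro exI[of _ ?D] conjI compact_Un compact_Times)
    qed
  qed
  then show thesis using e that unfolding \<R>(3) by blast
qed

text \<open>A finitely additive content on a product of two standard Borel spaces is automatically countably
additive once both of its marginals are measures (a theorem of Marczewski and Ryll-Nardzewski).
By Caratheodory's theorem continuity at the empty set suffices. If the content of a decreasing
sequence stays above \<open>\<epsilon>\<close>, compact inner approximations with errors \<open>\<epsilon> / 4, \<epsilon> / 8, \<dots>\<close>
still have nonempty finite intersections, hence a common point, which lies in all the sets.\<close>

lemma joint_content_extends:
  assumes b: "joint_content M N b"
    and \<phi>: "compactly_coded M \<phi>" and \<psi>: "compactly_coded N \<psi>"
  obtains \<kappa> where "sets \<kappa> = sets (M \<Otimes>\<^sub>M N)" "\<And>X. X \<in> rectangle_ring M N \<Longrightarrow> emeasure \<kappa> X = ennreal (b X)"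
proof -
  interpret R: ring_of_sets "space M \<times> space N" "rectangle_ring M N" by (rule ring_rectangle_ring)
  let ?\<Phi> = "map_prod \<phi> \<psi>" and ?f = "\<lambda>X. ennreal (b X)" and ?\<Omega> = "space M \<times> space N"
  note pa = joint_content_positive_additive[OF b]
  have b0: "0 \<le> b X" for X using b unfolding joint_content_def by blast
  have mono: "b X \<le> b Y" if "X \<in> rectangle_ring M N" "Y \<in> rectangle_ring M N" "X \<subseteq> Y" for X Y
    using R.additive_increasing[OF pa] that b0 unfolding increasing_def by (metis ennreal_le_iff)
  have inj: "inj_on ?\<Phi> ?\<Omega>"
    using \<phi> \<psi> by (auto simp: compactly_coded_def intro: map_prod_inj_on)
  have "\<exists>\<mu> :: ('a \<times> 'b) set \<Rightarrow> ennreal. (\<forall>s\<in>rectangle_ring M N. \<mu> s = ?f s) \<and>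
      measure_space ?\<Omega> (sigma_sets ?\<Omega> (rectangle_ring M N)) \<mu>"
  proof (rule R.caratheodory_empty_continuous[OF pa])
    fix A :: "nat \<Rightarrow> ('a \<times> 'b) set"
    assume A: "range A \<subseteq> rectangle_ring M N" "decseq A" "(\<Inter>i. A i) = {}"
    have Ai: "A i \<in> rectangle_ring M N" for i using A(1) by auto
    have small: "\<exists>n. b (A n) < \<epsilon>" if \<epsilon>: "\<epsilon> > 0" for \<epsilon>
    proof (rule ccontr)
      assume neg: "\<nexists>n. b (A n) < \<epsilon>"
      have "\<exists>C. compact C \<and> C \<subseteq> ?\<Phi> ` A n \<and> ?\<Phi> -` C \<inter> ?\<Omega> \<in> rectangle_ring M N \<and>
          b (A n - ?\<Phi> -` C) \<le> \<epsilon> * (1/2) ^ (n + 2)" for n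
        using joint_content_inner_compact[OF b \<phi> \<psi> Ai[of n], of "\<epsilon> * (1/2) ^ (n + 2)"] \<epsilon> by auto
      then obtain C where C: "\<And>n. compact (C n)" "\<And>n. C n \<subseteq> ?\<Phi> ` A n"
        "\<And>n. ?\<Phi> -` C n \<inter> ?\<Omega> \<in> rectangle_ring M N" "\<And>n. b (A n - ?\<Phi> -` C n) \<le> \<epsilon> * (1/2) ^ (n + 2)"
        by metis
      have Dm: "A n - ?\<Phi> -` C n \<in> rectangle_ring M N" for n
      proof -
        have "A n - ?\<Phi> -` C n = A n - (?\<Phi> -` C n \<inter> ?\<Omega>)"
          using R.sets_into_space[OF Ai[of n]] by blast
        then show ?thesis using Ai C(3) by auto
      qed
      have ne: "\<exists>w\<in>A n. \<forall>k\<le>n. ?\<Phi> w \<in> C k" for n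
      proof (rule ccontr)
        assume "\<not> (\<exists>w\<in>A n. \<forall>k\<le>n. ?\<Phi> w \<in> C k)"
        then have cov: "A n \<subseteq> (\<Union>k\<in>{..n}. A k - ?\<Phi> -` C k)"
          using decseqD[OF A(2)] by fastforce
        have "?f (A n) \<le> ?f (\<Union>k\<in>{..n}. A k - ?\<Phi> -` C k)"
          using mono[OF Ai _ cov] Dm by (auto intro!: ennreal_leI)
        also have "\<dots> \<le> (\<Sum>k\<in>{..n}. ?f (A k - ?\<Phi> -` C k))"
          using Dm by (intro R.subadditive[OF pa]) auto
        also have "\<dots> = ennreal (\<Sum>k\<in>{..n}. b (A k - ?\<Phi> -` C k))" using b0 by simp
        finally have "b (A n) \<le> (\<Sum>k\<in>{..n}. b (A k - ?\<Phi> -` C k))"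
          by (simp add: b0 sum_nonneg)
        also have "\<dots> \<le> (\<Sum>k\<in>{..n}. \<epsilon> * (1/2) ^ (k + 2))" using C(4) by (intro sum_mono) auto
        also have "\<dots> = \<epsilon> / 4 * (\<Sum>k\<le>n. (1/2) ^ k)" by (simp add: sum_distrib_left power_add)
        also have "\<dots> = \<epsilon> / 4 * (2 * (1 - (1/2) ^ Suc n))" by (subst sum_gp_basic[symmetric]) (simp add: sum_gp)
        also have "\<dots> \<le> \<epsilon> / 4 * 2" using \<epsilon> by (intro mult_left_mono) auto
        also have "\<dots> < \<epsilon>" using \<epsilon> by simp
        finally show False using neg by blast
      qed
      have "C 0 \<inter> \<Inter> (range C) \<noteq> {}"
      proof (rule compact_imp_fip[OF C(1)])
        show "\<And>T. T \<in> range C \<Longrightarrow> closed T" using C(1) compact_imp_closed by blast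
        fix F' assume F': "finite F'" "F' \<subseteq> range C"
        then obtain J where J: "finite J" "F' = C ` J" by (meson finite_subset_image)
        obtain w where "\<forall>k\<le>Max (insert 0 J). ?\<Phi> w \<in> C k" using ne by blast
        then have "?\<Phi> w \<in> C k" if "k \<in> insert 0 J" for k using that J(1) by simp
        then show "C 0 \<inter> \<Inter> F' \<noteq> {}" unfolding J(2) by blast
      qed
      then obtain z where z: "\<And>k. z \<in> C k" by blast
      obtain w where w: "z = ?\<Phi> w" "w \<in> A 0" using subsetD[OF C(2) z] by (rule imageE)
      have "w \<in> A k" for k
      proof -
        obtain w' where w': "z = ?\<Phi> w'" "w' \<in> A k" using subsetD[OF C(2) z] by (rule imageE)
        have "w = w'"
          using inj_onD[OF inj, of w w'] w w' R.sets_into_space[OF Ai[of k]] R.sets_into_space[OF Ai[of 0]] by auto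
        then show ?thesis using w' by simp
      qed
      then show False using A(3) by blast
    qed
    have "(\<lambda>i. b (A i)) \<longlonglongrightarrow> 0"
    proof (rule LIMSEQ_I)
      fix r :: real assume "0 < r"
      then obtain n where "b (A n) < r" using small by blast
      then have "norm (b (A m) - 0) < r" if "m \<ge> n" for m
        using mono[OF Ai Ai decseqD[OF A(2) that]] b0[of "A m"] by simp
      then show "\<exists>n. \<forall>m\<ge>n. norm (b (A m) - 0) < r" by blast
    qed
    then show "(\<lambda>i. ?f (A i)) \<longlonglongrightarrow> 0" by (metis ennreal_0 tendsto_ennrealI)
  qed simp
  then obtain \<mu> where \<mu>: "\<forall>s\<in>rectangle_ring M N. \<mu> s = ?f s"
    "measure_space ?\<Omega> (sigma_sets ?\<Omega> (rectangle_ring M N)) \<mu>" by blast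
  let ?\<kappa> = "measure_of ?\<Omega> (rectangle_ring M N) \<mu>"
  have "sets ?\<kappa> = sets (M \<Otimes>\<^sub>M N)"
    unfolding sets_pair_rectangle_ring using R.space_closed by (rule sets_measure_of)
  moreover have "emeasure ?\<kappa> X = ?f X" if "X \<in> rectangle_ring M N" for X
    using that \<mu> R.space_closed
    by (subst emeasure_measure_of[of ?\<kappa> ?\<Omega> "rectangle_ring M N" \<mu>])
       (auto simp: measure_space_def)
  ultimately show thesis using that by blast
qed

section \<open>Extreme points in a power of the real line\<close>

text \<open>Faces and extreme points are formulated for the coordinatewise operations on \<open>'i \<Rightarrow> \<real>\<close>,
a function space of arbitrary dimension with the product topology.\<close>

definition closed_face :: "('i \<Rightarrow> real) set \<Rightarrow> ('i \<Rightarrow> real) set \<Rightarrow> bool" where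
  "closed_face B F \<longleftrightarrow> closed F \<and> F \<noteq> {} \<and> F \<subseteq> B \<and>
     (\<forall>x\<in>B. \<forall>y\<in>B. \<forall>t. 0 < t \<and> t < 1 \<and> (\<lambda>i. (1 - t) * x i + t * y i) \<in> F \<longrightarrow> x \<in> F \<and> y \<in> F)"

lemma closed_faceI:
  assumes "closed F" "F \<noteq> {}" "F \<subseteq> B"
    and "\<And>x y t. x \<in> B \<Longrightarrow> y \<in> B \<Longrightarrow> 0 < t \<Longrightarrow> t < 1 \<Longrightarrow> (\<lambda>i. (1 - t) * x i + t * y i) \<in> F \<Longrightarrow> x \<in> F \<and> y \<in> F"
  shows "closed_face B F"
  using assms(1-3) unfolding closed_face_def by (auto dest: assms(4))

lemma closed_faceD:
  assumes "closed_face B F" "x \<in> B" "y \<in> B" "0 < t" "t < 1" "(\<lambda>i. (1 - t) * x i + t * y i) \<in> F"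
  shows "x \<in> F" "y \<in> F"
  using assms unfolding closed_face_def by blast+

lemma closed_face_coordinate_max:
  assumes B: "compact B" and F: "closed_face B F"
  shows "closed_face B {x\<in>F. \<forall>y\<in>F. y j \<le> x j}"
proof -
  have cF: "compact F" "F \<noteq> {}"
    using F compact_Int_closed[OF B, of F] unfolding closed_face_def by (auto simp: Int_absorb1)
  have cont: "continuous_on F (\<lambda>x. x j)"
    by (rule continuous_on_subset[OF continuous_on_product_coordinates]) auto
  obtain m where m: "m \<in> F" "\<And>y. y \<in> F \<Longrightarrow> y j \<le> m j"
    using continuous_attains_sup[OF cF cont] by auto
  have eq: "{x\<in>F. \<forall>y\<in>F. y j \<le> x j} = F \<inter> {x. m j \<le> x j}"
    using m by (auto intro: order_trans)
  have "closed (F \<inter> {x. m j \<le> x j})"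
    using F unfolding closed_face_def
    by (intro closed_Int closed_Collect_le continuous_on_const continuous_on_product_coordinates) auto
  moreover have "x \<in> F \<and> m j \<le> x j \<and> y \<in> F \<and> m j \<le> y j"
    if "x \<in> B" "y \<in> B" "0 < t" "t < 1" "(\<lambda>i. (1 - t) * x i + t * y i) \<in> F"
      "m j \<le> (1 - t) * x j + t * y j" for x y t
  proof -
    have xy: "x \<in> F" "y \<in> F" using F that unfolding closed_face_def by blast+
    have le: "x j \<le> m j" "y j \<le> m j" using m xy by auto
    have "t * (m j - y j) \<ge> 0" "(1 - t) * (m j - x j) \<ge> 0" using that le by auto
    moreover have "t * (m j - y j) + (1 - t) * (m j - x j) \<le> 0"
      using that by (simp add: algebra_simps)
    ultimately have "t * (m j - y j) = 0" "(1 - t) * (m j - x j) = 0" by linarith+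
    then show ?thesis using xy that by auto
  qed
  ultimately show ?thesis
    using m F unfolding eq closed_face_def by blast
qed

text \<open>Zorn's lemma is applied to complements of faces, ordered by inclusion; the intersection of a
chain of faces is nonempty by compactness.\<close>

lemma closed_face_minimal:
  assumes B: "compact B" and F0: "closed_face B F0"
  obtains F where "closed_face B F" "F \<subseteq> F0" "\<And>G. closed_face B G \<Longrightarrow> G \<subseteq> F \<Longrightarrow> G = F"
proof -
  let ?A = "{U. closed_face B (- U) \<and> - U \<subseteq> F0}"
  have "\<exists>M\<in>?A. \<forall>X\<in>?A. M \<subseteq> X \<longrightarrow> X = M"
  proof (rule subset_Zorn_nonempty)
    have "- F0 \<in> ?A" using F0 by auto
    then show "?A \<noteq> {}" by blast
  next
    fix C assume C: "C \<noteq> {}" "subset.chain ?A C"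
    then have CA: "\<And>U. U \<in> C \<Longrightarrow> closed_face B (- U) \<and> - U \<subseteq> F0"
      by (auto simp: subset.chain_def)
    have "B \<inter> \<Inter> (uminus ` C) \<noteq> {}"
    proof (rule compact_imp_fip[OF B])
      fix T assume "T \<in> uminus ` C"
      then show "closed T" using CA by (auto simp: closed_face_def)
    next
      fix F' assume F': "finite F'" "F' \<subseteq> uminus ` C"
      then obtain K where K: "K \<subseteq> C" "finite K" "F' = uminus ` K"
        by (meson finite_subset_image)
      show "B \<inter> \<Inter> F' \<noteq> {}"
      proof (cases "K = {}")
        case True
        then show ?thesis using K F0 by (auto simp: closed_face_def)
      next
        case False
        have "subset.chain ?A K" using C(2) K(1) unfolding subset.chain_def by blast
        then have "\<Union>K \<in> K" using Union_in_chain[OF K(2) False] by blast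
        then have "closed_face B (- \<Union>K)" using CA K by auto
        moreover have "- \<Union>K = \<Inter> F'" using K by auto
        ultimately have "\<Inter> F' \<noteq> {}" "\<Inter> F' \<subseteq> B" unfolding closed_face_def by metis+
        then show ?thesis by blast
      qed
    qed
    then have ne: "B \<inter> - \<Union>C \<noteq> {}" by auto
    have "closed (- \<Union>C)"
    proof -
      have "- \<Union>C = \<Inter> (uminus ` C)" by auto
      then show ?thesis using CA by (auto simp: closed_face_def)
    qed
    moreover have "- \<Union>C \<subseteq> B \<and> - \<Union>C \<subseteq> F0"
    proof -
      obtain U where "U \<in> C" using C(1) by blast
      then have "- U \<subseteq> B" "- U \<subseteq> F0" "- \<Union>C \<subseteq> - U" using CA by (auto simp: closed_face_def)
      then show ?thesis by blast
    qed
    ultimately have "closed_face B (- \<Union>C)"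
    proof (intro closed_faceI)
      fix x y t
      assume xy: "x \<in> B" "y \<in> B" "0 < t" "t < 1" "(\<lambda>i. (1 - t) * x i + t * y i) \<in> - \<Union>C"
      have "x \<in> - U \<and> y \<in> - U" if U: "U \<in> C" for U
      proof -
        have "(\<lambda>i. (1 - t) * x i + t * y i) \<in> - U" using xy(5) U by blast
        then show ?thesis using closed_faceD[OF conjunct1[OF CA[OF U]] xy(1-4)] by simp
      qed
      then show "x \<in> - \<Union>C \<and> y \<in> - \<Union>C" by auto
    qed (use ne in \<open>blast+\<close>)
    with \<open>- \<Union>C \<subseteq> B \<and> - \<Union>C \<subseteq> F0\<close> show "\<Union>C \<in> ?A" by blast
  qed
  then obtain M where "M \<in> ?A" and max: "\<forall>X\<in>?A. M \<subseteq> X \<longrightarrow> X = M" by (rule bexE)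
  then have M: "closed_face B (- M)" "- M \<subseteq> F0" by simp_all
  show thesis
  proof (rule that[OF M(1,2)])
    fix G assume G: "closed_face B G" "G \<subseteq> - M"
    then have "- G \<in> ?A" "M \<subseteq> - G" using M(2) by auto
    then have "- G = M" using max by (metis (lifting))
    then show "G = - M" by auto
  qed
qed

text \<open>This is the argument of Krein and Milman, started in the face on which the coordinate \<open>j\<close> is
maximal. A minimal closed face is a single point: maximizing any coordinate on it yields a
smaller face, so all coordinates are constant on it.\<close>

lemma compact_extreme_point_maximizing_coordinate:
  fixes B :: "('i \<Rightarrow> real) set"
  assumes B: "compact B" "B \<noteq> {}" and clB: "closed B"
  obtains b where "b \<in> B" "\<And>x. x \<in> B \<Longrightarrow> x j \<le> b j"
    "\<And>x y t. x \<in> B \<Longrightarrow> y \<in> B \<Longrightarrow> 0 < t \<Longrightarrow> t < 1 \<Longrightarrow> (\<And>i. b i = (1 - t) * x i + t * y i) \<Longrightarrow> x = y"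
proof -
  have "closed_face B B" using B clB by (auto simp: closed_face_def)
  then have F0: "closed_face B {x\<in>B. \<forall>y\<in>B. y j \<le> x j}" by (rule closed_face_coordinate_max[OF B(1)])
  obtain F where F: "closed_face B F" "F \<subseteq> {x\<in>B. \<forall>y\<in>B. y j \<le> x j}"
    "\<And>G. closed_face B G \<Longrightarrow> G \<subseteq> F \<Longrightarrow> G = F"
    using closed_face_minimal[OF B(1) F0] by blast
  obtain b where b: "b \<in> F" using F(1) by (auto simp: closed_face_def)
  have single: "x = b" if "x \<in> F" for x
  proof
    fix i
    have "{x\<in>F. \<forall>y\<in>F. y i \<le> x i} = F"
      using closed_face_coordinate_max[OF B(1) F(1)] by (intro F(3)) auto
    then show "x i = b i" using that b by (metis (mono_tags, lifting) mem_Collect_eq order_antisym)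
  qed
  show thesis
  proof (rule that[of b])
    show "b \<in> B" "\<And>x. x \<in> B \<Longrightarrow> x j \<le> b j" using b F(2) by auto
    fix x y t assume *: "x \<in> B" "y \<in> B" "0 < t" "t < 1" "\<And>i. b i = (1 - t) * x i + t * y i"
    then have "b = (\<lambda>i. (1 - t) * x i + t * y i)" by auto
    then have "x \<in> F \<and> y \<in> F" using closed_faceD[OF F(1) *(1-4)] b by simp
    then show "x = y" using single by auto
  qed
qed

section \<open>Conditioning a joining on an invariant set\<close>

text \<open>The measurable left inverses are what makes the density of an invariant measure an invariant
function.\<close>

definition mp_family :: "'g set \<Rightarrow> 'x measure \<Rightarrow> ('g \<Rightarrow> 'x \<Rightarrow> 'x) \<Rightarrow> bool" where
  "mp_family K M R \<longleftrightarrow> (\<forall>g\<in>K. R g \<in> measurable M M \<and> distr M M (R g) = M \<and>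
     (\<exists>Q\<in>measurable M M. \<forall>x\<in>space M. Q (R g x) = x))"

text \<open>The density \<open>u\<close> of \<open>\<mu>\<close> with respect to \<open>M\<close> is invariant, so with \<open>t\<close> the total mass of \<open>\<mu>\<close> the
set \<open>u > t\<close> has measure \<open>0\<close> or \<open>1\<close>. Hence one of the measures \<open>\<mu>\<close> and \<open>t M\<close> dominates the
other; as their total masses agree, they are equal.\<close>

lemma ergodic_invariant_measure_unique:
  assumes M: "prob_space M" and erg: "ergodic K M R" and mp: "mp_family K M R"
    and s: "sets \<mu> = sets M" and le: "\<And>A. A \<in> sets M \<Longrightarrow> emeasure \<mu> A \<le> emeasure M A"
    and inv: "\<And>g. g \<in> K \<Longrightarrow> distr \<mu> M (R g) = \<mu>"
    and A: "A \<in> sets M"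
  shows "measure \<mu> A = measure \<mu> (space M) * measure M A"
proof -
  interpret M: prob_space M by fact
  have sp: "space \<mu> = space M" using s by (rule sets_eq_imp_space_eq)
  have "emeasure \<mu> (space \<mu>) \<noteq> \<infinity>"
    using le[of "space M"] sp M.emeasure_space_1 by (auto simp: top_unique)
  then interpret \<mu>: finite_measure \<mu> by (rule finite_measureI)
  have ac: "absolutely_continuous M \<mu>"
    unfolding absolutely_continuous_def null_sets_def using le s by force
  define u where "u = RN_deriv M \<mu>"
  have [measurable]: "u \<in> borel_measurable M" by (simp add: u_def)
  have du: "density M u = \<mu>" unfolding u_def using M.density_RN_deriv[OF ac s] .
  have em: "emeasure \<mu> B = (\<integral>\<^sup>+x\<in>B. u x \<partial>M)" if "B \<in> sets M" for B
    using that by (simp add: du[symmetric] emeasure_density)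
  have u_inv: "AE x in M. u (R g x) = u x" if g: "g \<in> K" for g
  proof -
    obtain Q where R: "R g \<in> measurable M M" "distr M M (R g) = M"
      and Q: "Q \<in> measurable M M" "\<And>x. x \<in> space M \<Longrightarrow> Q (R g x) = x"
      using mp g unfolding mp_family_def by blast
    note [measurable] = R(1) Q(1)
    \<comment> \<open>both densities have the same image under the invertible map \<open>R g\<close>\<close>
    have "distr (density M (\<lambda>x. u (R g x))) M (R g) = density (distr M M (R g)) u"
      by (subst density_distr) auto
    also have "\<dots> = distr (density M u) M (R g)" using R(2) du inv[OF g] by simp
    finally have "distr (distr (density M (\<lambda>x. u (R g x))) M (R g)) M Q = distr (distr (density M u) M (R g)) M Q"
      by simp
    then have "distr (density M (\<lambda>x. u (R g x))) M (Q \<circ> R g) = distr (density M u) M (Q \<circ> R g)"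
      by (simp add: distr_distr)
    moreover have "distr (density M f) M (Q \<circ> R g) = density M f" for f
    proof -
      have "distr (density M f) M (Q \<circ> R g) = distr (density M f) (density M f) (\<lambda>x. x)"
        using Q(2) by (intro distr_cong) auto
      then show ?thesis by (simp add: distr_id)
    qed
    ultimately have "density M (\<lambda>x. u (R g x)) = density M u" by simp
    moreover have "sigma_finite_measure (density M (\<lambda>x. u (R g x)))"
      using \<open>density M (\<lambda>x. u (R g x)) = density M u\<close> du \<mu>.sigma_finite_measure_axioms by simp
    ultimately show ?thesis by (intro M.density_unique_iff[THEN iffD1]) auto
  qed
  define t where "t = measure \<mu> (space M)"
  define P where "P = {x\<in>space M. ennreal t < u x}"
  have P [measurable]: "P \<in> sets M" unfolding P_def by measurable
  have "AE x in M. R g x \<in> P \<longleftrightarrow> x \<in> P" if g: "g \<in> K" for g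
  proof -
    have "R g \<in> measurable M M" using mp g unfolding mp_family_def by blast
    then have "\<And>x. x \<in> space M \<Longrightarrow> R g x \<in> space M" by (rule measurable_space)
    then show ?thesis using u_inv[OF g] by (auto simp: P_def elim!: eventually_mono)
  qed
  then have P01: "measure M P = 0 \<or> measure M P = 1"
    using erg P unfolding ergodic_def by blast
  have eq_int: "ennreal t * emeasure M B = (\<integral>\<^sup>+x\<in>B. ennreal t \<partial>M)" if "B \<in> sets M" for B
    using that by (simp add: nn_integral_cmult_indicator)
  have dichotomy: "(\<forall>B\<in>sets M. measure \<mu> B \<le> t * measure M B) \<or> (\<forall>B\<in>sets M. t * measure M B \<le> measure \<mu> B)"
    using P01
  proof
    assume "measure M P = 0"
    then have "AE x in M. x \<notin> P" using P by (simp add: M.prob_eq_0)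
    then have "AE x in M. u x \<le> ennreal t" 
      using AE_space by eventually_elim (auto simp: P_def)
    then have "emeasure \<mu> B \<le> ennreal t * emeasure M B" if "B \<in> sets M" for B
      unfolding em[OF that] eq_int[OF that]
      by (intro nn_integral_mono_AE) (auto elim!: eventually_mono split: split_indicator)
    then have "ennreal (measure \<mu> B) \<le> ennreal (t * measure M B)" if "B \<in> sets M" for B
      using that by (simp add: \<mu>.emeasure_eq_measure M.emeasure_eq_measure ennreal_mult t_def)
    then show ?thesis by (auto simp: t_def)
  next
    assume "measure M P = 1"
    then have "AE x in M. x \<in> P" using P by (simp add: M.prob_eq_1)
    then have "AE x in M. ennreal t \<le> u x" by eventually_elim (auto simp: P_def)
    then have "ennreal t * emeasure M B \<le> emeasure \<mu> B" if "B \<in> sets M" for B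
      unfolding em[OF that] eq_int[OF that]
      by (intro nn_integral_mono_AE) (auto elim!: eventually_mono split: split_indicator)
    then have "ennreal (t * measure M B) \<le> ennreal (measure \<mu> B)" if "B \<in> sets M" for B
      using that by (simp add: \<mu>.emeasure_eq_measure M.emeasure_eq_measure ennreal_mult t_def)
    then show ?thesis by auto
  qed
  \<comment> \<open>the opposite inequality for \<open>A\<close> comes from the complement of \<open>A\<close>\<close>
  have c1: "measure \<mu> (space M - A) = t - measure \<mu> A"
    using \<mu>.finite_measure_compl[of A] A s sp by (simp add: t_def)
  have c2: "t * measure M (space M - A) = t - t * measure M A"
    unfolding M.prob_compl[OF A] by (simp add: right_diff_distrib)
  show ?thesis
    using dichotomy
  proof
    assume *: "\<forall>B\<in>sets M. measure \<mu> B \<le> t * measure M B"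
    have "measure \<mu> A \<le> t * measure M A" "measure \<mu> (space M - A) \<le> t * measure M (space M - A)"
      using * A by blast+
    then show ?thesis using c1 c2 by (simp add: t_def)
  next
    assume *: "\<forall>B\<in>sets M. t * measure M B \<le> measure \<mu> B"
    have "t * measure M A \<le> measure \<mu> A" "t * measure M (space M - A) \<le> measure \<mu> (space M - A)"
      using * A by blast+
    then show ?thesis using c1 c2 by (simp add: t_def)
  qed
qed

text \<open>The image under \<open>\<pi>\<close> of \<open>\<kappa>\<close> restricted to \<open>C\<close> is an invariant measure dominated by \<open>M\<close>, so it is
a multiple of \<open>M\<close>.\<close>

lemma invariant_set_independent_of_ergodic_factor:
  assumes \<kappa>: "prob_space \<kappa>" and M: "prob_space M" and erg: "ergodic K M R" and mp: "mp_family K M R"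
    and T: "\<And>g. g \<in> K \<Longrightarrow> T g \<in> measurable \<kappa> \<kappa>" "\<And>g. g \<in> K \<Longrightarrow> distr \<kappa> \<kappa> (T g) = \<kappa>"
    and C: "C \<in> sets \<kappa>" "\<And>g. g \<in> K \<Longrightarrow> AE x in \<kappa>. T g x \<in> C \<longleftrightarrow> x \<in> C"
    and \<pi>: "\<pi> \<in> measurable \<kappa> M" "distr \<kappa> M \<pi> = M"
      "\<And>g x. g \<in> K \<Longrightarrow> x \<in> space \<kappa> \<Longrightarrow> \<pi> (T g x) = R g (\<pi> x)"
    and B: "B \<in> sets M"
  shows "measure \<kappa> (C \<inter> (\<pi> -` B \<inter> space \<kappa>)) = measure \<kappa> C * measure M B"
proof -
  interpret \<kappa>: prob_space \<kappa> by fact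
  interpret M: prob_space M by fact
  note [measurable] = T(1) C(1) \<pi>(1)
  define \<mu> where "\<mu> = distr (density \<kappa> (indicator C)) M \<pi>"
  have em: "emeasure \<mu> B = emeasure \<kappa> (C \<inter> (\<pi> -` B \<inter> space \<kappa>))" if [measurable]: "B \<in> sets M" for B
    unfolding \<mu>_def by (simp add: emeasure_distr emeasure_density nn_integral_set_ennreal[symmetric] ac_simps
        flip: indicator_inter_arith)
  have "measure \<mu> B = measure \<mu> (space M) * measure M B"
  proof (rule ergodic_invariant_measure_unique[OF M erg mp _ _ _ B])
    show s: "sets \<mu> = sets M" by (simp add: \<mu>_def)
    fix A assume A[measurable]: "A \<in> sets M"
    have "emeasure \<kappa> (C \<inter> (\<pi> -` A \<inter> space \<kappa>)) \<le> emeasure \<kappa> (\<pi> -` A \<inter> space \<kappa>)"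
      by (intro emeasure_mono) auto
    also have "\<dots> = emeasure (distr \<kappa> M \<pi>) A" by (simp add: emeasure_distr)
    finally show "emeasure \<mu> A \<le> emeasure M A" using \<pi>(2) em[OF A] by simp
  next
    fix g assume g: "g \<in> K"
    note Tg [measurable] = T(1)[OF g]
    have Rg [measurable]: "R g \<in> measurable M M" using mp g unfolding mp_family_def by blast
    show "distr \<mu> M (R g) = \<mu>"
    proof (rule measure_eqI)
      show "sets (distr \<mu> M (R g)) = sets \<mu>" by (simp add: \<mu>_def)
      fix B assume "B \<in> sets (distr \<mu> M (R g))"
      then have B[measurable]: "B \<in> sets M" by simp
      have Rm: "R g \<in> measurable \<mu> M" using Rg by (simp add: \<mu>_def)
      have spm: "space \<mu> = space M" by (simp add: \<mu>_def)
      have *: "R g -` B \<inter> space M \<in> sets M" by measurable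
      have "emeasure (distr \<mu> M (R g)) B = emeasure \<mu> (R g -` B \<inter> space M)"
        using Rm B by (simp add: emeasure_distr spm)
      also have "\<dots> = emeasure \<kappa> (C \<inter> (\<pi> -` (R g -` B \<inter> space M) \<inter> space \<kappa>))" by (rule em[OF *])
      also have "C \<inter> (\<pi> -` (R g -` B \<inter> space M) \<inter> space \<kappa>) = C \<inter> (T g -` (\<pi> -` B \<inter> space \<kappa>) \<inter> space \<kappa>)"
        using \<pi>(3)[OF g] measurable_space[OF \<pi>(1)] measurable_space[OF Tg] by auto
      also have "emeasure \<kappa> \<dots> = emeasure \<kappa> (T g -` (C \<inter> (\<pi> -` B \<inter> space \<kappa>)) \<inter> space \<kappa>)"
        using C(2)[OF g] by (intro emeasure_eq_AE) (auto elim!: eventually_mono)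
      also have "\<dots> = emeasure (distr \<kappa> \<kappa> (T g)) (C \<inter> (\<pi> -` B \<inter> space \<kappa>))"
        by (simp add: emeasure_distr)
      finally show "emeasure (distr \<mu> M (R g)) B = emeasure \<mu> B"
        using T(2)[OF g] em[OF B] by simp
    qed
  qed
  moreover have "C \<inter> (\<pi> -` space M \<inter> space \<kappa>) = C"
    using measurable_space[OF \<pi>(1)] sets.sets_into_space[OF C(1)] by auto
  ultimately show ?thesis using em[OF B] em[of "space M"] by (simp add: measure_def)
qed

definition joinings ::
    "'g set \<Rightarrow> 'x measure \<Rightarrow> ('g \<Rightarrow> 'x \<Rightarrow> 'x) \<Rightarrow> 'y measure \<Rightarrow> ('g \<Rightarrow> 'y \<Rightarrow> 'y) \<Rightarrow> ('x \<times> 'y) measure set" where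
  "joinings K M R M' R' =
     {\<kappa>. prob_space \<kappa> \<and> sets \<kappa> = sets (M \<Otimes>\<^sub>M M') \<and>
         distr \<kappa> M fst = M \<and> distr \<kappa> M' snd = M' \<and>
         (\<forall>g\<in>K. distr \<kappa> \<kappa> (map_prod (R g) (R' g)) = \<kappa>)}"

text \<open>Conditioning on an invariant set preserves the marginals on two ergodic factors, since each
factor is independent of the set. This is used twice: with the coset coordinates of a joining of
induced actions, and with the two projections of a joining in order to split a joining that is
not ergodic.\<close>

lemma conditioned_joining:
  assumes \<kappa>: "prob_space \<kappa>"
    and M: "prob_space M" "ergodic K M R" "mp_family K M R"
    and N: "prob_space N" "ergodic K N R'" "mp_family K N R'"
    and T: "\<And>g. g \<in> K \<Longrightarrow> T g \<in> measurable \<kappa> \<kappa>" "\<And>g. g \<in> K \<Longrightarrow> distr \<kappa> \<kappa> (T g) = \<kappa>"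
    and C: "C \<in> sets \<kappa>" "\<And>g. g \<in> K \<Longrightarrow> AE x in \<kappa>. T g x \<in> C \<longleftrightarrow> x \<in> C" and pos: "0 < measure \<kappa> C"
    and \<pi>: "\<pi> \<in> measurable \<kappa> M" "distr \<kappa> M \<pi> = M"
      "\<And>g x. g \<in> K \<Longrightarrow> x \<in> space \<kappa> \<Longrightarrow> \<pi> (T g x) = R g (\<pi> x)"
    and \<rho>: "\<rho> \<in> measurable \<kappa> N" "distr \<kappa> N \<rho> = N"
      "\<And>g x. g \<in> K \<Longrightarrow> x \<in> space \<kappa> \<Longrightarrow> \<rho> (T g x) = R' g (\<rho> x)"
  obtains \<kappa>' where "\<kappa>' \<in> joinings K M R N R'"
    "\<And>Z. Z \<in> sets (M \<Otimes>\<^sub>M N) \<Longrightarrow>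
      measure \<kappa> C * measure \<kappa>' Z = measure \<kappa> (C \<inter> ((\<lambda>x. (\<pi> x, \<rho> x)) -` Z \<inter> space \<kappa>))"
proof -
  interpret \<kappa>: prob_space \<kappa> by fact
  note [measurable] = T(1) C(1) \<pi>(1) \<rho>(1)
  let ?U = "uniform_measure \<kappa> C" and ?\<Pi> = "\<lambda>x. (\<pi> x, \<rho> x)"
  define \<kappa>' where "\<kappa>' = distr ?U (M \<Otimes>\<^sub>M N) ?\<Pi>"
  have C0: "emeasure \<kappa> C \<noteq> 0" "emeasure \<kappa> C \<noteq> \<infinity>" using pos by (auto simp: \<kappa>.emeasure_eq_measure)
  interpret U: prob_space ?U by (rule prob_space_uniform_measure) (use C0 in auto)
  have [measurable]: "?\<Pi> \<in> measurable ?U (M \<Otimes>\<^sub>M N)" by simp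
  interpret \<kappa>': prob_space \<kappa>' unfolding \<kappa>'_def by (rule U.prob_space_distr) simp
  have me: "measure \<kappa>' Z = measure \<kappa> (C \<inter> (?\<Pi> -` Z \<inter> space \<kappa>)) / measure \<kappa> C"
    if [measurable]: "Z \<in> sets (M \<Otimes>\<^sub>M N)" for Z
  proof -
    have "measure \<kappa>' Z = measure ?U (?\<Pi> -` Z \<inter> space \<kappa>)"
      unfolding \<kappa>'_def by (simp add: measure_distr)
    also have "\<dots> = measure \<kappa> (C \<inter> (?\<Pi> -` Z \<inter> space \<kappa>)) / measure \<kappa> C"
      using C0 by (subst measure_uniform_measure) auto
    finally show ?thesis .
  qed
  have s [measurable_cong]: "sets \<kappa>' = sets (M \<Otimes>\<^sub>M N)" by (simp add: \<kappa>'_def)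
  have sp: "space \<kappa>' = space M \<times> space N" by (simp add: \<kappa>'_def space_pair_measure)
  have fst: "distr \<kappa>' M fst = M"
  proof (rule measure_eqI)
    fix B assume "B \<in> sets (distr \<kappa>' M fst)"
    then have B[measurable]: "B \<in> sets M" by simp
    have "measure (distr \<kappa>' M fst) B = measure \<kappa>' (fst -` B \<inter> space \<kappa>')"
      by (simp add: measure_distr)
    also have "fst -` B \<inter> space \<kappa>' = B \<times> space N" using sets.sets_into_space[OF B] by (auto simp: sp)
    also have "measure \<kappa>' \<dots> = measure \<kappa> (C \<inter> (?\<Pi> -` (B \<times> space N) \<inter> space \<kappa>)) / measure \<kappa> C"
      by (rule me) simp
    also have "C \<inter> (?\<Pi> -` (B \<times> space N) \<inter> space \<kappa>) = C \<inter> (\<pi> -` B \<inter> space \<kappa>)"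
      using measurable_space[OF \<rho>(1)] by auto
    also have "measure \<kappa> \<dots> = measure \<kappa> C * measure M B"
      by (rule invariant_set_independent_of_ergodic_factor[where K=K and T=T and R=R and \<pi>=\<pi>, OF \<kappa> M T C \<pi> B])
    finally show "emeasure (distr \<kappa>' M fst) B = emeasure M B"
      using pos by (simp add: finite_measure.emeasure_eq_measure[OF \<kappa>'.finite_measure_distr]
        finite_measure.emeasure_eq_measure[OF prob_space.finite_measure[OF M(1)]])
  qed simp
  have snd: "distr \<kappa>' N snd = N"
  proof (rule measure_eqI)
    fix B assume "B \<in> sets (distr \<kappa>' N snd)"
    then have B[measurable]: "B \<in> sets N" by simp
    have "measure (distr \<kappa>' N snd) B = measure \<kappa>' (snd -` B \<inter> space \<kappa>')"
      by (simp add: measure_distr)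
    also have "snd -` B \<inter> space \<kappa>' = space M \<times> B" using sets.sets_into_space[OF B] by (auto simp: sp)
    also have "measure \<kappa>' \<dots> = measure \<kappa> (C \<inter> (?\<Pi> -` (space M \<times> B) \<inter> space \<kappa>)) / measure \<kappa> C"
      by (rule me) simp
    also have "C \<inter> (?\<Pi> -` (space M \<times> B) \<inter> space \<kappa>) = C \<inter> (\<rho> -` B \<inter> space \<kappa>)"
      using measurable_space[OF \<pi>(1)] by auto
    also have "measure \<kappa> \<dots> = measure \<kappa> C * measure N B"
      by (rule invariant_set_independent_of_ergodic_factor[where K=K and T=T and R=R' and \<pi>=\<rho>, OF \<kappa> N T C \<rho> B])
    finally show "emeasure (distr \<kappa>' N snd) B = emeasure N B"
      using pos by (simp add: finite_measure.emeasure_eq_measure[OF \<kappa>'.finite_measure_distr]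
        finite_measure.emeasure_eq_measure[OF prob_space.finite_measure[OF N(1)]])
  qed simp
  have inv: "distr \<kappa>' \<kappa>' (map_prod (R g) (R' g)) = \<kappa>'" if g: "g \<in> K" for g
  proof (rule measure_eqI)
    have [measurable]: "R g \<in> measurable M M" "R' g \<in> measurable N N"
      using M(3) N(3) g unfolding mp_family_def by blast+
    note Tg[measurable] = T(1)[OF g]
    have mm[measurable]: "map_prod (R g) (R' g) \<in> measurable (M \<Otimes>\<^sub>M N) (M \<Otimes>\<^sub>M N)"
      unfolding map_prod_def by measurable
    fix Z assume "Z \<in> sets (distr \<kappa>' \<kappa>' (map_prod (R g) (R' g)))"
    then have Z[measurable]: "Z \<in> sets (M \<Otimes>\<^sub>M N)" by (simp add: s)
    let ?Z = "map_prod (R g) (R' g) -` Z \<inter> (space M \<times> space N)"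
    have Z': "?Z \<in> sets (M \<Otimes>\<^sub>M N)" using measurable_sets[OF mm Z] by (simp add: space_pair_measure)
    have Zk: "Z \<in> sets \<kappa>'" using Z s by simp
    have mk: "map_prod (R g) (R' g) \<in> measurable \<kappa>' \<kappa>'"
      using mm by (simp add: measurable_cong_sets[OF s s])
    have eq: "C \<inter> (?\<Pi> -` ?Z \<inter> space \<kappa>) = C \<inter> (T g -` (?\<Pi> -` Z \<inter> space \<kappa>) \<inter> space \<kappa>)"
      using \<pi>(3)[OF g] \<rho>(3)[OF g] measurable_space[OF \<pi>(1)] measurable_space[OF \<rho>(1)]
        measurable_space[OF Tg] by auto
    have "measure \<kappa> (C \<inter> (?\<Pi> -` ?Z \<inter> space \<kappa>)) = measure \<kappa> (T g -` (C \<inter> (?\<Pi> -` Z \<inter> space \<kappa>)) \<inter> space \<kappa>)"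
      unfolding eq using C(2)[OF g] by (intro measure_eq_AE) (auto elim!: eventually_mono)
    also have "\<dots> = measure (distr \<kappa> \<kappa> (T g)) (C \<inter> (?\<Pi> -` Z \<inter> space \<kappa>))"
      by (simp add: measure_distr)
    finally have "measure \<kappa>' ?Z = measure \<kappa>' Z"
      unfolding me[OF Z'] me[OF Z] T(2)[OF g] by simp
    moreover have "emeasure (distr \<kappa>' \<kappa>' (map_prod (R g) (R' g))) Z = emeasure \<kappa>' ?Z"
      using emeasure_distr[OF mk Zk] by (simp add: sp)
    ultimately show "emeasure (distr \<kappa>' \<kappa>' (map_prod (R g) (R' g))) Z = emeasure \<kappa>' Z"
      by (simp add: \<kappa>'.emeasure_eq_measure)
  qed simp
  have "\<kappa>' \<in> joinings K M R N R'"
    unfolding joinings_def using fst snd inv s \<kappa>'.prob_space_axioms by blast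
  then show thesis by (rule that) (use me pos in auto)
qed

section \<open>Extreme joinings are ergodic\<close>

lemma measure_eqI_rectangles:
  assumes s: "sets \<mu> = sets (M \<Otimes>\<^sub>M N)" "sets \<mu>' = sets (M \<Otimes>\<^sub>M N)" and fin: "finite_measure \<mu>"
    and eq: "\<And>A B. A \<in> sets M \<Longrightarrow> B \<in> sets N \<Longrightarrow> emeasure \<mu> (A \<times> B) = emeasure \<mu>' (A \<times> B)"
  shows "\<mu> = \<mu>'"
proof (rule measure_eqI_generator_eq[OF Int_stable_pair_measure_generator[of M N],
      where \<Omega> = "space M \<times> space N" and A = "\<lambda>_. space M \<times> space N"])
  show "{a \<times> b |a b. a \<in> sets M \<and> b \<in> sets N} \<subseteq> Pow (space M \<times> space N)"
    by (auto dest: sets.sets_into_space)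
  show "sets \<mu> = sigma_sets (space M \<times> space N) {a \<times> b |a b. a \<in> sets M \<and> b \<in> sets N}"
       "sets \<mu>' = sigma_sets (space M \<times> space N) {a \<times> b |a b. a \<in> sets M \<and> b \<in> sets N}"
    using s by (simp_all add: sets_pair_measure)
  show "range (\<lambda>_. space M \<times> space N) \<subseteq> {a \<times> b |a b. a \<in> sets M \<and> b \<in> sets N}" by blast
  show "\<And>i. emeasure \<mu> (space M \<times> space N) \<noteq> \<infinity>"
    using finite_measure.emeasure_finite[OF fin] by (simp add: infinity_ennreal_def)
qed (use eq in auto)

lemma map_prod_measurable_family:
  assumes "mp_family K M R" "mp_family K N R'" "g \<in> K" "sets \<kappa> = sets (M \<Otimes>\<^sub>M N)"
  shows "map_prod (R g) (R' g) \<in> measurable \<kappa> \<kappa>"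
proof -
  have [measurable]: "R g \<in> measurable M M" "R' g \<in> measurable N N"
    using assms unfolding mp_family_def by blast+
  have "map_prod (R g) (R' g) \<in> measurable (M \<Otimes>\<^sub>M N) (M \<Otimes>\<^sub>M N)"
    unfolding map_prod_def by measurable
  then show ?thesis by (simp add: measurable_cong_sets[OF assms(4) assms(4)])
qed

lemma joining_marginals:
  assumes \<kappa>: "\<kappa> \<in> joinings K M R N R'"
  shows "A \<in> sets M \<Longrightarrow> measure \<kappa> (A \<times> space N) = measure M A"
    and "B \<in> sets N \<Longrightarrow> measure \<kappa> (space M \<times> B) = measure N B"
proof -
  have s: "sets \<kappa> = sets (M \<Otimes>\<^sub>M N)" and d: "distr \<kappa> M fst = M" "distr \<kappa> N snd = N"
    using \<kappa> unfolding joinings_def by blast+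
  have sp: "space \<kappa> = space M \<times> space N" using sets_eq_imp_space_eq[OF s] by (simp add: space_pair_measure)
  have f: "fst \<in> measurable \<kappa> M" "snd \<in> measurable \<kappa> N"
    by (simp_all add: measurable_cong_sets[OF s refl])
  show "measure \<kappa> (A \<times> space N) = measure M A" if A: "A \<in> sets M"
  proof -
    have "measure (distr \<kappa> M fst) A = measure \<kappa> (fst -` A \<inter> space \<kappa>)" using measure_distr[OF f(1) A] .
    also have "fst -` A \<inter> space \<kappa> = A \<times> space N" using sets.sets_into_space[OF A] by (auto simp: sp)
    finally show ?thesis using d by simp
  qed
  show "measure \<kappa> (space M \<times> B) = measure N B" if B: "B \<in> sets N"
  proof -
    have "measure (distr \<kappa> N snd) B = measure \<kappa> (snd -` B \<inter> space \<kappa>)" using measure_distr[OF f(2) B] .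
    also have "snd -` B \<inter> space \<kappa> = space M \<times> B" using sets.sets_into_space[OF B] by (auto simp: sp)
    finally show ?thesis using d by simp
  qed
qed

definition joining_contents ::
    "'g set \<Rightarrow> 'x measure \<Rightarrow> ('g \<Rightarrow> 'x \<Rightarrow> 'x) \<Rightarrow> 'y measure \<Rightarrow> ('g \<Rightarrow> 'y \<Rightarrow> 'y) \<Rightarrow> (('x \<times> 'y) set \<Rightarrow> real) set" where
  "joining_contents K M R N R' =
     {b. joint_content M N b \<and> (\<forall>X. b X \<le> 1) \<and> (\<forall>X\<in>- rectangle_ring M N. b X = 0) \<and>
         (\<forall>g\<in>K. \<forall>A\<in>sets M. \<forall>B\<in>sets N.
            b ((R g -` A \<inter> space M) \<times> (R' g -` B \<inter> space N)) = b (A \<times> B))}"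

text \<open>Each requirement is an equation or a weak inequality between finitely many coordinates.\<close>

lemma closed_joining_contents: "closed (joining_contents K M R N R')"
proof -
  have ball: "closed {b. \<forall>a\<in>I. P b a}" if "\<And>a. a \<in> I \<Longrightarrow> closed {b. P b a}"
    for I :: "'i set" and P :: "(('a \<times> 'b) set \<Rightarrow> real) \<Rightarrow> 'i \<Rightarrow> bool"
    unfolding Collect_ball_eq using that by blast
  have imp: "closed {b. Q \<longrightarrow> P b}" if "closed {b. P b}"
    for Q and P :: "(('a \<times> 'b) set \<Rightarrow> real) \<Rightarrow> bool"
    using that by (cases Q) auto
  show ?thesis
    unfolding joining_contents_def joint_content_def
    by (intro closed_Collect_conj closed_Collect_all ball imp closed_Collect_le closed_Collect_eq
        continuous_on_const continuous_on_add continuous_on_product_coordinates)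
qed

lemma compact_joining_contents: "compact (joining_contents K M R N R')"
proof -
  have "compactin (product_topology (\<lambda>i. euclideanreal) UNIV) (PiE UNIV (\<lambda>_. {0..1}))"
    unfolding compactin_PiE by simp
  then have "compact (PiE UNIV (\<lambda>_::('a\<times>'b) set. {0..1::real}))"
    by (simp add: euclidean_product_topology)
  then have "compact (PiE UNIV (\<lambda>_. {0..1}) \<inter> joining_contents K M R N R')"
    using closed_joining_contents by (rule compact_Int_closed)
  moreover have "joining_contents K M R N R' \<subseteq> PiE UNIV (\<lambda>_. {0..1})"
    unfolding joining_contents_def joint_content_def by auto
  ultimately show ?thesis by (simp add: Int_absorb1)
qed

text \<open>The value \<open>0\<close> outside the ring makes the correspondence between joinings and contents
bijective.\<close>

definition joining_content where
  "joining_content M N \<kappa> X = (if X \<in> rectangle_ring M N then measure \<kappa> X else 0)"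

lemma joining_content_in_joining_contents:
  assumes \<kappa>: "\<kappa> \<in> joinings K M R N R'" and mp: "mp_family K M R" "mp_family K N R'"
  shows "joining_content M N \<kappa> \<in> joining_contents K M R N R'"
proof -
  interpret \<kappa>: prob_space \<kappa> using \<kappa> unfolding joinings_def by blast
  have s: "sets \<kappa> = sets (M \<Otimes>\<^sub>M N)" using \<kappa> unfolding joinings_def by blast
  have sp: "space \<kappa> = space M \<times> space N" using sets_eq_imp_space_eq[OF s] by (simp add: space_pair_measure)
  interpret R: ring_of_sets "space M \<times> space N" "rectangle_ring M N" by (rule ring_rectangle_ring)
  have rs: "X \<in> sets \<kappa>" if "X \<in> rectangle_ring M N" for X
    using that rectangle_ring_subset_sets s by blast
  have eq: "joining_content M N \<kappa> X = measure \<kappa> X" if "X \<in> rectangle_ring M N" for X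
    using that by (simp add: joining_content_def)
  have "joint_content M N (joining_content M N \<kappa>)"
    unfolding joint_content_def
  proof (intro conjI ballI allI impI)
    fix X Y assume XY: "X \<in> rectangle_ring M N" "Y \<in> rectangle_ring M N" "X \<inter> Y = {}"
    then show "joining_content M N \<kappa> (X \<union> Y) = joining_content M N \<kappa> X + joining_content M N \<kappa> Y"
      using \<kappa>.finite_measure_Union[OF rs rs XY(3)] by (simp add: eq R.Un)
  qed (auto simp: eq Times_in_rectangle_ring joining_marginals[OF \<kappa>], simp add: joining_content_def)
  moreover have "joining_content M N \<kappa> ((R g -` A \<inter> space M) \<times> (R' g -` B \<inter> space N)) = joining_content M N \<kappa> (A \<times> B)"
    if g: "g \<in> K" and A: "A \<in> sets M" and B: "B \<in> sets N" for g A B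
  proof -
    have m: "R g \<in> measurable M M" "R' g \<in> measurable N N"
      using mp g unfolding mp_family_def by blast+
    have "measure (distr \<kappa> \<kappa> (map_prod (R g) (R' g))) (A \<times> B) = measure \<kappa> (map_prod (R g) (R' g) -` (A \<times> B) \<inter> space \<kappa>)"
      using A B s by (intro measure_distr map_prod_measurable_family[OF mp g s]) auto
    also have "map_prod (R g) (R' g) -` (A \<times> B) \<inter> space \<kappa> = (R g -` A \<inter> space M) \<times> (R' g -` B \<inter> space N)"
      by (auto simp: sp)
    finally show ?thesis
      using \<kappa> g A B measurable_sets[OF m(1) A] measurable_sets[OF m(2) B]
      unfolding joinings_def by (simp add: eq Times_in_rectangle_ring)
  qed
  ultimately show ?thesis
    unfolding joining_contents_def by (auto simp: joining_content_def)
qed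

lemma joining_of_joining_content:
  assumes b: "b \<in> joining_contents K M R N R'" and mp: "mp_family K M R" "mp_family K N R'"
    and M: "prob_space M" "compactly_coded M \<phi>" and N: "prob_space N" "compactly_coded N \<psi>"
  obtains \<kappa> where "\<kappa> \<in> joinings K M R N R'" "joining_content M N \<kappa> = b"
proof -
  interpret M: prob_space M by fact
  interpret N: prob_space N by fact
  have jc: "joint_content M N b" using b unfolding joining_contents_def by blast
  have b0: "0 \<le> b X" for X using jc unfolding joint_content_def by blast
  obtain \<kappa> where s: "sets \<kappa> = sets (M \<Otimes>\<^sub>M N)"
    and em: "\<And>X. X \<in> rectangle_ring M N \<Longrightarrow> emeasure \<kappa> X = ennreal (b X)"
    using joint_content_extends[OF jc M(2) N(2)] by blast
  have sp: "space \<kappa> = space M \<times> space N" using sets_eq_imp_space_eq[OF s] by (simp add: space_pair_measure)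
  have emr: "emeasure \<kappa> (A \<times> B) = ennreal (b (A \<times> B))" if "A \<in> sets M" "B \<in> sets N" for A B
    using that by (intro em Times_in_rectangle_ring)
  have marg: "b (A \<times> space N) = measure M A" "b (space M \<times> B) = measure N B" if "A \<in> sets M" "B \<in> sets N" for A B
    using jc that unfolding joint_content_def by blast+
  interpret \<kappa>: prob_space \<kappa>
  proof
    show "emeasure \<kappa> (space \<kappa>) = 1" using emr[of "space M" "space N"] marg[of "space M" "space N"]
      by (simp add: sp M.prob_space)
  qed
  have f: "fst \<in> measurable \<kappa> M" "snd \<in> measurable \<kappa> N"
    by (simp_all add: measurable_cong_sets[OF s refl])
  have "distr \<kappa> M fst = M"
  proof (rule measure_eqI)
    fix A assume "A \<in> sets (distr \<kappa> M fst)"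
    then have A: "A \<in> sets M" by simp
    have "emeasure (distr \<kappa> M fst) A = emeasure \<kappa> (fst -` A \<inter> space \<kappa>)" using emeasure_distr[OF f(1) A] .
    also have "fst -` A \<inter> space \<kappa> = A \<times> space N" using sets.sets_into_space[OF A] by (auto simp: sp)
    finally show "emeasure (distr \<kappa> M fst) A = emeasure M A"
      using emr[OF A sets.top] marg[OF A sets.top] by (simp add: M.emeasure_eq_measure)
  qed simp
  moreover have "distr \<kappa> N snd = N"
  proof (rule measure_eqI)
    fix B assume "B \<in> sets (distr \<kappa> N snd)"
    then have B: "B \<in> sets N" by simp
    have "emeasure (distr \<kappa> N snd) B = emeasure \<kappa> (snd -` B \<inter> space \<kappa>)" using emeasure_distr[OF f(2) B] .
    also have "snd -` B \<inter> space \<kappa> = space M \<times> B" using sets.sets_into_space[OF B] by (auto simp: sp)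
    finally show "emeasure (distr \<kappa> N snd) B = emeasure N B"
      using emr[OF sets.top B] marg[OF sets.top B] by (simp add: N.emeasure_eq_measure)
  qed simp
  moreover have "distr \<kappa> \<kappa> (map_prod (R g) (R' g)) = \<kappa>" if g: "g \<in> K" for g
  proof (rule measure_eqI_rectangles[where M=M and N=N])
    have mm: "map_prod (R g) (R' g) \<in> measurable \<kappa> \<kappa>" by (rule map_prod_measurable_family[OF mp g s])
    show "finite_measure (distr \<kappa> \<kappa> (map_prod (R g) (R' g)))" by (rule \<kappa>.finite_measure_distr[OF mm])
    fix A B assume A: "A \<in> sets M" and B: "B \<in> sets N"
    have m: "R g \<in> measurable M M" "R' g \<in> measurable N N"
      using mp g unfolding mp_family_def by blast+
    have "emeasure (distr \<kappa> \<kappa> (map_prod (R g) (R' g))) (A \<times> B) = emeasure \<kappa> (map_prod (R g) (R' g) -` (A \<times> B) \<inter> space \<kappa>)"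
      using A B s by (intro emeasure_distr mm) auto
    also have "map_prod (R g) (R' g) -` (A \<times> B) \<inter> space \<kappa> = (R g -` A \<inter> space M) \<times> (R' g -` B \<inter> space N)"
      by (auto simp: sp)
    also have "emeasure \<kappa> \<dots> = ennreal (b \<dots>)"
      by (rule emr[OF measurable_sets[OF m(1) A] measurable_sets[OF m(2) B]])
    also have "b ((R g -` A \<inter> space M) \<times> (R' g -` B \<inter> space N)) = b (A \<times> B)"
      using b g A B unfolding joining_contents_def by blast
    finally show "emeasure (distr \<kappa> \<kappa> (map_prod (R g) (R' g))) (A \<times> B) = emeasure \<kappa> (A \<times> B)"
      using emr[OF A B] by simp
  qed (simp_all add: s)
  ultimately have "\<kappa> \<in> joinings K M R N R'"
    unfolding joinings_def using s \<kappa>.prob_space_axioms by blast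
  moreover have "joining_content M N \<kappa> = b"
  proof
    fix X show "joining_content M N \<kappa> X = b X"
      using b em[of X] b0 unfolding joining_contents_def by (auto simp: joining_content_def measure_def)
  qed
  ultimately show thesis by (rule that)
qed

text \<open>The content of \<open>\<kappa>\<close> is an extreme point at which the coordinate \<open>A \<times> B\<close> is maximal. If an
invariant set \<open>C\<close> had measure strictly between \<open>0\<close> and \<open>1\<close>, then \<open>\<kappa>\<close> would be a proper convex
combination of the joinings obtained by conditioning on \<open>C\<close> and on its complement. Extremality
makes these equal, but \<open>C\<close> has measure \<open>1\<close> for the first and \<open>0\<close> for the second.\<close>

lemma ergodic_joining_dominates_on_rectangle:
  assumes M: "prob_space M" "standard_borel M" "ergodic K M R" "mp_family K M R"
    and N: "prob_space N" "standard_borel N" "ergodic K N R'" "mp_family K N R'"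
    and \<kappa>0: "\<kappa>0 \<in> joinings K M R N R'" and A: "A \<in> sets M" and B: "B \<in> sets N"
  obtains \<kappa> where "\<kappa> \<in> ergodic_joinings K M R N R'" "measure \<kappa>0 (A \<times> B) \<le> measure \<kappa> (A \<times> B)"
proof -
  interpret M: prob_space M by fact
  interpret N: prob_space N by fact
  obtain \<phi> where \<phi>: "compactly_coded M \<phi>"
    using standard_borel_compactly_coded[OF M(2) M.finite_measure_axioms M.not_empty] by blast
  obtain \<psi> where \<psi>: "compactly_coded N \<psi>"
    using standard_borel_compactly_coded[OF N(2) N.finite_measure_axioms N.not_empty] by blast
  let ?S = "joining_contents K M R N R'"
  have k0: "joining_content M N \<kappa>0 \<in> ?S"
    by (rule joining_content_in_joining_contents[OF \<kappa>0 M(4) N(4)])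
  then have ne: "?S \<noteq> {}" by blast
  obtain b where b: "b \<in> ?S" "\<And>x. x \<in> ?S \<Longrightarrow> x (A \<times> B) \<le> b (A \<times> B)"
    and ext: "\<And>x y t. x \<in> ?S \<Longrightarrow> y \<in> ?S \<Longrightarrow> 0 < t \<Longrightarrow> t < 1 \<Longrightarrow>
      (\<And>i. b i = (1 - t) * x i + t * y i) \<Longrightarrow> x = y"
    using compact_extreme_point_maximizing_coordinate[OF compact_joining_contents ne closed_joining_contents, of "A \<times> B"]
    by metis
  obtain \<kappa> where \<kappa>: "\<kappa> \<in> joinings K M R N R'" and bk: "joining_content M N \<kappa> = b"
    by (rule joining_of_joining_content[OF b(1) M(4) N(4) M(1) \<phi> N(1) \<psi>])
  have prob: "prob_space \<kappa>" and s: "sets \<kappa> = sets (M \<Otimes>\<^sub>M N)" and d: "distr \<kappa> M fst = M" "distr \<kappa> N snd = N"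
    and inv: "\<And>g. g \<in> K \<Longrightarrow> distr \<kappa> \<kappa> (map_prod (R g) (R' g)) = \<kappa>"
    using \<kappa> unfolding joinings_def by blast+
  interpret \<kappa>: prob_space \<kappa> by fact
  have sp: "space \<kappa> = space M \<times> space N" using sets_eq_imp_space_eq[OF s] by (simp add: space_pair_measure)
  have f: "fst \<in> measurable \<kappa> M" "snd \<in> measurable \<kappa> N"
    by (simp_all add: measurable_cong_sets[OF s refl])
  have T: "map_prod (R g) (R' g) \<in> measurable \<kappa> \<kappa>" if "g \<in> K" for g
    by (rule map_prod_measurable_family[OF M(4) N(4) that s])
  have cond: "\<exists>\<kappa>'\<in>joinings K M R N R'. \<forall>Z\<in>sets \<kappa>. measure \<kappa> C * measure \<kappa>' Z = measure \<kappa> (C \<inter> Z)"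
    if C: "C \<in> sets \<kappa>" "\<And>g. g \<in> K \<Longrightarrow> AE x in \<kappa>. map_prod (R g) (R' g) x \<in> C \<longleftrightarrow> x \<in> C"
      and pos: "0 < measure \<kappa> C" for C
  proof -
    obtain \<kappa>' where \<kappa>': "\<kappa>' \<in> joinings K M R N R'"
      "\<And>Z. Z \<in> sets (M \<Otimes>\<^sub>M N) \<Longrightarrow>
        measure \<kappa> C * measure \<kappa>' Z = measure \<kappa> (C \<inter> ((\<lambda>x. (fst x, snd x)) -` Z \<inter> space \<kappa>))"
      by (rule conditioned_joining[where K=K and T="\<lambda>g. map_prod (R g) (R' g)" and R=R and R'=R' and C=C
            and \<pi>=fst and \<rho>=snd, OF prob M(1,3,4) N(1,3,4) T inv C pos f(1) d(1) _ f(2) d(2)]) auto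
    have "C \<inter> ((\<lambda>x. (fst x, snd x)) -` Z \<inter> space \<kappa>) = C \<inter> Z" for Z
      using sets.sets_into_space[OF C(1)] by auto
    then show ?thesis using \<kappa>' s by auto
  qed
  have "ergodic K \<kappa> (\<lambda>g. map_prod (R g) (R' g))"
    unfolding ergodic_def
  proof (intro ballI impI, rule ccontr)
    fix C assume C: "C \<in> sets \<kappa>" and Ci: "\<forall>g\<in>K. AE x in \<kappa>. map_prod (R g) (R' g) x \<in> C \<longleftrightarrow> x \<in> C"
      and "\<not> (measure \<kappa> C = 0 \<or> measure \<kappa> C = 1)"
    then have t: "0 < measure \<kappa> C" "measure \<kappa> C < 1"
      using \<kappa>.prob_le_1[of C] by (auto simp: less_le measure_nonneg)
    let ?D = "space \<kappa> - C"
    have D: "?D \<in> sets \<kappa>" "measure \<kappa> ?D = 1 - measure \<kappa> C" using C \<kappa>.prob_compl by auto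
    have Di: "AE x in \<kappa>. map_prod (R g) (R' g) x \<in> ?D \<longleftrightarrow> x \<in> ?D" if "g \<in> K" for g
      using bspec[OF Ci that] AE_space
    proof eventually_elim
      case (elim x)
      then show ?case using measurable_space[OF T[OF that], of x] by blast
    qed
    obtain \<kappa>1 where \<kappa>1: "\<kappa>1 \<in> joinings K M R N R'"
      "\<And>Z. Z \<in> sets \<kappa> \<Longrightarrow> measure \<kappa> C * measure \<kappa>1 Z = measure \<kappa> (C \<inter> Z)"
      using cond[OF C bspec[OF Ci] t(1)] by blast
    obtain \<kappa>2 where \<kappa>2: "\<kappa>2 \<in> joinings K M R N R'"
      "\<And>Z. Z \<in> sets \<kappa> \<Longrightarrow> measure \<kappa> ?D * measure \<kappa>2 Z = measure \<kappa> (?D \<inter> Z)"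
      using cond[OF D(1) Di] D t by auto
    have "joining_content M N \<kappa>1 = joining_content M N \<kappa>2"
    proof (rule ext[of _ _ "1 - measure \<kappa> C"])
      show "joining_content M N \<kappa>1 \<in> ?S" by (rule joining_content_in_joining_contents[OF \<kappa>1(1) M(4) N(4)])
      show "joining_content M N \<kappa>2 \<in> ?S" by (rule joining_content_in_joining_contents[OF \<kappa>2(1) M(4) N(4)])
      show "0 < 1 - measure \<kappa> C" "1 - measure \<kappa> C < 1" using t by auto
      fix X
      show "b X = (1 - (1 - measure \<kappa> C)) * joining_content M N \<kappa>1 X + (1 - measure \<kappa> C) * joining_content M N \<kappa>2 X"
      proof (cases "X \<in> rectangle_ring M N")
        case True
        then have X: "X \<in> sets \<kappa>" using rectangle_ring_subset_sets s by blast
        have "X = (C \<inter> X) \<union> (?D \<inter> X)" using sets.sets_into_space[OF X] by blast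
        then have "measure \<kappa> X = measure \<kappa> ((C \<inter> X) \<union> (?D \<inter> X))" by simp
        also have "\<dots> = measure \<kappa> (C \<inter> X) + measure \<kappa> (?D \<inter> X)"
          using C D(1) X by (intro \<kappa>.finite_measure_Union) auto
        finally have "measure \<kappa> X = measure \<kappa> (C \<inter> X) + measure \<kappa> (?D \<inter> X)" .
        then show ?thesis
          using \<kappa>1(2)[OF X] \<kappa>2(2)[OF X] D(2) True bk[symmetric] by (simp add: joining_content_def)
      next
        case False
        then show ?thesis using bk[symmetric] by (simp add: joining_content_def)
      qed
    qed
    then have eqr: "measure \<kappa>1 (A \<times> B) = measure \<kappa>2 (A \<times> B)" if "A \<in> sets M" "B \<in> sets N" for A B
      using Times_in_rectangle_ring[OF that] by (metis joining_content_def)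
    have p12: "prob_space \<kappa>1" "prob_space \<kappa>2" and s12: "sets \<kappa>1 = sets (M \<Otimes>\<^sub>M N)" "sets \<kappa>2 = sets (M \<Otimes>\<^sub>M N)"
      using \<kappa>1(1) \<kappa>2(1) unfolding joinings_def by blast+
    have "\<kappa>1 = \<kappa>2"
      by (rule measure_eqI_rectangles[OF s12])
         (simp_all add: p12 prob_space.finite_measure eqr finite_measure.emeasure_eq_measure)
    moreover have "measure \<kappa>1 C = 1" using \<kappa>1(2)[OF C] t by simp
    moreover have "measure \<kappa>2 C = 0" using \<kappa>2(2)[OF C] D t by (simp add: Int_Diff Diff_Int_distrib2)
    ultimately show False by simp
  qed
  then have "\<kappa> \<in> ergodic_joinings K M R N R'"
    using \<kappa> unfolding joinings_def ergodic_joinings_def by blast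
  moreover have "measure \<kappa>0 (A \<times> B) \<le> measure \<kappa> (A \<times> B)"
    using b(2)[OF k0] bk[symmetric] A B by (simp add: joining_content_def Times_in_rectangle_ring)
  ultimately show thesis by (rule that)
qed

section \<open>Correlations of indicators under joinings of induced actions\<close>

definition centred_indicator :: "'a measure \<Rightarrow> 'a set \<Rightarrow> 'a \<Rightarrow> complex" where
  "centred_indicator M A x = complex_of_real (indicator A x - measure M A)"

lemma measurable_centred_indicator [measurable]:
  assumes [measurable]: "A \<in> sets M"
  shows "centred_indicator M A \<in> borel_measurable M"
proof -
  have "(\<lambda>x. complex_of_real (indicator A x - a)) \<in> borel_measurable M" for a by measurable
  then show ?thesis unfolding centred_indicator_def .
qed

lemma cmod_centred_indicator_le:
  assumes "prob_space M"
  shows "cmod (centred_indicator M A x) \<le> 1"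
  using prob_space.prob_le_1[OF assms, of A] measure_nonneg[of M A]
  by (auto simp: centred_indicator_def indicator_def simp del: of_real_diff measure_nonneg)

lemma integral_centred_indicator:
  assumes "prob_space M" "A \<in> sets M"
  shows "(\<integral>x. centred_indicator M A x \<partial>M) = 0"
proof -
  interpret prob_space M by fact
  have "(\<integral>x. centred_indicator M A x \<partial>M) = complex_of_real (\<integral>x. indicator A x - measure M A \<partial>M)"
    unfolding centred_indicator_def by (rule integral_complex_of_real)
  also have "(\<integral>x. indicator A x - measure M A \<partial>M) = measure M A - measure M A"
    using assms(2) by (subst Bochner_Integration.integral_diff) (auto simp: prob_space emeasure_eq_measure)
  finally show ?thesis by simp
qed

lemma centred_indicator_L2_0:
  assumes "prob_space M" "A \<in> sets M"
  shows "centred_indicator M A \<in> L2_0 M"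
proof -
  interpret prob_space M by fact
  have [measurable]: "centred_indicator M A \<in> borel_measurable M" using assms(2) by simp
  have "integrable M (\<lambda>x. (cmod (centred_indicator M A x))\<^sup>2)"
    using cmod_centred_indicator_le[OF assms(1)]
    by (intro integrable_const_bound[where B=1]) (auto simp: power_le_one)
  then show ?thesis
    unfolding L2_0_def L2_def using integral_centred_indicator[OF assms] by simp
qed

lemma integral_centred_indicators_restricted:
  assumes \<kappa>: "prob_space \<kappa>"
    and C: "C \<in> sets \<kappa>" and \<pi>: "\<pi> \<in> measurable \<kappa> M" and \<rho>: "\<rho> \<in> measurable \<kappa> N"
    and A: "A \<in> sets M" and B: "B \<in> sets N"
  shows "(\<integral>z. centred_indicator M A (\<pi> z) * centred_indicator N B (\<rho> z) * indicator C z \<partial>\<kappa>) =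
    complex_of_real (measure \<kappa> (C \<inter> ((\<lambda>z. (\<pi> z, \<rho> z)) -` (A \<times> B) \<inter> space \<kappa>))
      - measure N B * measure \<kappa> (C \<inter> (\<pi> -` A \<inter> space \<kappa>))
      - measure M A * measure \<kappa> (C \<inter> (\<rho> -` B \<inter> space \<kappa>))
      + measure M A * measure N B * measure \<kappa> C)"
proof -
  interpret prob_space \<kappa> by fact
  note [measurable] = C \<pi> \<rho> A B
  let ?X = "C \<inter> ((\<lambda>z. (\<pi> z, \<rho> z)) -` (A \<times> B) \<inter> space \<kappa>)"
  let ?Y = "C \<inter> (\<pi> -` A \<inter> space \<kappa>)" and ?Z = "C \<inter> (\<rho> -` B \<inter> space \<kappa>)"
  have "(\<integral>z. centred_indicator M A (\<pi> z) * centred_indicator N B (\<rho> z) * indicator C z \<partial>\<kappa>) =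
      (\<integral>z. complex_of_real (indicator ?X z - measure N B * indicator ?Y z - measure M A * indicator ?Z z
          + measure M A * measure N B * indicator C z) \<partial>\<kappa>)"
    by (intro Bochner_Integration.integral_cong) (auto simp: centred_indicator_def indicator_def algebra_simps)
  also have "\<dots> = complex_of_real (\<integral>z. indicator ?X z - measure N B * indicator ?Y z - measure M A * indicator ?Z z
          + measure M A * measure N B * indicator C z \<partial>\<kappa>)"
    by (rule integral_complex_of_real)
  also have "(\<integral>z. indicator ?X z - measure N B * indicator ?Y z - measure M A * indicator ?Z z
          + measure M A * measure N B * indicator C z \<partial>\<kappa>) =
     measure \<kappa> ?X - measure N B * measure \<kappa> ?Y - measure M A * measure \<kappa> ?Z + measure M A * measure N B * measure \<kappa> C"
  proof -
    have [measurable]: "?X \<in> sets \<kappa>" "?Y \<in> sets \<kappa>" "?Z \<in> sets \<kappa>" by measurable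
    have i: "integrable \<kappa> (indicator U :: _ \<Rightarrow> real)" if "U \<in> sets \<kappa>" for U
      using that by (simp add: emeasure_eq_measure)
    have "measure \<kappa> (U \<inter> space \<kappa>) = measure \<kappa> U" if "U \<in> sets \<kappa>" for U
      using sets.sets_into_space[OF that] by (simp add: Int_absorb2)
    then show ?thesis
      by (simp add: i Bochner_Integration.integral_add Bochner_Integration.integral_diff)
  qed
  finally show ?thesis .
qed

lemma joining_integral_centred_indicators:
  assumes \<kappa>: "\<kappa> \<in> joinings K M R N R'" and A: "A \<in> sets M" and B: "B \<in> sets N"
  shows "(\<integral>z. centred_indicator M A (fst z) * centred_indicator N B (snd z) \<partial>\<kappa>) =
    complex_of_real (measure \<kappa> (A \<times> B) - measure M A * measure N B)"
proof -
  have s: "sets \<kappa> = sets (M \<Otimes>\<^sub>M N)" and p: "prob_space \<kappa>" using \<kappa> unfolding joinings_def by blast+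
  interpret prob_space \<kappa> by fact
  have sp: "space \<kappa> = space M \<times> space N" using sets_eq_imp_space_eq[OF s] by (simp add: space_pair_measure)
  have f: "fst \<in> measurable \<kappa> M" "snd \<in> measurable \<kappa> N"
    by (simp_all add: measurable_cong_sets[OF s refl])
  have e: "space \<kappa> \<inter> ((\<lambda>z. (fst z, snd z)) -` (A \<times> B) \<inter> space \<kappa>) = A \<times> B"
    "space \<kappa> \<inter> (fst -` A \<inter> space \<kappa>) = A \<times> space N"
    "space \<kappa> \<inter> (snd -` B \<inter> space \<kappa>) = space M \<times> B"
    using sets.sets_into_space[OF A] sets.sets_into_space[OF B] by (auto simp: sp)
  have "(\<integral>z. centred_indicator M A (fst z) * centred_indicator N B (snd z) \<partial>\<kappa>) =
    (\<integral>z. centred_indicator M A (fst z) * centred_indicator N B (snd z) * indicator (space \<kappa>) z \<partial>\<kappa>)"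
    by (intro Bochner_Integration.integral_cong) auto
  also have "\<dots> = complex_of_real (measure \<kappa> (A \<times> B) - measure N B * measure M A
      - measure M A * measure N B + measure M A * measure N B * measure \<kappa> (space \<kappa>))"
    unfolding integral_centred_indicators_restricted[OF p sets.top f A B] e
      joining_marginals(1)[OF \<kappa> A] joining_marginals(2)[OF \<kappa> B] ..
  finally show ?thesis by (simp add: prob_space)
qed

text \<open>If the correlation is negative, the bound from above is applied to the complement of \<open>A\<close>, which
replaces \<open>\<kappa> (A \<times> B)\<close> by \<open>N B - \<kappa> (A \<times> B)\<close>.\<close>

lemma joining_correlation_le_ergodic:
  assumes M: "prob_space M" "standard_borel M" "ergodic K M R" "mp_family K M R"
    and N: "prob_space N" "standard_borel N" "ergodic K N R'" "mp_family K N R'"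
    and \<kappa>: "\<kappa> \<in> joinings K M R N R'" and A: "A \<in> sets M" and B: "B \<in> sets N"
  obtains \<kappa>' where "\<kappa>' \<in> ergodic_joinings K M R N R'"
    "\<bar>measure \<kappa> (A \<times> B) - measure M A * measure N B\<bar> \<le> \<bar>measure \<kappa>' (A \<times> B) - measure M A * measure N B\<bar>"
proof (cases "measure M A * measure N B \<le> measure \<kappa> (A \<times> B)")
  case True
  obtain \<kappa>' where "\<kappa>' \<in> ergodic_joinings K M R N R'" "measure \<kappa> (A \<times> B) \<le> measure \<kappa>' (A \<times> B)"
    by (rule ergodic_joining_dominates_on_rectangle[OF M N \<kappa> A B])
  with True show thesis by (intro that[of \<kappa>']) auto
next
  case False
  have A': "space M - A \<in> sets M" using A by simp
  obtain \<kappa>' where \<kappa>': "\<kappa>' \<in> ergodic_joinings K M R N R'"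
    and le: "measure \<kappa> ((space M - A) \<times> B) \<le> measure \<kappa>' ((space M - A) \<times> B)"
    by (rule ergodic_joining_dominates_on_rectangle[OF M N \<kappa> A' B])
  have compl: "measure \<mu> ((space M - A) \<times> B) = measure N B - measure \<mu> (A \<times> B)"
    if \<mu>: "\<mu> \<in> joinings K M R N R'" for \<mu>
  proof -
    have s: "sets \<mu> = sets (M \<Otimes>\<^sub>M N)" and "prob_space \<mu>" using \<mu> unfolding joinings_def by blast+
    then interpret prob_space \<mu> by simp
    have "(space M - A) \<times> B = space M \<times> B - A \<times> B" by auto
    moreover have "A \<times> B \<subseteq> space M \<times> B" using sets.sets_into_space[OF A] by auto
    ultimately show ?thesis
      using finite_measure_Diff[of "space M \<times> B" "A \<times> B"] A B s joining_marginals(2)[OF \<mu> B] by simp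
  qed
  have "\<kappa>' \<in> joinings K M R N R'" using \<kappa>' unfolding joinings_def ergodic_joinings_def by blast
  with False le compl \<kappa> show thesis by (intro that[OF \<kappa>']) simp
qed

lemma add_subgroup_sum: "add_subgroup H \<Longrightarrow> h \<in> H \<Longrightarrow> (\<Sum>i<p. h) \<in> H" for p :: nat
  by (induction p) (auto simp: add_subgroup_def)

lemma coset_translate:
  assumes H: "add_subgroup H" and h: "h \<in> H" and c: "c \<in> range (coset H)"
  shows "(+) h ` c = c"
proof -
  obtain x where c: "c = (+) x ` H" using c by (auto simp: coset_def)
  have "y \<in> (+) h ` H" if "y \<in> H" for y
  proof -
    have "- h + y \<in> H" using H h that unfolding add_subgroup_def by blast
    then show ?thesis by (metis add_minus_cancel image_eqI)
  qed
  moreover have "h + y \<in> H" if "y \<in> H" for y using H h that unfolding add_subgroup_def by blast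
  ultimately have "(+) h ` H = H" by blast
  moreover have "(+) h ` (+) x ` H = (+) x ` (+) h ` H" by (simp add: image_image add.left_commute)
  ultimately have "(+) h ` (+) x ` H = (+) x ` H" by simp
  then show ?thesis by (simp add: c)
qed

text \<open>Commutativity gives \<open>- s c + h + s c = h\<close>, so a subgroup element acts by itself in every fibre.\<close>

lemma induced_action_subgroup:
  assumes "add_subgroup H" "h \<in> H" "c \<in> range (coset H)"
  shows "induced_action s S h (y, c) = (S h y, c)"
  by (simp add: induced_action_def cocycle_def coset_translate[OF assms])

lemma mp_family_pow_action:
  assumes H: "add_subgroup H" and S: "mp_action H M S"
  shows "mp_family H M (pow_action S p)"
  unfolding mp_family_def
proof (intro ballI conjI)
  have m: "S h \<in> measurable M M" if h: "h \<in> H" for h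
  proof -
    have "(\<lambda>(g, x). S g x) \<in> measurable (restrict_space borel H \<Otimes>\<^sub>M M) M" using S unfolding mp_action_def by blast
    moreover have "Pair h \<in> measurable M (restrict_space borel H \<Otimes>\<^sub>M M)"
      using h by (intro measurable_Pair1') (simp add: space_restrict_space)
    ultimately have "(\<lambda>(g, x). S g x) \<circ> Pair h \<in> measurable M M" by (intro measurable_comp)
    then have "(\<lambda>x. S h x) \<in> measurable M M" by (simp add: comp_def)
    then show ?thesis by simp
  qed
  fix g assume g: "g \<in> H"
  have pg: "(\<Sum>i<p. g) \<in> H" by (rule add_subgroup_sum[OF H g])
  then have npg: "- (\<Sum>i<p. g) \<in> H" using H unfolding add_subgroup_def by blast
  show "pow_action S p g \<in> measurable M M" using m[OF pg] by (simp add: pow_action_def)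
  show "distr M M (pow_action S p g) = M" using S pg unfolding mp_action_def pow_action_def by blast
  have "S (- (\<Sum>i<p. g)) (S (\<Sum>i<p. g) x) = x" if x: "x \<in> space M" for x
  proof -
    have "S (- (\<Sum>i<p. g) + (\<Sum>i<p. g)) x = S (- (\<Sum>i<p. g)) (S (\<Sum>i<p. g) x)"
      using S pg npg x unfolding mp_action_def by blast
    then show ?thesis using S x unfolding mp_action_def by simp
  qed
  then show "\<exists>Q\<in>measurable M M. \<forall>x\<in>space M. Q (pow_action S p g x) = x"
    unfolding pow_action_def by (intro bexI[OF _ m[OF npg]]) blast
qed

text \<open>With \<open>U\<close> the set where the coset coordinates lie in \<open>C\<close> and \<open>D\<close>, the integral is the measure of
\<open>U\<close> times the integral of the centred indicators against the joining \<open>\<kappa>'\<close> conditioned on \<open>U\<close>;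
the latter is the correlation \<open>\<kappa>' (A \<times> B) - M A * M B\<close>, which an ergodic joining dominates.\<close>

lemma induced_joining_correlation:
  assumes H: "add_subgroup H" and M: "prob_space M" "standard_borel M" and S: "mp_action H M S"
    and erg: "ergodic H M (pow_action S p)" "ergodic H M (pow_action S q)"
    and N: "prob_space N" "space N = range (coset H)"
    and \<kappa>: "\<kappa> \<in> joinings UNIV (M \<Otimes>\<^sub>M N) (pow_action (induced_action s S) p) (M \<Otimes>\<^sub>M N) (pow_action (induced_action s S) q)"
    and AB: "A \<in> sets M" "B \<in> sets M" and CD: "C \<in> sets N" "D \<in> sets N"
  shows "ennreal (cmod (\<integral>z. (centred_indicator M A (fst (fst z)) * indicator C (snd (fst z))) *
        (centred_indicator M B (fst (snd z)) * indicator D (snd (snd z))) \<partial>\<kappa>))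
      \<le> joining_sup H M S p q (centred_indicator M A) (centred_indicator M B)"
proof -
  let ?P = "M \<Otimes>\<^sub>M N"
  interpret N: prob_space N by fact
  interpret M: prob_space M by fact
  have p\<kappa>: "prob_space \<kappa>" and s: "sets \<kappa> = sets (?P \<Otimes>\<^sub>M ?P)"
    and d: "distr \<kappa> ?P fst = ?P" "distr \<kappa> ?P snd = ?P"
    and inv: "\<And>g. distr \<kappa> \<kappa> (map_prod (pow_action (induced_action s S) p g) (pow_action (induced_action s S) q g)) = \<kappa>"
    using \<kappa> unfolding joinings_def by blast+
  interpret \<kappa>: prob_space \<kappa> by fact
  note s[measurable_cong]
  have sp: "space \<kappa> = (space M \<times> range (coset H)) \<times> (space M \<times> range (coset H))"
    using sets_eq_imp_space_eq[OF s] by (simp add: space_pair_measure N(2))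
  note mp = mp_family_pow_action[OF H S]
  define U where "U = {z\<in>space \<kappa>. snd (fst z) \<in> C \<and> snd (snd z) \<in> D}"
  have [measurable]: "C \<in> sets N" "D \<in> sets N" "A \<in> sets M" "B \<in> sets M" by fact+
  have U [measurable]: "U \<in> sets \<kappa>" unfolding U_def by measurable
  let ?T = "\<lambda>g. map_prod (pow_action (induced_action s S) p g) (pow_action (induced_action s S) q g)"
  have T: "?T g z = ((pow_action S p g (fst (fst z)), snd (fst z)), (pow_action S q g (fst (snd z)), snd (snd z)))"
    if g: "g \<in> H" and z: "z \<in> space \<kappa>" for g z
    using z by (auto simp: sp pow_action_def induced_action_subgroup[OF H add_subgroup_sum[OF H g]])
  have Tm: "?T g \<in> measurable \<kappa> \<kappa>" if g: "g \<in> H" for g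
  proof -
    have [measurable]: "pow_action S p g \<in> measurable M M" "pow_action S q g \<in> measurable M M"
      using mp g unfolding mp_family_def by blast+
    have "(\<lambda>z. ((pow_action S p g (fst (fst z)), snd (fst z)), (pow_action S q g (fst (snd z)), snd (snd z)))) \<in> measurable \<kappa> \<kappa>"
      by measurable
    then show ?thesis using T[OF g] by (subst measurable_cong) auto
  qed
  have TU: "AE z in \<kappa>. ?T g z \<in> U \<longleftrightarrow> z \<in> U" if g: "g \<in> H" for g
    using measurable_space[OF Tm[OF g]] T[OF g] by (intro AE_I2) (auto simp: U_def)
  have \<pi>: "(\<lambda>z. fst (fst z)) \<in> measurable \<kappa> M" "(\<lambda>z. fst (snd z)) \<in> measurable \<kappa> M" by measurable
  have dfst: "distr ?P M fst = M" by (rule N.distr_pair_fst)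
  have d\<pi>: "distr \<kappa> M (\<lambda>z. fst (fst z)) = M"
  proof -
    have "distr \<kappa> M (fst \<circ> fst) = distr (distr \<kappa> ?P fst) M fst" by (rule distr_distr[symmetric]) measurable
    then show ?thesis using d dfst by (simp add: comp_def)
  qed
  have d\<rho>: "distr \<kappa> M (\<lambda>z. fst (snd z)) = M"
  proof -
    have "distr \<kappa> M (fst \<circ> snd) = distr (distr \<kappa> ?P snd) M fst" by (rule distr_distr[symmetric]) measurable
    then show ?thesis using d dfst by (simp add: comp_def)
  qed
  let ?I = "\<integral>z. (centred_indicator M A (fst (fst z)) * indicator C (snd (fst z))) *
        (centred_indicator M B (fst (snd z)) * indicator D (snd (snd z))) \<partial>\<kappa>"
  have I: "?I = (\<integral>z. centred_indicator M A (fst (fst z)) * centred_indicator M B (fst (snd z)) * indicator U z \<partial>\<kappa>)"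
    by (intro Bochner_Integration.integral_cong) (auto simp: U_def indicator_def)
  show ?thesis
  proof (cases "measure \<kappa> U = 0")
    case True
    then have "AE z in \<kappa>. z \<notin> U" using U by (simp add: \<kappa>.prob_eq_0)
    then have "AE z in \<kappa>. centred_indicator M A (fst (fst z)) * centred_indicator M B (fst (snd z)) * indicator U z = 0"
      by eventually_elim simp
    then have "?I = 0" unfolding I by (rule integral_eq_zero_AE)
    then show ?thesis by simp
  next
    case False
    then have pos: "0 < measure \<kappa> U" by (simp add: less_le)
    obtain \<kappa>' where \<kappa>': "\<kappa>' \<in> joinings H M (pow_action S p) M (pow_action S q)"
      and me: "\<And>Z. Z \<in> sets (M \<Otimes>\<^sub>M M) \<Longrightarrow> measure \<kappa> U * measure \<kappa>' Z =
        measure \<kappa> (U \<inter> ((\<lambda>z. (fst (fst z), fst (snd z))) -` Z \<inter> space \<kappa>))"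
      by (rule conditioned_joining[where K=H and T="?T" and R="pow_action S p" and R'="pow_action S q" and C=U
            and \<pi>="\<lambda>z. fst (fst z)" and \<rho>="\<lambda>z. fst (snd z)",
            OF p\<kappa> M(1) erg(1) mp M(1) erg(2) mp Tm inv U TU pos \<pi>(1) d\<pi> _ \<pi>(2) d\<rho>])
         (simp_all add: T)
    have e: "(\<lambda>z. (fst (fst z), fst (snd z))) -` (A \<times> space M) \<inter> space \<kappa> = (\<lambda>z. fst (fst z)) -` A \<inter> space \<kappa>"
      "(\<lambda>z. (fst (fst z), fst (snd z))) -` (space M \<times> B) \<inter> space \<kappa> = (\<lambda>z. fst (snd z)) -` B \<inter> space \<kappa>"
      by (auto simp: sp)
    have m1: "measure \<kappa> (U \<inter> ((\<lambda>z. fst (fst z)) -` A \<inter> space \<kappa>)) = measure \<kappa> U * measure M A"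
      using me[of "A \<times> space M"] joining_marginals(1)[OF \<kappa>' AB(1)] by (simp add: e)
    have m2: "measure \<kappa> (U \<inter> ((\<lambda>z. fst (snd z)) -` B \<inter> space \<kappa>)) = measure \<kappa> U * measure M B"
      using me[of "space M \<times> B"] joining_marginals(2)[OF \<kappa>' AB(2)] by (simp add: e)
    have "?I = complex_of_real (measure \<kappa> U * (measure \<kappa>' (A \<times> B) - measure M A * measure M B))"
      unfolding I integral_centred_indicators_restricted[OF p\<kappa> U \<pi> AB] m1 m2
      using me[of "A \<times> B"] AB by (simp add: algebra_simps)
    then have "cmod ?I = measure \<kappa> U * \<bar>measure \<kappa>' (A \<times> B) - measure M A * measure M B\<bar>"
      by (simp only: norm_of_real abs_mult abs_of_nonneg[OF measure_nonneg])
    also have "\<dots> \<le> 1 * \<bar>measure \<kappa>' (A \<times> B) - measure M A * measure M B\<bar>"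
      by (intro mult_right_mono \<kappa>.prob_le_1) simp
    finally have le1: "cmod ?I \<le> \<bar>measure \<kappa>' (A \<times> B) - measure M A * measure M B\<bar>" by simp
    obtain \<kappa>'' where \<kappa>'': "\<kappa>'' \<in> ergodic_joinings H M (pow_action S p) M (pow_action S q)"
      and le2: "\<bar>measure \<kappa>' (A \<times> B) - measure M A * measure M B\<bar> \<le> \<bar>measure \<kappa>'' (A \<times> B) - measure M A * measure M B\<bar>"
      by (rule joining_correlation_le_ergodic[OF M erg(1) mp M erg(2) mp \<kappa>' AB])
    have j: "\<kappa>'' \<in> joinings H M (pow_action S p) M (pow_action S q)"
      using \<kappa>'' unfolding joinings_def ergodic_joinings_def by blast
    have "cmod ?I \<le> cmod (\<integral>z. centred_indicator M A (fst z) * centred_indicator M B (snd z) \<partial>\<kappa>'')"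
      using le1 le2 unfolding joining_integral_centred_indicators[OF j AB] norm_of_real by linarith
    then have "ennreal (cmod ?I) \<le> ennreal (cmod (\<integral>z. centred_indicator M A (fst z) * centred_indicator M B (snd z) \<partial>\<kappa>''))"
      by (rule ennreal_leI)
    also have "\<dots> \<le> joining_sup H M S p q (centred_indicator M A) (centred_indicator M B)"
      unfolding joining_sup_def by (rule SUP_upper[OF \<kappa>''])
    finally show ?thesis .
  qed
qed

section \<open>Square integrable functions on a product\<close>

text \<open>A linear combination of indicators of rectangles is represented by its list of coefficients and
sides, so that the operation of centring every \<open>A\<close> can be defined on the representation.\<close>

definition rect_fun :: "(complex \<times> 'a set \<times> 'b set) list \<Rightarrow> 'a \<times> 'b \<Rightarrow> complex" where
  "rect_fun xs z = (\<Sum>(c, A, C)\<leftarrow>xs. c * (indicator A (fst z) * indicator C (snd z)))"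

definition rect_coeffs :: "'a measure \<Rightarrow> 'b measure \<Rightarrow> (complex \<times> 'a set \<times> 'b set) list set" where
  "rect_coeffs M N = lists (UNIV \<times> sets M \<times> sets N)"

lemma rect_fun_simps [simp]:
  "rect_fun [] z = 0"
  "rect_fun ((c, A, C) # xs) z = c * (indicator A (fst z) * indicator C (snd z)) + rect_fun xs z"
  "rect_fun (xs @ ys) z = rect_fun xs z + rect_fun ys z"
  by (simp_all add: rect_fun_def)

lemma rect_coeffs_simps [simp]:
  "[] \<in> rect_coeffs M N"
  "(c, A, C) # xs \<in> rect_coeffs M N \<longleftrightarrow> A \<in> sets M \<and> C \<in> sets N \<and> xs \<in> rect_coeffs M N"
  "xs @ ys \<in> rect_coeffs M N \<longleftrightarrow> xs \<in> rect_coeffs M N \<and> ys \<in> rect_coeffs M N"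
  by (auto simp: rect_coeffs_def)

lemma measurable_rect_fun [measurable]:
  "xs \<in> rect_coeffs M N \<Longrightarrow> rect_fun xs \<in> borel_measurable (M \<Otimes>\<^sub>M N)"
proof (induction xs)
  case Nil
  have "rect_fun [] = (\<lambda>z. 0)" by auto
  then show ?case by simp
next
  case (Cons x xs)
  obtain c A C where x: "x = (c, A, C)" by (cases x)
  have [measurable]: "A \<in> sets M" "C \<in> sets N" "rect_fun xs \<in> borel_measurable (M \<Otimes>\<^sub>M N)"
    using Cons x by auto
  have "rect_fun (x # xs) = (\<lambda>z. c * (indicator A (fst z) * indicator C (snd z)) + rect_fun xs z)"
    by (auto simp: x)
  then show ?case by simp
qed

definition sqnorm :: "'x measure \<Rightarrow> ('x \<Rightarrow> complex) \<Rightarrow> ennreal" where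
  "sqnorm P f = (\<integral>\<^sup>+z. ennreal ((cmod (f z))\<^sup>2) \<partial>P)"

definition sqdist :: "'x measure \<Rightarrow> ('x \<Rightarrow> complex) \<Rightarrow> ('x \<Rightarrow> complex) \<Rightarrow> ennreal" where
  "sqdist P f g = sqnorm P (\<lambda>z. f z - g z)"

lemma sqdist_triangle:
  assumes [measurable]: "f \<in> borel_measurable P" "g \<in> borel_measurable P" "h \<in> borel_measurable P" "k \<in> borel_measurable P"
  shows "sqdist P (\<lambda>z. f z + h z) (\<lambda>z. g z + k z) \<le> 2 * sqdist P f g + 2 * sqdist P h k"
proof -
  have "sqdist P (\<lambda>z. f z + h z) (\<lambda>z. g z + k z) \<le> 
     (\<integral>\<^sup>+z. 2 * ennreal ((cmod (f z - g z))\<^sup>2) + 2 * ennreal ((cmod (h z - k z))\<^sup>2) \<partial>P)"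
    unfolding sqdist_def sqnorm_def
  proof (intro nn_integral_mono)
    fix z
    let ?a = "cmod (f z - g z)" and ?b = "cmod (h z - k z)"
    have "cmod (f z + h z - (g z + k z)) \<le> ?a + ?b"
      using norm_triangle_ineq[of "f z - g z" "h z - k z"] by (simp add: algebra_simps)
    then have "(cmod (f z + h z - (g z + k z)))\<^sup>2 \<le> (?a + ?b)\<^sup>2" by (intro power_mono) auto
    also have "\<dots> \<le> 2 * ?a\<^sup>2 + 2 * ?b\<^sup>2"
      using zero_le_power2[of "?a - ?b"] by (simp add: power2_eq_square algebra_simps)
    finally have "ennreal ((cmod (f z + h z - (g z + k z)))\<^sup>2) \<le> ennreal (2 * ?a\<^sup>2 + 2 * ?b\<^sup>2)"
      by (rule ennreal_leI)
    then show "ennreal ((cmod (f z + h z - (g z + k z)))\<^sup>2) \<le> 2 * ennreal (?a\<^sup>2) + 2 * ennreal (?b\<^sup>2)"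
      by (simp add: ennreal_plus ennreal_mult)
  qed
  also have "\<dots> = 2 * sqdist P f g + 2 * sqdist P h k"
    unfolding sqdist_def sqnorm_def by (simp add: nn_integral_add nn_integral_cmult)
  finally show ?thesis .
qed

definition rect_approximable :: "'a measure \<Rightarrow> 'b measure \<Rightarrow> ('a \<times> 'b \<Rightarrow> complex) \<Rightarrow> bool" where
  "rect_approximable M N f \<longleftrightarrow> f \<in> borel_measurable (M \<Otimes>\<^sub>M N) \<and>
     (\<forall>e>0. \<exists>xs\<in>rect_coeffs M N. sqdist (M \<Otimes>\<^sub>M N) f (rect_fun xs) < ennreal e)"

lemma rect_approximable_add:
  assumes f: "rect_approximable M N f" and g: "rect_approximable M N g"
  shows "rect_approximable M N (\<lambda>z. f z + g z)"
  unfolding rect_approximable_def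
proof (intro conjI allI impI)
  have fm [measurable]: "f \<in> borel_measurable (M \<Otimes>\<^sub>M N)" "g \<in> borel_measurable (M \<Otimes>\<^sub>M N)"
    using f g by (auto simp: rect_approximable_def)
  show "(\<lambda>z. f z + g z) \<in> borel_measurable (M \<Otimes>\<^sub>M N)" by simp
  fix e :: real assume e: "e > 0"
  then have e4: "e / 4 > 0" by simp
  obtain xs where xs: "xs \<in> rect_coeffs M N" "sqdist (M \<Otimes>\<^sub>M N) f (rect_fun xs) < ennreal (e/4)"
    using f e4 unfolding rect_approximable_def by blast
  obtain ys where ys: "ys \<in> rect_coeffs M N" "sqdist (M \<Otimes>\<^sub>M N) g (rect_fun ys) < ennreal (e/4)"
    using g e4 unfolding rect_approximable_def by blast
  have app: "rect_fun (xs @ ys) = (\<lambda>z. rect_fun xs z + rect_fun ys z)" by auto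
  have "sqdist (M \<Otimes>\<^sub>M N) (\<lambda>z. f z + g z) (rect_fun (xs @ ys))
      \<le> 2 * sqdist (M \<Otimes>\<^sub>M N) f (rect_fun xs) + 2 * sqdist (M \<Otimes>\<^sub>M N) g (rect_fun ys)"
    unfolding app using xs ys by (intro sqdist_triangle) auto
  also have "\<dots> < 2 * ennreal (e/4) + 2 * ennreal (e/4)"
    using xs(2) ys(2) by (intro add_strict_mono ennreal_mult_strict_left_mono) auto
  also have "\<dots> = ennreal e" using e by (simp add: ennreal_plus[symmetric] ennreal_mult'[symmetric] del: ennreal_plus flip: ennreal_numeral)
  finally show "\<exists>xs\<in>rect_coeffs M N. sqdist (M \<Otimes>\<^sub>M N) (\<lambda>z. f z + g z) (rect_fun xs) < ennreal e"
    using xs ys by (intro bexI[of _ "xs @ ys"]) auto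
qed

lemma rect_approximable_limit:
  assumes f [measurable]: "f \<in> borel_measurable (M \<Otimes>\<^sub>M N)"
    and ap: "\<And>i::nat. rect_approximable M N (g i)"
    and lim: "(\<lambda>i. sqdist (M \<Otimes>\<^sub>M N) f (g i)) \<longlonglongrightarrow> 0"
  shows "rect_approximable M N f"
  unfolding rect_approximable_def
proof (intro conjI allI impI f)
  fix e :: real assume e: "e > 0"
  then have e4: "e / 4 > 0" by simp
  have "\<forall>\<^sub>F i in sequentially. sqdist (M \<Otimes>\<^sub>M N) f (g i) < ennreal (e/4)"
    using e4 by (intro order_tendstoD(2)[OF lim]) simp
  then obtain i where i: "sqdist (M \<Otimes>\<^sub>M N) f (g i) < ennreal (e/4)"
    by (meson eventually_sequentially order_refl)
  have gm [measurable]: "g i \<in> borel_measurable (M \<Otimes>\<^sub>M N)" using ap by (simp add: rect_approximable_def)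
  obtain xs where xs: "xs \<in> rect_coeffs M N" "sqdist (M \<Otimes>\<^sub>M N) (g i) (rect_fun xs) < ennreal (e/4)"
    using ap[of i] e4 unfolding rect_approximable_def by blast
  have "sqdist (M \<Otimes>\<^sub>M N) f (rect_fun xs) = sqdist (M \<Otimes>\<^sub>M N) (\<lambda>z. f z + g i z) (\<lambda>z. g i z + rect_fun xs z)"
    by (simp add: sqdist_def sqnorm_def)
  also have "\<dots> \<le> 2 * sqdist (M \<Otimes>\<^sub>M N) f (g i) + 2 * sqdist (M \<Otimes>\<^sub>M N) (g i) (rect_fun xs)"
    using xs by (intro sqdist_triangle) auto
  also have "\<dots> < 2 * ennreal (e/4) + 2 * ennreal (e/4)"
    using xs(2) i by (intro add_strict_mono ennreal_mult_strict_left_mono) auto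
  also have "\<dots> = ennreal e" using e by (simp add: ennreal_plus[symmetric] ennreal_mult'[symmetric] del: ennreal_plus flip: ennreal_numeral)
  finally show "\<exists>xs\<in>rect_coeffs M N. sqdist (M \<Otimes>\<^sub>M N) f (rect_fun xs) < ennreal e"
    using xs by blast
qed

lemma rect_approximable_cmult:
  assumes f: "rect_approximable M N f"
  shows "rect_approximable M N (\<lambda>z. c * f z)"
  unfolding rect_approximable_def
proof (intro conjI allI impI)
  have fm [measurable]: "f \<in> borel_measurable (M \<Otimes>\<^sub>M N)"
    using f by (auto simp: rect_approximable_def)
  show "(\<lambda>z. c * f z) \<in> borel_measurable (M \<Otimes>\<^sub>M N)" by simp
  fix e :: real assume e: "e > 0"
  define k where "k = (cmod c)\<^sup>2 + 1"
  have k: "k > 0" by (auto simp: k_def add_nonneg_pos)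
  obtain xs where xs: "xs \<in> rect_coeffs M N" "sqdist (M \<Otimes>\<^sub>M N) f (rect_fun xs) < ennreal (e / k)"
    using f e k unfolding rect_approximable_def by (metis divide_pos_pos)
  let ?ys = "map (\<lambda>(d, A, C). (c * d, A, C)) xs"
  have ys: "rect_fun ?ys z = c * rect_fun xs z" for z
    by (induction xs) (auto simp: algebra_simps)
  have ysc: "?ys \<in> rect_coeffs M N" using xs(1) unfolding rect_coeffs_def by auto
  have "sqdist (M \<Otimes>\<^sub>M N) (\<lambda>z. c * f z) (rect_fun ?ys)
      = (\<integral>\<^sup>+z. ennreal ((cmod c)\<^sup>2) * ennreal ((cmod (f z - rect_fun xs z))\<^sup>2) \<partial>(M \<Otimes>\<^sub>M N))"
    unfolding sqdist_def sqnorm_def ys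
    by (simp add: right_diff_distrib[symmetric] norm_mult power_mult_distrib ennreal_mult)
  also have "\<dots> = ennreal ((cmod c)\<^sup>2) * sqdist (M \<Otimes>\<^sub>M N) f (rect_fun xs)"
    unfolding sqdist_def sqnorm_def using xs(1) by (simp add: nn_integral_cmult)
  also have "\<dots> \<le> ennreal k * sqdist (M \<Otimes>\<^sub>M N) f (rect_fun xs)"
    by (intro mult_right_mono ennreal_leI) (auto simp: k_def)
  also have "\<dots> < ennreal k * ennreal (e / k)"
    using xs(2) k by (intro ennreal_mult_strict_left_mono) auto
  also have "\<dots> = ennreal e" using k e by (simp add: ennreal_mult'[symmetric])
  finally show "\<exists>xs\<in>rect_coeffs M N. sqdist (M \<Otimes>\<^sub>M N) (\<lambda>z. c * f z) (rect_fun xs) < ennreal e"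
    using ysc by blast
qed

lemma rect_approximable_Times:
  assumes "A \<in> sets M" "C \<in> sets N"
  shows "rect_approximable M N (indicator (A \<times> C))"
  unfolding rect_approximable_def
proof (intro conjI allI impI)
  show "indicator (A \<times> C) \<in> borel_measurable (M \<Otimes>\<^sub>M N)" using assms by simp
  fix e :: real assume "e > 0"
  moreover have "rect_fun [(1, A, C)] = indicator (A \<times> C)" by (auto simp: indicator_def)
  ultimately show "\<exists>xs\<in>rect_coeffs M N. sqdist (M \<Otimes>\<^sub>M N) (indicator (A \<times> C)) (rect_fun xs) < ennreal e"
    using assms by (intro bexI[of _ "[(1, A, C)]"]) (auto simp: sqdist_def sqnorm_def)
qed

lemma rect_approximable_cong:
  assumes "rect_approximable M N f" "\<And>z. z \<in> space (M \<Otimes>\<^sub>M N) \<Longrightarrow> f z = g z"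
  shows "rect_approximable M N g"
proof -
  have "sqdist (M \<Otimes>\<^sub>M N) f h = sqdist (M \<Otimes>\<^sub>M N) g h" for h
    unfolding sqdist_def sqnorm_def using assms(2) by (intro nn_integral_cong) auto
  moreover have "f \<in> borel_measurable (M \<Otimes>\<^sub>M N) \<longleftrightarrow> g \<in> borel_measurable (M \<Otimes>\<^sub>M N)"
    using assms(2) by (intro measurable_cong) auto
  ultimately show ?thesis using assms(1) unfolding rect_approximable_def by simp
qed

lemma rect_approximable_zero: "rect_approximable M N (\<lambda>z. 0)"
  unfolding rect_approximable_def by (auto intro!: bexI[of _ "[]"] simp: sqdist_def sqnorm_def)

lemma rect_approximable_sum:
  "finite I \<Longrightarrow> (\<And>i. i \<in> I \<Longrightarrow> rect_approximable M N (f i)) \<Longrightarrow> rect_approximable M N (\<lambda>z. \<Sum>i\<in>I. f i z)"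
  by (induction I rule: finite_induct) (auto intro: rect_approximable_zero rect_approximable_add)

text \<open>Complements and countable disjoint unions preserve approximability, so the claim follows from
the rectangles, a generator stable under intersections.\<close>

lemma rect_approximable_indicator:
  assumes M: "prob_space M" and N: "prob_space N" and X: "X \<in> sets (M \<Otimes>\<^sub>M N)"
  shows "rect_approximable M N (indicator X)"
proof -
  interpret M: prob_space M by fact
  interpret N: prob_space N by fact
  interpret pair_prob_space M N ..
  let ?P = "M \<Otimes>\<^sub>M N"
  let ?G = "{a \<times> b |a b. a \<in> sets M \<and> b \<in> sets N}"
  have X': "X \<in> sigma_sets (space M \<times> space N) ?G" using X by (simp add: sets_pair_measure)
  have G: "?G \<subseteq> Pow (space M \<times> space N)" by (auto dest: sets.sets_into_space)
  from Int_stable_pair_measure_generator G X' show ?thesis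
  proof (induction rule: sigma_sets_induct_disjoint)
    case (basic A)
    then show ?case using rect_approximable_Times by blast
  next
    case empty
    show ?case by (rule rect_approximable_cong[OF rect_approximable_zero]) simp
  next
    case (compl A)
    have "rect_approximable M N (\<lambda>z. indicator (space M \<times> space N) z + (- 1) * indicator A z)"
      using compl by (intro rect_approximable_add rect_approximable_cmult rect_approximable_Times) auto
    then show ?case
      by (rule rect_approximable_cong) (auto simp: space_pair_measure indicator_def)
  next
    case (union A)
    have As: "A i \<in> sets ?P" for i using union(2) by (auto simp: sets_pair_measure)
    have m: "(\<lambda>i. measure ?P (\<Union>(range A) - (\<Union>j<i. A j))) \<longlonglongrightarrow> 0"
    proof -
      have "(\<lambda>i. measure ?P (\<Union>(range A) - (\<Union>j<i. A j))) \<longlonglongrightarrow> measure ?P (\<Inter>i. \<Union>(range A) - (\<Union>j<i. A j))"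
        using As by (intro finite_Lim_measure_decseq) (auto simp: decseq_def)
      moreover have "(\<Inter>i. \<Union>(range A) - (\<Union>j<i. A j)) = {}" by (auto simp: not_less intro: exI[of _ "Suc _"])
      ultimately show ?thesis by (simp only: measure_empty)
    qed
    show ?case
    proof (rule rect_approximable_limit)
      show "indicator (\<Union>(range A)) \<in> borel_measurable ?P" using As by simp
      show "rect_approximable M N (\<lambda>z. \<Sum>j<i. indicator (A j) z)" for i
        using union by (intro rect_approximable_sum) auto
      have ind: "(\<Sum>j<i. indicator (A j) z) = (indicator (\<Union>j<i. A j) z :: complex)" for i z
      proof -
        have "disjoint_family_on A {..<i}" using union(1) by (auto simp: disjoint_family_on_def)
        then show ?thesis by (simp add: indicator_UN_disjoint)
      qed
      have "sqdist ?P (indicator (\<Union>(range A))) (\<lambda>z. \<Sum>j<i. indicator (A j) z)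
          = ennreal (measure ?P (\<Union>(range A) - (\<Union>j<i. A j)))" for i
      proof -
        have "sqdist ?P (indicator (\<Union>(range A))) (\<lambda>z. \<Sum>j<i. indicator (A j) z)
            = (\<integral>\<^sup>+z. indicator (\<Union>(range A) - (\<Union>j<i. A j)) z \<partial>?P)"
          unfolding sqdist_def sqnorm_def ind by (intro nn_integral_cong) (auto simp: indicator_def)
        then show ?thesis using As by (simp add: emeasure_eq_measure)
      qed
      then show "(\<lambda>i. sqdist ?P (indicator (\<Union>(range A))) (\<lambda>z. \<Sum>j<i. indicator (A j) z)) \<longlonglongrightarrow> 0"
        using m by (simp flip: ennreal_0)
    qed
  qed
qed

lemma rect_approximable_L2:
  assumes M: "prob_space M" and N: "prob_space N" and f: "f \<in> L2 (M \<Otimes>\<^sub>M N)"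
  shows "rect_approximable M N f"
proof -
  let ?P = "M \<Otimes>\<^sub>M N"
  have [measurable]: "f \<in> borel_measurable ?P" and int: "integrable ?P (\<lambda>x. (cmod (f x))\<^sup>2)"
    using f unfolding L2_def by auto
  obtain F where F: "\<And>i. simple_function ?P (F i)" "\<And>x. x \<in> space ?P \<Longrightarrow> (\<lambda>i. F i x) \<longlonglongrightarrow> f x"
    "\<And>i x. x \<in> space ?P \<Longrightarrow> dist (F i x) 0 \<le> 2 * dist (f x) 0"
    using borel_measurable_implies_sequence_metric[OF \<open>f \<in> borel_measurable ?P\<close>, of 0] by metis
  have [measurable]: "F i \<in> borel_measurable ?P" for i using F(1) by (rule borel_measurable_simple_function)
  show ?thesis
  proof (rule rect_approximable_limit[of f M N F])
    show "rect_approximable M N (F i)" for i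
    proof -
      have fin: "finite (F i ` space ?P)" using F(1)[of i] by (simp add: simple_function_def)
      have "rect_approximable M N (\<lambda>z. \<Sum>y\<in>F i ` space ?P. y * indicator (F i -` {y} \<inter> space ?P) z)"
        using F(1)[of i] by (intro rect_approximable_sum fin rect_approximable_cmult rect_approximable_indicator M N)
          (auto simp: simple_function_def)
      then show ?thesis
      proof (rule rect_approximable_cong)
        fix z assume z: "z \<in> space ?P"
        have "(\<Sum>y\<in>F i ` space ?P. y * indicator (F i -` {y} \<inter> space ?P) z)
            = (\<Sum>y\<in>F i ` space ?P. if y = F i z then y else 0)"
          using z by (intro sum.cong) (auto simp: indicator_def)
        then show "(\<Sum>y\<in>F i ` space ?P. y * indicator (F i -` {y} \<inter> space ?P) z) = F i z"
          using z fin by (simp add: sum.delta)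
      qed
    qed
    have "(\<lambda>i. \<integral>\<^sup>+z. ennreal ((cmod (f z - F i z))\<^sup>2) \<partial>?P) \<longlonglongrightarrow> (\<integral>\<^sup>+z. 0 \<partial>?P)"
    proof (rule nn_integral_dominated_convergence[where w="\<lambda>z. ennreal (9 * (cmod (f z))\<^sup>2)"])
      show "AE z in ?P. ennreal ((cmod (f z - F i z))\<^sup>2) \<le> ennreal (9 * (cmod (f z))\<^sup>2)" for i
      proof (rule AE_I2)
        fix z assume z: "z \<in> space ?P"
        have "cmod (f z - F i z) \<le> 3 * cmod (f z)"
          using F(3)[OF z, of i] norm_triangle_ineq4[of "f z" "F i z"] by simp
        then have "(cmod (f z - F i z))\<^sup>2 \<le> (3 * cmod (f z))\<^sup>2" by (intro power_mono) auto
        then show "ennreal ((cmod (f z - F i z))\<^sup>2) \<le> ennreal (9 * (cmod (f z))\<^sup>2)"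
          by (intro ennreal_leI) (simp add: power_mult_distrib)
      qed
      have "integrable ?P (\<lambda>z. 9 * (cmod (f z))\<^sup>2)" using int by simp
      then show "(\<integral>\<^sup>+z. ennreal (9 * (cmod (f z))\<^sup>2) \<partial>?P) < \<infinity>"
        by (subst nn_integral_eq_integral) (auto simp: less_top)
      show "AE z in ?P. (\<lambda>i. ennreal ((cmod (f z - F i z))\<^sup>2)) \<longlonglongrightarrow> 0"
      proof (rule AE_I2)
        fix z assume "z \<in> space ?P"
        then have "(\<lambda>i. (cmod (f z - F i z))\<^sup>2) \<longlonglongrightarrow> (cmod (f z - f z))\<^sup>2"
          by (intro tendsto_intros F(2))
        then show "(\<lambda>i. ennreal ((cmod (f z - F i z))\<^sup>2)) \<longlonglongrightarrow> 0" by (simp flip: ennreal_0)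
      qed
    qed auto
    then show "(\<lambda>i. sqdist ?P f (F i)) \<longlonglongrightarrow> 0" by (simp add: sqdist_def sqnorm_def)
  qed simp
qed

definition centred_term :: "'a measure \<Rightarrow> complex \<times> 'a set \<times> 'b set \<Rightarrow> 'a \<times> 'b \<Rightarrow> complex" where
  "centred_term M = (\<lambda>(c, A, C) z. c * (centred_indicator M A (fst z) * indicator C (snd z)))"

definition centred_rect_fun :: "'a measure \<Rightarrow> (complex \<times> 'a set \<times> 'b set) list \<Rightarrow> 'a \<times> 'b \<Rightarrow> complex" where
  "centred_rect_fun M xs z = (\<Sum>x\<leftarrow>xs. centred_term M x z)"

text \<open>The conditional expectation of \<open>rect_fun xs\<close> given the second coordinate.\<close>

definition fibre_mean :: "'a measure \<Rightarrow> (complex \<times> 'a set \<times> 'b set) list \<Rightarrow> 'b \<Rightarrow> complex" where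
  "fibre_mean M xs y = (\<Sum>(c, A, C)\<leftarrow>xs. c * (complex_of_real (measure M A) * indicator C y))"

lemma rect_fun_eq_centred_plus_mean:
  "rect_fun xs z = centred_rect_fun M xs z + fibre_mean M xs (snd z)"
  by (induction xs)
     (auto simp: centred_rect_fun_def centred_term_def fibre_mean_def centred_indicator_def
        algebra_simps indicator_def)

lemma measurable_centred_term [measurable]:
  assumes "x \<in> UNIV \<times> sets M \<times> sets N"
  shows "centred_term M x \<in> borel_measurable (M \<Otimes>\<^sub>M N)"
proof -
  obtain c A C where x: "x = (c, A, C)" and [measurable]: "A \<in> sets M" "C \<in> sets N"
    using assms by auto
  show ?thesis unfolding x centred_term_def by simp
qed

lemma centred_term_bound:
  assumes "prob_space M"
  shows "cmod (centred_term M x z) \<le> cmod (fst x)"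
proof -
  obtain c A C where x: "x = (c, A, C)" by (cases x)
  have "cmod (centred_indicator M A (fst z)) * cmod (indicator C (snd z)) \<le> 1 * 1"
    using cmod_centred_indicator_le[OF assms] by (intro mult_mono) (auto simp: indicator_def)
  then show ?thesis
    unfolding x centred_term_def by (simp add: norm_mult mult_left_le)
qed

lemma measurable_sum_list [measurable]:
  fixes g :: "'i \<Rightarrow> 'x \<Rightarrow> complex"
  shows "(\<And>x. x \<in> set xs \<Longrightarrow> g x \<in> borel_measurable P) \<Longrightarrow> (\<lambda>z. \<Sum>x\<leftarrow>xs. g x z) \<in> borel_measurable P"
  by (induction xs) auto

lemma bounded_sum_list:
  fixes g :: "'i \<Rightarrow> 'x \<Rightarrow> complex"
  assumes "\<And>x z. x \<in> set xs \<Longrightarrow> cmod (g x z) \<le> b x"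
  shows "cmod (\<Sum>x\<leftarrow>xs. g x z) \<le> (\<Sum>x\<leftarrow>xs. b x)"
  using assms
proof (induction xs)
  case (Cons x xs)
  then have "cmod (g x z) \<le> b x" "cmod (\<Sum>x\<leftarrow>xs. g x z) \<le> (\<Sum>x\<leftarrow>xs. b x)" by auto
  then show ?case using norm_triangle_ineq[of "g x z" "\<Sum>x\<leftarrow>xs. g x z"] by simp
qed simp

lemma bounded_in_L2:
  assumes P: "prob_space P" and [measurable]: "f \<in> borel_measurable P" and b: "\<And>z. cmod (f z) \<le> b"
  shows "f \<in> L2 P"
proof -
  interpret prob_space P by fact
  have "norm ((cmod (f z))\<^sup>2) \<le> b\<^sup>2" for z using b[of z] by (simp add: power_mono)
  then show ?thesis
    unfolding L2_def by (auto intro!: integrable_const_bound[where B="b\<^sup>2"])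
qed

lemma integral_centred_term_fibre:
  assumes M: "prob_space M" and N: "prob_space N" and x: "x \<in> UNIV \<times> sets M \<times> sets N"
    and \<phi>[measurable]: "\<phi> \<in> borel_measurable N" and b: "\<And>y. cmod (\<phi> y) \<le> b"
  shows "(\<integral>z. centred_term M x z * \<phi> (snd z) \<partial>(M \<Otimes>\<^sub>M N)) = 0"
    and "integrable (M \<Otimes>\<^sub>M N) (\<lambda>z. centred_term M x z * \<phi> (snd z))"
proof -
  interpret M: prob_space M by fact
  interpret N: prob_space N by fact
  interpret pair_prob_space M N ..
  obtain c A C where xe: "x = (c, A, C)" and [measurable]: "A \<in> sets M" "C \<in> sets N"
    using x by auto
  have tm: "centred_term M x \<in> borel_measurable (M \<Otimes>\<^sub>M N)" using x by simp
  have "cmod (centred_term M x z * \<phi> (snd z)) \<le> cmod c * b" for z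
    using centred_term_bound[OF M, of x z] b[of "snd z"]
    by (simp add: norm_mult xe mult_mono)
  then show int: "integrable (M \<Otimes>\<^sub>M N) (\<lambda>z. centred_term M x z * \<phi> (snd z))"
    using tm by (intro integrable_const_bound[where B="cmod c * b"]) auto
  have cp: "(\<lambda>z. centred_term M x z * \<phi> (snd z)) = case_prod (\<lambda>u y. centred_indicator M A u * (c * indicator C y * \<phi> y))"
    by (auto simp: xe centred_term_def)
  have "(\<integral>z. centred_term M x z * \<phi> (snd z) \<partial>(M \<Otimes>\<^sub>M N)) =
      (\<integral>y. (\<integral>u. centred_indicator M A u * (c * indicator C y * \<phi> y) \<partial>M) \<partial>N)"
    using int unfolding cp by (rule integral_snd[symmetric])
  also have "\<dots> = 0" using integral_centred_indicator[OF M \<open>A \<in> sets M\<close>] by simp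
  finally show "(\<integral>z. centred_term M x z * \<phi> (snd z) \<partial>(M \<Otimes>\<^sub>M N)) = 0" .
qed

lemma integral_sum_list:
  fixes g :: "'i \<Rightarrow> 'x \<Rightarrow> complex"
  assumes "\<And>x. x \<in> set xs \<Longrightarrow> integrable P (g x)"
  shows "integrable P (\<lambda>z. \<Sum>x\<leftarrow>xs. g x z)" "(\<integral>z. (\<Sum>x\<leftarrow>xs. g x z) \<partial>P) = (\<Sum>x\<leftarrow>xs. \<integral>z. g x z \<partial>P)"
  using assms by (induction xs) auto

lemma integral_centred_rect_fun_fibre:
  assumes M: "prob_space M" and N: "prob_space N" and xs: "xs \<in> rect_coeffs M N"
    and \<phi>: "\<phi> \<in> borel_measurable N" and b: "\<And>y. cmod (\<phi> y) \<le> b"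
  shows "(\<integral>z. centred_rect_fun M xs z * \<phi> (snd z) \<partial>(M \<Otimes>\<^sub>M N)) = 0"
proof -
  have x: "x \<in> UNIV \<times> sets M \<times> sets N" if "x \<in> set xs" for x
    using xs that by (auto simp: rect_coeffs_def)
  have "(\<integral>z. centred_rect_fun M xs z * \<phi> (snd z) \<partial>(M \<Otimes>\<^sub>M N)) =
      (\<integral>z. (\<Sum>x\<leftarrow>xs. centred_term M x z * \<phi> (snd z)) \<partial>(M \<Otimes>\<^sub>M N))"
    unfolding centred_rect_fun_def by (simp add: sum_list_mult_const)
  also have "\<dots> = (\<Sum>x\<leftarrow>xs. \<integral>z. centred_term M x z * \<phi> (snd z) \<partial>(M \<Otimes>\<^sub>M N))"
    by (rule integral_sum_list(2)) (rule integral_centred_term_fibre(2)[OF M N x \<phi> b])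
  also have "\<dots> = (\<Sum>x\<leftarrow>xs. 0)"
    by (rule arg_cong[where f=sum_list], rule map_cong[OF refl])
       (rule integral_centred_term_fibre(1)[OF M N x \<phi> b])
  finally show ?thesis by simp
qed

lemma centred_rect_fun_measurable [measurable]:
  assumes "xs \<in> rect_coeffs M N"
  shows "centred_rect_fun M xs \<in> borel_measurable (M \<Otimes>\<^sub>M N)"
proof -
  have "(\<lambda>z. \<Sum>x\<leftarrow>xs. centred_term M x z) \<in> borel_measurable (M \<Otimes>\<^sub>M N)"
    using assms by (intro measurable_sum_list measurable_centred_term) (auto simp: rect_coeffs_def)
  then show ?thesis unfolding centred_rect_fun_def .
qed

lemma centred_rect_fun_bound:
  assumes "prob_space M"
  shows "cmod (centred_rect_fun M xs z) \<le> (\<Sum>x\<leftarrow>xs. cmod (fst x))"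
  unfolding centred_rect_fun_def by (rule bounded_sum_list) (rule centred_term_bound[OF assms])

lemma fibre_mean_measurable [measurable]:
  "xs \<in> rect_coeffs M N \<Longrightarrow> fibre_mean M xs \<in> borel_measurable N"
proof -
  assume "xs \<in> rect_coeffs M N"
  then have "(\<lambda>y. \<Sum>x\<leftarrow>xs. case x of (c, A, C) \<Rightarrow> c * (complex_of_real (measure M A) * indicator C y)) \<in> borel_measurable N"
    by (intro measurable_sum_list) (auto simp: rect_coeffs_def)
  then show ?thesis unfolding fibre_mean_def .
qed

lemma fibre_mean_bound:
  assumes "prob_space M"
  shows "cmod (fibre_mean M xs y) \<le> (\<Sum>x\<leftarrow>xs. cmod (fst x))"
  unfolding fibre_mean_def
proof (rule bounded_sum_list)
  fix x :: "complex \<times> 'a set \<times> 'b set" and z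
  obtain c A C where x: "x = (c, A, C)" by (cases x)
  have "measure M A * cmod (indicator C z) \<le> 1 * 1"
    using prob_space.prob_le_1[OF assms, of A] by (intro mult_mono) (auto simp: indicator_def)
  then show "cmod (case x of (c, A, C) \<Rightarrow> c * (complex_of_real (measure M A) * indicator C z)) \<le> cmod (fst x)"
    by (simp add: x norm_mult mult_left_le)
qed

lemma L2_diff:
  assumes "f \<in> L2 P" "g \<in> L2 P"
  shows "(\<lambda>z. f z - g z) \<in> L2 P"
proof -
  have [measurable]: "f \<in> borel_measurable P" "g \<in> borel_measurable P"
    and int: "integrable P (\<lambda>z. (cmod (f z))\<^sup>2)" "integrable P (\<lambda>z. (cmod (g z))\<^sup>2)"
    using assms unfolding L2_def by auto
  have dom: "integrable P (\<lambda>z. 2 * (cmod (f z))\<^sup>2 + 2 * (cmod (g z))\<^sup>2)" using int by simp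
  have "(cmod (f z - g z))\<^sup>2 \<le> 2 * (cmod (f z))\<^sup>2 + 2 * (cmod (g z))\<^sup>2" for z
  proof -
    have "(cmod (f z - g z))\<^sup>2 \<le> (cmod (f z) + cmod (g z))\<^sup>2"
      by (intro power_mono norm_triangle_ineq4) simp
    also have "\<dots> \<le> 2 * (cmod (f z))\<^sup>2 + 2 * (cmod (g z))\<^sup>2"
      using zero_le_power2[of "cmod (f z) - cmod (g z)"] by (simp add: power2_eq_square algebra_simps)
    finally show ?thesis .
  qed
  then have bnd: "norm ((cmod (f z - g z))\<^sup>2) \<le> norm (2 * (cmod (f z))\<^sup>2 + 2 * (cmod (g z))\<^sup>2)" for z
    by simp
  have "integrable P (\<lambda>z. (cmod (f z - g z))\<^sup>2)"
    by (rule Bochner_Integration.integrable_bound[OF dom _ AE_I2[OF bnd]]) measurable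
  then show ?thesis unfolding L2_def by simp
qed

lemma sqdist_eq_integral:
  assumes "f \<in> L2 P" "g \<in> L2 P"
  shows "sqdist P f g = ennreal (\<integral>z. (cmod (f z - g z))\<^sup>2 \<partial>P)"
  unfolding sqdist_def sqnorm_def using L2_diff[OF assms] unfolding L2_def by (intro nn_integral_eq_integral) auto

text \<open>Both \<open>E\<close> and the centred combination are orthogonal to functions of the second coordinate, in
particular to the fibre mean, by which the two combinations differ. The claim is Pythagoras'
theorem.\<close>

lemma centring_decreases_distance:
  assumes M: "prob_space M" and N: "prob_space N" and E: "E \<in> L2_ominus_snd M N"
    and xs: "xs \<in> rect_coeffs M N"
  shows "sqdist (M \<Otimes>\<^sub>M N) E (centred_rect_fun M xs) \<le> sqdist (M \<Otimes>\<^sub>M N) E (rect_fun xs)"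
proof -
  let ?P = "M \<Otimes>\<^sub>M N" and ?G = "centred_rect_fun M xs" and ?q = "\<lambda>z. fibre_mean M xs (snd z)"
  interpret M: prob_space M by fact
  interpret N: prob_space N by fact
  interpret pair_prob_space M N ..
  define b where "b = (\<Sum>x\<leftarrow>xs. cmod (fst x))"
  have EL: "E \<in> L2 ?P" and orth: "\<And>\<phi>. \<phi> \<in> L2 N \<Longrightarrow> (\<integral>z. E z * cnj (\<phi> (snd z)) \<partial>?P) = 0"
    using E unfolding L2_ominus_snd_def by auto
  have [measurable]: "E \<in> borel_measurable ?P" using EL unfolding L2_def by auto
  have [measurable]: "fibre_mean M xs \<in> borel_measurable N" "?G \<in> borel_measurable ?P" using xs by auto
  have bq: "cmod (fibre_mean M xs y) \<le> b" for y unfolding b_def by (rule fibre_mean_bound[OF M])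
  have bG: "cmod (?G z) \<le> b" for z unfolding b_def by (rule centred_rect_fun_bound[OF M])
  have b0: "0 \<le> b" using norm_ge_zero bq by (rule order_trans)
  have GL: "?G \<in> L2 ?P" by (rule bounded_in_L2[OF prob_space_axioms _ bG]) simp
  have qL: "fibre_mean M xs \<in> L2 N" by (rule bounded_in_L2[OF N _ bq]) simp
  have qLP: "?q \<in> L2 ?P" by (rule bounded_in_L2[OF prob_space_axioms _ bq]) simp
  have DL: "(\<lambda>z. E z - ?G z) \<in> L2 ?P" by (rule L2_diff[OF EL GL])
  then have D2: "integrable ?P (\<lambda>z. (cmod (E z - ?G z))\<^sup>2)" by (simp add: L2_def)
  have q2: "integrable ?P (\<lambda>z. (cmod (?q z))\<^sup>2)" using qLP by (simp add: L2_def)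
  have prod_int: "integrable ?P (\<lambda>z. h z * cnj (?q z))" if h: "h \<in> L2 ?P" for h
  proof (rule Bochner_Integration.integrable_bound)
    show "integrable ?P (\<lambda>z. ((cmod (h z))\<^sup>2 + 1) * b)" using h by (simp add: L2_def)
    show "(\<lambda>z. h z * cnj (?q z)) \<in> borel_measurable ?P"
      using h by (auto simp: L2_def intro!: borel_measurable_times measurable_compose[OF _ borel_measurable_continuous_onI[of cnj]] continuous_intros)
    have "cmod (h z) \<le> (cmod (h z))\<^sup>2 + 1" for z
      using zero_le_power2[of "cmod (h z) - 1/2"] by (simp add: power2_eq_square algebra_simps)
    then have "cmod (h z) * cmod (?q z) \<le> ((cmod (h z))\<^sup>2 + 1) * b" for z
      using bq by (intro mult_mono) auto
    then show "AE z in ?P. norm (h z * cnj (?q z)) \<le> norm (((cmod (h z))\<^sup>2 + 1) * b)"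
      using b0 by (auto simp: norm_mult abs_mult)
  qed
  have Gq: "(\<integral>z. ?G z * cnj (?q z) \<partial>?P) = 0"
  proof (rule integral_centred_rect_fun_fibre[OF M N xs])
    show "(\<lambda>y. cnj (fibre_mean M xs y)) \<in> borel_measurable N"
      by (rule measurable_compose[OF _ borel_measurable_continuous_onI[of cnj]]) (auto intro: continuous_intros)
    show "\<And>y. cmod (cnj (fibre_mean M xs y)) \<le> b" using bq by simp
  qed
  have "(\<integral>z. (E z - ?G z) * cnj (?q z) \<partial>?P) = (\<integral>z. E z * cnj (?q z) \<partial>?P) - (\<integral>z. ?G z * cnj (?q z) \<partial>?P)"
    using prod_int[OF EL] prod_int[OF GL] by (simp add: left_diff_distrib)
  then have cross: "(\<integral>z. (E z - ?G z) * cnj (?q z) \<partial>?P) = 0" using orth[OF qL] Gq by simp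
  have cross_int: "integrable ?P (\<lambda>z. (E z - ?G z) * cnj (?q z))" using prod_int[OF DL] .
  have expand: "(cmod (E z - rect_fun xs z))\<^sup>2 =
      (cmod (E z - ?G z))\<^sup>2 + (cmod (?q z))\<^sup>2 - 2 * Re ((E z - ?G z) * cnj (?q z))" for z
  proof -
    have polar: "(cmod (a - b))\<^sup>2 = (cmod a)\<^sup>2 + (cmod b)\<^sup>2 - 2 * Re (a * cnj b)" for a b :: complex
      unfolding cmod_power2 by (simp add: power2_eq_square algebra_simps)
    have "E z - rect_fun xs z = (E z - ?G z) - ?q z"
      by (simp add: rect_fun_eq_centred_plus_mean[of xs z M])
    then show ?thesis using polar[of "E z - ?G z" "?q z"] by (simp only:)
  qed
  have RL: "rect_fun xs \<in> L2 ?P"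
  proof (rule bounded_in_L2[OF prob_space_axioms])
    show "cmod (rect_fun xs z) \<le> b + b" for z
      unfolding rect_fun_eq_centred_plus_mean[of xs z M] using norm_triangle_mono[OF bG bq] .
  qed (use xs in simp)
  have "(\<integral>z. (cmod (E z - rect_fun xs z))\<^sup>2 \<partial>?P) =
      (\<integral>z. (cmod (E z - ?G z))\<^sup>2 \<partial>?P) + (\<integral>z. (cmod (?q z))\<^sup>2 \<partial>?P) - 2 * Re (\<integral>z. (E z - ?G z) * cnj (?q z) \<partial>?P)"
  proof -
    define X where "X z = (E z - ?G z) * cnj (?q z)" for z
    have "integrable ?P X" using cross_int by (simp add: X_def[abs_def])
    then show ?thesis
      unfolding expand X_def[symmetric] using D2 q2 by (simp add: integral_Re)
  qed
  then have "(\<integral>z. (cmod (E z - ?G z))\<^sup>2 \<partial>?P) \<le> (\<integral>z. (cmod (E z - rect_fun xs z))\<^sup>2 \<partial>?P)"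
    unfolding cross by (simp add: integral_nonneg)
  then show ?thesis
    unfolding sqdist_eq_integral[OF EL GL] sqdist_eq_integral[OF EL RL] by (rule ennreal_leI)
qed

lemma sqnorm_finite: "f \<in> L2 P \<Longrightarrow> sqnorm P f < \<infinity>"
  unfolding sqnorm_def L2_def by (auto simp: nn_integral_eq_integral less_top)

text \<open>The bound involves the marginals only. This makes the approximation in \<open>L\<^sup>2\<close> uniform over all
joinings.\<close>

lemma coupling_Cauchy_Schwarz:
  assumes s: "sets \<kappa> = sets (P \<Otimes>\<^sub>M Q)" and d: "distr \<kappa> P fst = P" "distr \<kappa> Q snd = Q"
    and u: "u \<in> L2 P" and v: "v \<in> L2 Q"
  shows "(\<integral>\<^sup>+z. ennreal (cmod (u (fst z) * v (snd z))) \<partial>\<kappa>)\<^sup>2 \<le> sqnorm P u * sqnorm Q v"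
    and "integrable \<kappa> (\<lambda>z. u (fst z) * v (snd z))"
proof -
  note s[measurable_cong]
  have [measurable]: "u \<in> borel_measurable P" "v \<in> borel_measurable Q" using u v by (auto simp: L2_def)
  have e: "ennreal (cmod (u (fst z) * v (snd z))) = ennreal (cmod (u (fst z))) * ennreal (cmod (v (snd z)))" for z
    by (simp add: norm_mult ennreal_mult)
  have "(\<integral>\<^sup>+z. ennreal (cmod (u (fst z) * v (snd z))) \<partial>\<kappa>)\<^sup>2 \<le>
      (\<integral>\<^sup>+z. (ennreal (cmod (u (fst z))))\<^sup>2 \<partial>\<kappa>) * (\<integral>\<^sup>+z. (ennreal (cmod (v (snd z))))\<^sup>2 \<partial>\<kappa>)"
    unfolding e by (rule Cauchy_Schwarz_nn_integral) measurable
  also have "(\<integral>\<^sup>+z. (ennreal (cmod (u (fst z))))\<^sup>2 \<partial>\<kappa>) = sqnorm (distr \<kappa> P fst) u"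
    unfolding sqnorm_def by (subst nn_integral_distr) (auto simp: ennreal_power)
  also have "(\<integral>\<^sup>+z. (ennreal (cmod (v (snd z))))\<^sup>2 \<partial>\<kappa>) = sqnorm (distr \<kappa> Q snd) v"
    unfolding sqnorm_def by (subst nn_integral_distr) (auto simp: ennreal_power)
  finally show *: "(\<integral>\<^sup>+z. ennreal (cmod (u (fst z) * v (snd z))) \<partial>\<kappa>)\<^sup>2 \<le> sqnorm P u * sqnorm Q v"
    unfolding d .
  have "sqnorm P u * sqnorm Q v < \<infinity>"
    using sqnorm_finite[OF u] sqnorm_finite[OF v] by (simp add: ennreal_mult_less_top)
  with * have "(\<integral>\<^sup>+z. ennreal (cmod (u (fst z) * v (snd z))) \<partial>\<kappa>)\<^sup>2 < \<infinity>" by (rule le_less_trans)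
  then have "(\<integral>\<^sup>+z. ennreal (cmod (u (fst z) * v (snd z))) \<partial>\<kappa>) < \<infinity>"
    by (auto simp: power2_eq_square ennreal_mult_less_top less_top)
  then show "integrable \<kappa> (\<lambda>z. u (fst z) * v (snd z))"
    by (intro integrableI_bounded) auto
qed

lemma coupling_correlation_le:
  assumes s: "sets \<kappa> = sets (P \<Otimes>\<^sub>M Q)" and d: "distr \<kappa> P fst = P" "distr \<kappa> Q snd = Q"
    and u: "u \<in> L2 P" and v: "v \<in> L2 Q" and r: "0 \<le> r" "sqnorm P u * sqnorm Q v \<le> ennreal (r\<^sup>2)"
  shows "cmod (\<integral>z. u (fst z) * v (snd z) \<partial>\<kappa>) \<le> r"
proof -
  have "ennreal (cmod (\<integral>z. u (fst z) * v (snd z) \<partial>\<kappa>)) \<le> (\<integral>\<^sup>+z. ennreal (cmod (u (fst z) * v (snd z))) \<partial>\<kappa>)"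
    by (rule integral_norm_bound_ennreal[OF coupling_Cauchy_Schwarz(2)[OF s d u v]])
  then have "(ennreal (cmod (\<integral>z. u (fst z) * v (snd z) \<partial>\<kappa>)))\<^sup>2 \<le> (\<integral>\<^sup>+z. ennreal (cmod (u (fst z) * v (snd z))) \<partial>\<kappa>)\<^sup>2"
    by (rule power_mono) simp
  also have "\<dots> \<le> ennreal (r\<^sup>2)" using coupling_Cauchy_Schwarz(1)[OF s d u v] r(2) by (rule order_trans)
  finally have "(cmod (\<integral>z. u (fst z) * v (snd z) \<partial>\<kappa>))\<^sup>2 \<le> r\<^sup>2"
    by (simp add: ennreal_power)
  then show ?thesis using r(1) by (rule power2_le_imp_le)
qed

lemma coupling_correlation_perturbation:
  assumes s: "sets \<kappa> = sets (P \<Otimes>\<^sub>M Q)" and d: "distr \<kappa> P fst = P" "distr \<kappa> Q snd = Q"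
    and E: "E \<in> L2 P" "E' \<in> L2 P" and F: "F \<in> L2 Q" "F' \<in> L2 Q"
    and r: "0 \<le> r" "sqdist P E E' * sqnorm Q F \<le> ennreal (r\<^sup>2)" "sqnorm P E' * sqdist Q F F' \<le> ennreal (r\<^sup>2)"
  shows "cmod (\<integral>z. E (fst z) * F (snd z) \<partial>\<kappa>) \<le> cmod (\<integral>z. E' (fst z) * F' (snd z) \<partial>\<kappa>) + 2 * r"
proof -
  let ?I = "\<lambda>u v. \<integral>z. u (fst z) * v (snd z) \<partial>\<kappa>"
  note int = coupling_Cauchy_Schwarz(2)[OF s d]
  have "?I (\<lambda>x. E x - E' x) F = ?I E F - ?I E' F"
    using int[OF E(1) F(1)] int[OF E(2) F(1)] by (simp add: left_diff_distrib)
  moreover have "?I E' (\<lambda>x. F x - F' x) = ?I E' F - ?I E' F'"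
    using int[OF E(2) F(1)] int[OF E(2) F(2)] by (simp add: right_diff_distrib)
  ultimately have eq: "?I E F = ?I E' F' + (?I (\<lambda>x. E x - E' x) F + ?I E' (\<lambda>x. F x - F' x))" by simp
  have "cmod (?I E F) \<le> cmod (?I E' F') + (cmod (?I (\<lambda>x. E x - E' x) F) + cmod (?I E' (\<lambda>x. F x - F' x)))"
    unfolding eq by (intro norm_triangle_le add_left_mono norm_triangle_ineq)
  moreover have "cmod (?I (\<lambda>x. E x - E' x) F) \<le> r"
    using r by (intro coupling_correlation_le[OF s d L2_diff[OF E] F(1)]) (auto simp: sqdist_def sqnorm_def)
  moreover have "cmod (?I E' (\<lambda>x. F x - F' x)) \<le> r"
    using r by (intro coupling_correlation_le[OF s d E(2) L2_diff[OF F]]) (auto simp: sqdist_def sqnorm_def)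
  ultimately show ?thesis by simp
qed

lemma ennreal_cmod_sum_list_le:
  fixes f :: "'i \<Rightarrow> complex"
  shows "ennreal (cmod (\<Sum>x\<leftarrow>xs. f x)) \<le> (\<Sum>x\<leftarrow>xs. ennreal (cmod (f x)))"
proof (induction xs)
  case (Cons x xs)
  have "ennreal (cmod (\<Sum>x\<leftarrow>x # xs. f x)) \<le> ennreal (cmod (f x) + cmod (\<Sum>x\<leftarrow>xs. f x))"
    by (intro ennreal_leI) (simp add: norm_triangle_ineq)
  also have "\<dots> \<le> ennreal (cmod (f x)) + (\<Sum>x\<leftarrow>xs. ennreal (cmod (f x)))"
    using Cons by (simp add: ennreal_plus add_left_mono)
  finally show ?case by simp
qed simp

lemma tendsto_sum_list_zero:
  fixes g :: "'i \<Rightarrow> 'x \<Rightarrow> ennreal"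
  assumes "\<And>x. x \<in> set xs \<Longrightarrow> (g x \<longlongrightarrow> 0) F"
  shows "((\<lambda>i. \<Sum>x\<leftarrow>xs. g x i) \<longlongrightarrow> 0) F"
  using assms
proof (induction xs)
  case (Cons x xs)
  then have "((\<lambda>i. g x i + (\<Sum>x\<leftarrow>xs. g x i)) \<longlongrightarrow> 0 + 0) F" by (intro tendsto_add) auto
  then show ?case by simp
qed simp

text \<open>The factor \<open>k\<close> stands for the square norm of the other function in the Cauchy-Schwarz bound. It
is a parameter because the second function is approximated after the first one, with respect
to the norm of the first approximation.\<close>

lemma L2_ominus_snd_approximation:
  assumes M: "prob_space M" and N: "prob_space N" and E: "E \<in> L2_ominus_snd M N"
    and k: "k < (\<infinity>::ennreal)" and r: "0 < r"
  obtains xs where "xs \<in> rect_coeffs M N" "centred_rect_fun M xs \<in> L2 (M \<Otimes>\<^sub>M N)"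
    "sqdist (M \<Otimes>\<^sub>M N) E (centred_rect_fun M xs) * k \<le> ennreal (r\<^sup>2)"
proof -
  interpret M: prob_space M by fact
  interpret N: prob_space N by fact
  interpret P: pair_prob_space M N ..
  obtain k' where k': "k = ennreal k'" "0 \<le> k'" using k by (cases k) auto
  have e: "r\<^sup>2 / (k' + 1) > 0" using r k' by (simp add: add_nonneg_pos)
  have "rect_approximable M N E"
    using E by (intro rect_approximable_L2[OF M N]) (simp add: L2_ominus_snd_def)
  then obtain xs where xs: "xs \<in> rect_coeffs M N" "sqdist (M \<Otimes>\<^sub>M N) E (rect_fun xs) < ennreal (r\<^sup>2 / (k' + 1))"
    using e unfolding rect_approximable_def by blast
  have "sqdist (M \<Otimes>\<^sub>M N) E (centred_rect_fun M xs) * k \<le> ennreal (r\<^sup>2 / (k' + 1)) * ennreal k'"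
    unfolding k'(1) using centring_decreases_distance[OF M N E xs(1)] xs(2)
    by (intro mult_right_mono) auto
  also have "\<dots> = ennreal (r\<^sup>2 * (k' / (k' + 1)))" using k' e by (simp add: ennreal_mult''[symmetric])
  also have "\<dots> \<le> ennreal (r\<^sup>2)" using k' by (intro ennreal_leI mult_left_le) auto
  finally have "sqdist (M \<Otimes>\<^sub>M N) E (centred_rect_fun M xs) * k \<le> ennreal (r\<^sup>2)" .
  moreover have "centred_rect_fun M xs \<in> L2 (M \<Otimes>\<^sub>M N)"
    by (rule bounded_in_L2[OF P.prob_space_axioms centred_rect_fun_measurable[OF xs(1)] centred_rect_fun_bound[OF M]])
  ultimately show thesis using xs(1) by (intro that)
qed

section \<open>Convergence for induced actions\<close>

text \<open>The contribution of one term of each combination to the bound of a joining integral. The pair of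
exponents is a single argument so that limits along pairs of primes apply to it directly.\<close>

definition term_bound ::
    "'g::ab_group_add set \<Rightarrow> 'a measure \<Rightarrow> ('g \<Rightarrow> 'a \<Rightarrow> 'a) \<Rightarrow> nat \<times> nat \<Rightarrow>
     complex \<times> 'a set \<times> 'b set \<Rightarrow> complex \<times> 'a set \<times> 'b set \<Rightarrow> ennreal" where
  "term_bound H M S pq x y = ennreal (cmod (fst x) * cmod (fst y)) *
     joining_sup H M S (fst pq) (snd pq) (centred_indicator M (fst (snd x))) (centred_indicator M (fst (snd y)))"

lemma induced_joining_centred_rect_fun:
  assumes H: "add_subgroup H" and M: "prob_space M" "standard_borel M" and S: "mp_action H M S"
    and erg: "ergodic H M (pow_action S p)" "ergodic H M (pow_action S q)"
    and N: "prob_space N" "space N = range (coset H)"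
    and \<kappa>: "\<kappa> \<in> joinings UNIV (M \<Otimes>\<^sub>M N) (pow_action (induced_action s S) p) (M \<Otimes>\<^sub>M N) (pow_action (induced_action s S) q)"
    and xs: "xs \<in> rect_coeffs M N" and ys: "ys \<in> rect_coeffs M N"
  shows "ennreal (cmod (\<integral>z. centred_rect_fun M xs (fst z) * centred_rect_fun M ys (snd z) \<partial>\<kappa>)) \<le>
    (\<Sum>x\<leftarrow>xs. \<Sum>y\<leftarrow>ys. term_bound H M S (p, q) x y)"
proof -
  let ?P = "M \<Otimes>\<^sub>M N"
  interpret M: prob_space M by fact
  interpret N: prob_space N by fact
  interpret P: pair_prob_space M N ..
  have s: "sets \<kappa> = sets (?P \<Otimes>\<^sub>M ?P)" and d: "distr \<kappa> ?P fst = ?P" "distr \<kappa> ?P snd = ?P"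
    using \<kappa> unfolding joinings_def by blast+
  have xm: "x \<in> UNIV \<times> sets M \<times> sets N" if "x \<in> set xs \<or> x \<in> set ys" for x
    using xs ys that by (auto simp: rect_coeffs_def)
  have tL: "centred_term M x \<in> L2 ?P" if "x \<in> set xs \<or> x \<in> set ys" for x
    by (rule bounded_in_L2[OF P.prob_space_axioms measurable_centred_term[OF xm[OF that]] centred_term_bound[OF M(1)]])
  have int: "integrable \<kappa> (\<lambda>z. centred_term M x (fst z) * centred_term M y (snd z))" if "x \<in> set xs" "y \<in> set ys" for x y
    using that by (intro coupling_Cauchy_Schwarz(2)[OF s d] tL) auto
  have single: "ennreal (cmod (\<integral>z. centred_term M x (fst z) * centred_term M y (snd z) \<partial>\<kappa>)) \<le> term_bound H M S (p, q) x y"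
    if x: "x \<in> set xs" and y: "y \<in> set ys" for x y
  proof -
    obtain c A C where xe: "x = (c, A, C)" and A: "A \<in> sets M" and C: "C \<in> sets N" using xm[of x] x by auto
    obtain d B D where ye: "y = (d, B, D)" and B: "B \<in> sets M" and D: "D \<in> sets N" using xm[of y] y by auto
    let ?I = "\<integral>z. (centred_indicator M A (fst (fst z)) * indicator C (snd (fst z))) *
        (centred_indicator M B (fst (snd z)) * indicator D (snd (snd z))) \<partial>\<kappa>"
    have "(\<integral>z. centred_term M x (fst z) * centred_term M y (snd z) \<partial>\<kappa>) =
        (\<integral>z. (c * d) * ((centred_indicator M A (fst (fst z)) * indicator C (snd (fst z))) *
        (centred_indicator M B (fst (snd z)) * indicator D (snd (snd z)))) \<partial>\<kappa>)"
      by (intro Bochner_Integration.integral_cong) (auto simp: xe ye centred_term_def)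
    also have "\<dots> = (c * d) * ?I" by simp
    finally have "ennreal (cmod (\<integral>z. centred_term M x (fst z) * centred_term M y (snd z) \<partial>\<kappa>)) =
        ennreal (cmod c * cmod d) * ennreal (cmod ?I)"
      by (simp add: norm_mult ennreal_mult)
    also have "\<dots> \<le> ennreal (cmod c * cmod d) * joining_sup H M S p q (centred_indicator M A) (centred_indicator M B)"
      by (intro mult_left_mono induced_joining_correlation[OF H M S erg N \<kappa> A B C D]) simp
    finally show ?thesis by (simp add: term_bound_def xe ye)
  qed
  have "(\<integral>z. centred_rect_fun M xs (fst z) * centred_rect_fun M ys (snd z) \<partial>\<kappa>) =
      (\<integral>z. (\<Sum>x\<leftarrow>xs. \<Sum>y\<leftarrow>ys. centred_term M x (fst z) * centred_term M y (snd z)) \<partial>\<kappa>)"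
    unfolding centred_rect_fun_def by (simp add: sum_list_mult_const sum_list_const_mult)
  also have "\<dots> = (\<Sum>x\<leftarrow>xs. \<integral>z. (\<Sum>y\<leftarrow>ys. centred_term M x (fst z) * centred_term M y (snd z)) \<partial>\<kappa>)"
    by (intro integral_sum_list int)
  also have "\<dots> = (\<Sum>x\<leftarrow>xs. \<Sum>y\<leftarrow>ys. \<integral>z. centred_term M x (fst z) * centred_term M y (snd z) \<partial>\<kappa>)"
    by (rule arg_cong[where f=sum_list], rule map_cong[OF refl]) (intro integral_sum_list int)
  also have "ennreal (cmod \<dots>) \<le> (\<Sum>x\<leftarrow>xs. ennreal (cmod (\<Sum>y\<leftarrow>ys. \<integral>z. centred_term M x (fst z) * centred_term M y (snd z) \<partial>\<kappa>)))"
    by (rule ennreal_cmod_sum_list_le)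
  also have "\<dots> \<le> (\<Sum>x\<leftarrow>xs. \<Sum>y\<leftarrow>ys. term_bound H M S (p, q) x y)"
    by (intro sum_list_mono order_trans[OF ennreal_cmod_sum_list_le] single)
  finally show ?thesis .
qed

theorem proposition7:
  fixes H :: "'g::{topological_ab_group_add, second_countable_topology, t2_space} set"
    and \<nu> :: "'y measure"
    and S :: "'g \<Rightarrow> 'y \<Rightarrow> 'y"
    and m :: "'g set measure"
    and s :: "'g set \<Rightarrow> 'g"
    and E F :: "'y \<times> 'g set \<Rightarrow> complex"
  assumes "locally_compact_space (euclidean :: 'g topology)"
    and "add_subgroup H" and "closed H"
    and "compact_space (quot_topology H)"
    and "no_nontrivial_compact_subgroups H"
    and "prob_space \<nu>" and "standard_borel \<nu>"
    and "AOP H \<nu> S"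
    and "quot_invariant_prob H m"
    and "borel_selector H s"
    and "E \<in> L2_ominus_snd \<nu> m" and "F \<in> L2_ominus_snd \<nu> m"
  shows "((\<lambda>(p, q). joining_sup UNIV (\<nu> \<Otimes>\<^sub>M m) (induced_action s S) p q E F) \<longlongrightarrow> 0)
           distinct_primes_at_top"
proof -
  let ?P = "\<nu> \<Otimes>\<^sub>M m"
  note H = \<open>add_subgroup H\<close> and \<nu> = \<open>prob_space \<nu>\<close> \<open>standard_borel \<nu>\<close>
  have m: "prob_space m" "space m = range (coset H)"
    using \<open>quot_invariant_prob H m\<close> unfolding quot_invariant_prob_def by blast+
  have S: "mp_action H \<nu> S" and erg: "\<And>p. prime p \<Longrightarrow> ergodic H \<nu> (pow_action S p)"
    and lim: "\<And>f g. f \<in> L2_0 \<nu> \<Longrightarrow> g \<in> L2_0 \<nu> \<Longrightarrow>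
      ((\<lambda>(p, q). joining_sup H \<nu> S p q f g) \<longlongrightarrow> 0) distinct_primes_at_top"
    using \<open>AOP H \<nu> S\<close> unfolding AOP_def by blast+
  have EL: "E \<in> L2 ?P" and FL: "F \<in> L2 ?P"
    using \<open>E \<in> L2_ominus_snd \<nu> m\<close> \<open>F \<in> L2_ominus_snd \<nu> m\<close> unfolding L2_ominus_snd_def by auto
  have primes: "\<forall>\<^sub>F pq in distinct_primes_at_top. prime (fst pq) \<and> prime (snd pq)"
    unfolding distinct_primes_at_top_def by (auto simp: eventually_inf_principal intro: always_eventually)
  show ?thesis
  proof (rule order_tendstoI)
    fix a :: ennreal assume "0 < a"
    then obtain a' where a': "0 < a'" "a' < a" using dense by blast
    then obtain r3 where r3: "a' = ennreal r3" "0 \<le> r3" by (cases a') auto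
    \<comment> \<open>one third for each of the two approximations, one third for the limit\<close>
    define r where "r = r3 / 3"
    have r: "0 < r" "ennreal (3 * r) < a" using a' r3 by (auto simp: r_def)
    obtain xs where xs: "xs \<in> rect_coeffs \<nu> m" and E': "centred_rect_fun \<nu> xs \<in> L2 ?P"
      and dE: "sqdist ?P E (centred_rect_fun \<nu> xs) * sqnorm ?P F \<le> ennreal (r\<^sup>2)"
      by (rule L2_ominus_snd_approximation[OF \<nu>(1) m(1) \<open>E \<in> L2_ominus_snd \<nu> m\<close> sqnorm_finite[OF FL] r(1)])
    obtain ys where ys: "ys \<in> rect_coeffs \<nu> m" and F': "centred_rect_fun \<nu> ys \<in> L2 ?P"
      and dF: "sqdist ?P F (centred_rect_fun \<nu> ys) * sqnorm ?P (centred_rect_fun \<nu> xs) \<le> ennreal (r\<^sup>2)"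
      by (rule L2_ominus_snd_approximation[OF \<nu>(1) m(1) \<open>F \<in> L2_ominus_snd \<nu> m\<close> sqnorm_finite[OF E'] r(1)])
    have "((\<lambda>pq. \<Sum>x\<leftarrow>xs. \<Sum>y\<leftarrow>ys. term_bound H \<nu> S pq x y) \<longlongrightarrow> 0) distinct_primes_at_top"
    proof (intro tendsto_sum_list_zero)
      fix x y assume xy: "x \<in> set xs" "y \<in> set ys"
      have "centred_indicator \<nu> (fst (snd x)) \<in> L2_0 \<nu>" "centred_indicator \<nu> (fst (snd y)) \<in> L2_0 \<nu>"
        using xs ys xy by (auto simp: rect_coeffs_def intro!: centred_indicator_L2_0[OF \<nu>(1)])
      from lim[OF this] show "((\<lambda>pq. term_bound H \<nu> S pq x y) \<longlongrightarrow> 0) distinct_primes_at_top"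
        unfolding term_bound_def case_prod_beta'
        by (intro ennreal_tendsto_cmult[where x=0, simplified]) auto
    qed
    then have "\<forall>\<^sub>F pq in distinct_primes_at_top. (\<Sum>x\<leftarrow>xs. \<Sum>y\<leftarrow>ys. term_bound H \<nu> S pq x y) < ennreal r"
      using r(1) by (intro order_tendstoD(2)) auto
    with primes show "\<forall>\<^sub>F pq in distinct_primes_at_top.
        (case pq of (p, q) \<Rightarrow> joining_sup UNIV ?P (induced_action s S) p q E F) < a"
    proof eventually_elim
      case (elim pq)
      obtain p q where pq: "pq = (p, q)" by (cases pq)
      have "joining_sup UNIV ?P (induced_action s S) p q E F \<le> ennreal (3 * r)"
        unfolding joining_sup_def
      proof (rule SUP_least)
        fix \<kappa> assume "\<kappa> \<in> ergodic_joinings UNIV ?P (pow_action (induced_action s S) p) ?P (pow_action (induced_action s S) q)"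
        then have \<kappa>: "\<kappa> \<in> joinings UNIV ?P (pow_action (induced_action s S) p) ?P (pow_action (induced_action s S) q)"
          unfolding joinings_def ergodic_joinings_def by blast
        have s\<kappa>: "sets \<kappa> = sets (?P \<Otimes>\<^sub>M ?P)" "distr \<kappa> ?P fst = ?P" "distr \<kappa> ?P snd = ?P"
          using \<kappa> unfolding joinings_def by blast+
        let ?I' = "\<integral>z. centred_rect_fun \<nu> xs (fst z) * centred_rect_fun \<nu> ys (snd z) \<partial>\<kappa>"
        have "ennreal (cmod ?I') \<le> (\<Sum>x\<leftarrow>xs. \<Sum>y\<leftarrow>ys. term_bound H \<nu> S (p, q) x y)"
          using elim(1) erg pq
          by (intro induced_joining_centred_rect_fun[OF H \<nu> S _ _ m \<kappa> xs ys]) auto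
        also have "\<dots> < ennreal r" using elim(2) pq by simp
        finally have "cmod ?I' < r" by (simp add: ennreal_less_iff)
        moreover have "cmod (\<integral>z. E (fst z) * F (snd z) \<partial>\<kappa>) \<le> cmod ?I' + 2 * r"
          using r(1) dE dF by (intro coupling_correlation_perturbation[OF s\<kappa> EL E' FL F']) (auto simp: mult.commute)
        ultimately show "ennreal (cmod (\<integral>z. E (fst z) * F (snd z) \<partial>\<kappa>)) \<le> ennreal (3 * r)"
          by (intro ennreal_leI) linarith
      qed
      then show ?case using r(2) pq by simp
    qed
  qed simp
qed

end
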